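(* Let $k\ge 0$ be an integer, let $P(z)=b_nz^n+b_{n-1}z^{n-1}+\dots+b_0$ be a polynomial with complex constant coefficients, $b_n\neq 0$, of degree $n$, and let $m$ be the number of distinct zeros of $P$. Let $f$ be a transcendental meromorphic (resp. transcendental entire) function of zero order, and let $\alpha(z)$ be a non-zero small function of $f$. Let $$L_k(f,E_q)(z)=a_kf(q_kz+c_k)+a_{k-1}f(q_{k-1}z+c_{k-1})+\dots+a_0f(q_0z+c_0),$$ where $a_0,\dots,a_k$, $c_0,\dots,c_k$ and $q_0,\dots,q_k$ are complex constants with all $q_j\neq 0$. If $n>m+3k+4$ (resp. $n>m+k$), then $P(f)L_k(f,E_q)-\alpha(z)$ has infinitely many zeros.
   Context: Meromorphic means meromorphic in the whole complex plane $\mathbb{C}$. $T(r,f)$ is the Nevanlinna characteristic; zero order means $\limsup_{r\to\infty}\log^+T(r,f)/\log r=0$. A meromorphic function $\alpha$ is a small function of $f$ if $T(r,\alpha)=S(r,f)$, i.e. $T(r,\alpha)=o(T(r,f))$ as $r\to\infty$ outside a possible exceptional set of finite linear measure.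
   Formalization: The formal theorem additionally assumes that L_k(f,E_q) is not identically zero; without this the claim fails, e.g. for all a_j = 0 and α = 1, where P(f)L_k(f,E_q) − α = −1 has no zeros. *)

theory Defs
  imports "HOL-Complex_Analysis.Complex_Analysis" "HOL-Library.Landau_Symbols"
begin

text \<open>
  Meromorphic functions are represented by total functions that are \<open>meromorphic_on UNIV\<close>. Their
  values at poles and at removable singularities are arbitrary, so all notions below are insensitive
  to changing a function on a closed discrete set; identities between meromorphic functions are
  stated up to such a set, by means of \<open>cosparse UNIV\<close>.
\<close>

definition log_plus :: "real \<Rightarrow> real" where
  "log_plus x = ln (max 1 x)"

text \<open>Poles are counted with multiplicity; \<open>zorder\<close> is negative at a pole.\<close>

definition pole_count :: "real \<Rightarrow> (complex \<Rightarrow> complex) \<Rightarrow> nat" where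
  "pole_count r f = (\<Sum>z | norm z \<le> r \<and> is_pole f z. nat (- zorder f z))"

definition nevanlinna_N :: "real \<Rightarrow> (complex \<Rightarrow> complex) \<Rightarrow> real" where
  "nevanlinna_N r f =
     integral {0..r} (\<lambda>t. (real (pole_count t f) - real (pole_count 0 f)) / t)
       + real (pole_count 0 f) * ln r"

definition nevanlinna_m :: "real \<Rightarrow> (complex \<Rightarrow> complex) \<Rightarrow> real" where
  "nevanlinna_m r f =
     1 / (2 * pi) * integral {0..2 * pi} (\<lambda>\<theta>. log_plus (norm (f (of_real r * cis \<theta>))))"

definition nevanlinna_T :: "real \<Rightarrow> (complex \<Rightarrow> complex) \<Rightarrow> real" where
  "nevanlinna_T r f = nevanlinna_m r f + nevanlinna_N r f"

definition zero_order :: "(complex \<Rightarrow> complex) \<Rightarrow> bool" where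
  "zero_order f \<longleftrightarrow>
     Limsup at_top (\<lambda>r. ereal (log_plus (nevanlinna_T r f) / ln r)) = 0"

text \<open>\<open>S(r, f)\<close>: the exceptional set \<open>E\<close> has finite Lebesgue measure.\<close>

definition nevanlinna_S :: "(complex \<Rightarrow> complex) \<Rightarrow> (real \<Rightarrow> real) set" where
  "nevanlinna_S f =
     {\<phi>. \<exists>E \<in> lmeasurable. \<phi> \<in> o[inf at_top (principal (- E))](\<lambda>r. nevanlinna_T r f)}"

definition small_function :: "(complex \<Rightarrow> complex) \<Rightarrow> (complex \<Rightarrow> complex) \<Rightarrow> bool" where
  "small_function \<alpha> f \<longleftrightarrow>
     \<alpha> meromorphic_on UNIV \<and> (\<lambda>r. nevanlinna_T r \<alpha>) \<in> nevanlinna_S f"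

text \<open>Transcendental means not rational; an entire function is rational iff it is a polynomial.\<close>

definition transcendental_meromorphic :: "(complex \<Rightarrow> complex) \<Rightarrow> bool" where
  "transcendental_meromorphic f \<longleftrightarrow>
     f meromorphic_on UNIV \<and>
     \<not> (\<exists>p q :: complex poly. q \<noteq> 0 \<and> (\<forall>\<^sub>\<approx>z. f z = poly p z / poly q z))"

definition transcendental_entire :: "(complex \<Rightarrow> complex) \<Rightarrow> bool" where
  "transcendental_entire f \<longleftrightarrow> f holomorphic_on UNIV \<and> transcendental_meromorphic f"

definition nonzero_function :: "(complex \<Rightarrow> complex) \<Rightarrow> bool" where
  "nonzero_function f \<longleftrightarrow> \<not> (\<forall>\<^sub>\<approx>z. f z = 0)"

definition L_op ::
  "nat \<Rightarrow> (nat \<Rightarrow> complex) \<Rightarrow> (nat \<Rightarrow> complex) \<Rightarrow> (nat \<Rightarrow> complex)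
     \<Rightarrow> (complex \<Rightarrow> complex) \<Rightarrow> complex \<Rightarrow> complex" where
  "L_op k a q c f z = (\<Sum>j\<le>k. a j * f (q j * z + c j))"

text \<open>
  \<open>isolated_zero\<close> is expressed by punctured limits, so it sees the zeros of the meromorphic function
  represented by \<open>g\<close>, not accidental values of \<open>g\<close> at its singularities.
\<close>

definition has_infinitely_many_zeros :: "(complex \<Rightarrow> complex) \<Rightarrow> bool" where
  "has_infinitely_many_zeros g \<longleftrightarrow> infinite {z. isolated_zero g z}"

end

theory Submission
  imports Defs "HOL-Computational_Algebra.Fundamental_Theorem_Algebra"
begin

text \<open>
  For functions of zero order there are arbitrarily large windows of radii, of ratio as large as one
  likes, in which \<open>T(r, f)\<close> at most doubles. Jensen's formula then leaves only \<open>o(T(r, f))\<close> zeros and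
  poles in the window, and after removing them by a finite product one is left with an exponential
  whose logarithm is almost constant on a much smaller disc, by the Schwarz formula. Three estimates
  follow, each up to \<open>o(T(r, f))\<close>: \<open>T(r, f(q z + c)) \<le> T(r, f)\<close>; \<open>m(r, u'/u) = 0\<close>; and a function
  with few zeros and few poles has a negligible characteristic.

  Put \<open>F = P(f) L\<close> and suppose that \<open>F - \<alpha>\<close> has finitely many zeros; \<open>T(r, F)\<close> is at least
  \<open>(n - k - 1) T(r, f)\<close>. In the meromorphic case the second main theorem for \<open>F/\<alpha>\<close> and the values
  \<open>0, 1, \<infinity>\<close> bounds \<open>T(r, F)\<close> by \<open>(m + 2 k + 3) T(r, f)\<close>. In the entire case \<open>F - \<alpha>\<close> has few zeros and
  few poles, so that \<open>T(r, F)\<close> would be negligible.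

  All means are taken over circles on which the functions involved are analytic and nonzero; this
  excludes only countably many radii and makes every integrand continuous.
\<close>

section \<open>Means over circles\<close>

text \<open>The obstacle is that |q_j| need not be 1: \<open>q z + c\<close> moves a circle to
  another radius, so characteristics at different radii must be compared. Zero order permits this
  only in a sequence of windows, which suffices for a contradiction; the exceptional set of \<alpha>
  is avoided when the radii are chosen. With T(r') <= 2 T(r), Jensen's formula gives n(r) ln(r'/r) =
  O(T), and r'/r is unbounded, so n(r) = o(T). An estimate at \<open>\<rho> s\<close> uses
  \<open>\<rho> (s+1)\<close> for the Schwarz formula and \<open>\<rho> (s+2)\<close> for the number
  of zeros and poles. Two estimates are nested (shifts inside L, then F/\<alpha> or F - \<alpha>),
  hence five radii per window. Constants and multiples of ln r are o(T) because f is transcendental.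
  In m + 2 k + 3 the poles of f account for 1, the distinct zeros of P for m, the zeros and the
  poles of L for k + 1 each. Recovering P(f) = F/L costs another k + 1, whence n <= m + 3 k + 4. The
  entire case uses only n > k + 1, which follows from n > m + k because m >= 1.\<close>

definition circle_mean :: "real \<Rightarrow> (complex \<Rightarrow> real) \<Rightarrow> real" where
  "circle_mean r \<phi> = 1 / (2 * pi) * integral {0..2 * pi} (\<lambda>\<theta>. \<phi> (of_real r * cis \<theta>))"

lemma nevanlinna_m_circle_mean: "nevanlinna_m r f = circle_mean r (\<lambda>z. log_plus (norm (f z)))"
  by (simp add: nevanlinna_m_def circle_mean_def)

lemma continuous_on_circle:
  fixes \<phi> :: "complex \<Rightarrow> 'a::topological_space"
  assumes "0 \<le> r" "continuous_on (sphere 0 r) \<phi>"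
  shows "continuous_on A (\<lambda>\<theta>. \<phi> (of_real r * cis \<theta>))"
  by (rule continuous_on_compose2[OF assms(2)])
     (use assms(1) in \<open>auto intro!: continuous_intros simp: norm_mult\<close>)

lemma circle_integrable:
  fixes \<phi> :: "complex \<Rightarrow> 'a::banach"
  assumes "0 \<le> r" "continuous_on (sphere 0 r) \<phi>"
  shows "(\<lambda>\<theta>. \<phi> (of_real r * cis \<theta>)) integrable_on {0..2 * pi}"
  by (intro integrable_continuous_real continuous_on_circle assms)

lemma circle_mean_cong:
  assumes "0 \<le> r" "\<And>z. norm z = r \<Longrightarrow> \<phi> z = \<psi> z"
  shows "circle_mean r \<phi> = circle_mean r \<psi>"
proof -
  have "\<phi> (of_real r * cis \<theta>) = \<psi> (of_real r * cis \<theta>)" for \<theta>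
    using assms by (auto simp: norm_mult)
  thus ?thesis by (simp add: circle_mean_def)
qed

lemma circle_mean_const [simp]: "circle_mean r (\<lambda>_. c) = c"
  by (simp add: circle_mean_def)

lemma circle_mean_add:
  assumes "0 \<le> r" "continuous_on (sphere 0 r) \<phi>" "continuous_on (sphere 0 r) \<psi>"
  shows "circle_mean r (\<lambda>z. \<phi> z + \<psi> z) = circle_mean r \<phi> + circle_mean r \<psi>"
  unfolding circle_mean_def
  by (subst integral_add[OF circle_integrable[OF assms(1,2)] circle_integrable[OF assms(1,3)]])
     (simp add: algebra_simps)

lemma circle_mean_diff:
  assumes "0 \<le> r" "continuous_on (sphere 0 r) \<phi>" "continuous_on (sphere 0 r) \<psi>"
  shows "circle_mean r (\<lambda>z. \<phi> z - \<psi> z) = circle_mean r \<phi> - circle_mean r \<psi>"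
  unfolding circle_mean_def
  by (subst integral_diff[OF circle_integrable[OF assms(1,2)] circle_integrable[OF assms(1,3)]])
     (simp add: algebra_simps)

lemma circle_mean_cmult: "circle_mean r (\<lambda>z. c * \<phi> z) = c * circle_mean r \<phi>"
  by (simp add: circle_mean_def)

lemma circle_mean_sum:
  assumes "0 \<le> r" "finite I" "\<And>i. i \<in> I \<Longrightarrow> continuous_on (sphere 0 r) (\<phi> i)"
  shows "circle_mean r (\<lambda>z. \<Sum>i\<in>I. \<phi> i z) = (\<Sum>i\<in>I. circle_mean r (\<phi> i))"
  using assms(2,3)
proof (induction rule: finite_induct)
  case (insert x F)
  have "circle_mean r (\<lambda>z. \<phi> x z + (\<Sum>i\<in>F. \<phi> i z)) = circle_mean r (\<phi> x) + circle_mean r (\<lambda>z. \<Sum>i\<in>F. \<phi> i z)"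
    using insert assms(1) by (intro circle_mean_add continuous_on_sum) auto
  thus ?case using insert by simp
qed auto

lemma circle_mean_mono:
  assumes "0 \<le> r" "continuous_on (sphere 0 r) \<phi>" "continuous_on (sphere 0 r) \<psi>"
    and "\<And>z. norm z = r \<Longrightarrow> \<phi> z \<le> \<psi> z"
  shows "circle_mean r \<phi> \<le> circle_mean r \<psi>"
  unfolding circle_mean_def using assms
  by (intro mult_left_mono integral_le circle_integrable) (auto simp: norm_mult)

lemma circle_mean_le_const:
  assumes "0 \<le> r" "continuous_on (sphere 0 r) \<phi>" "\<And>z. norm z = r \<Longrightarrow> \<phi> z \<le> c"
  shows "circle_mean r \<phi> \<le> c"
  using circle_mean_mono[OF assms(1,2) continuous_on_const assms(3)] by simp

lemma circle_mean_nonneg: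
  assumes "0 \<le> r" "continuous_on (sphere 0 r) \<phi>" "\<And>z. norm z = r \<Longrightarrow> 0 \<le> \<phi> z"
  shows "0 \<le> circle_mean r \<phi>"
  using circle_mean_mono[OF assms(1) continuous_on_const assms(2) assms(3)] by simp

text \<open>On |z| = r one has dz = i z d\<theta>. This turns contour integrals into the angular
  integrals of \<open>circle_mean\<close>, at the price of a factor z in the integrand and a
  division of the value by i.\<close>

lemma has_integral_circle:
  assumes "(f has_contour_integral I) (circlepath 0 r)"
  shows "((\<lambda>\<theta>. f (of_real r * cis \<theta>) * (of_real r * cis \<theta>)) has_integral (I / \<i>)) {0..2 * pi}"
proof -
  have "((\<lambda>t. f (0 + r * cis t) * r * \<i> * cis t) has_integral I) {0..2*pi}"
    using assms has_contour_integral_part_circlepath_iff[of 0 "2*pi" f I 0 r]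
    by (simp add: circlepath_def)
  from has_integral_mult_left[OF this, of "1 / \<i>"] show ?thesis
    by (simp add: field_simps)
qed

lemma circle_integral_holomorphic:
  fixes h :: "complex \<Rightarrow> complex"
  assumes "h holomorphic_on ball 0 R" "0 < r" "r < R"
  shows "((\<lambda>\<theta>. h (of_real r * cis \<theta>)) has_integral (2 * pi * h 0)) {0..2 * pi}"
proof -
  have "((\<lambda>u. h u / (u - 0)) has_contour_integral 2 * of_real pi * \<i> * h 0) (circlepath 0 r)"
    by (rule Cauchy_integral_circlepath_simple)
       (use assms in \<open>auto intro!: holomorphic_on_subset[OF assms(1)]\<close>)
  from has_integral_circle[OF this] show ?thesis
    using assms(2) by (simp add: mult_ac)
qed

lemma circle_mean_Re_holomorphic:
  assumes "h holomorphic_on ball 0 R" "0 < r" "r < R"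
  shows "circle_mean r (\<lambda>z. Re (h z)) = Re (h 0)"
proof -
  have "((\<lambda>\<theta>. Re (h (of_real r * cis \<theta>))) has_integral Re (2 * pi * h 0)) {0..2 * pi}"
    using has_integral_linear[OF circle_integral_holomorphic[OF assms] bounded_linear_Re]
    by (simp add: o_def)
  thus ?thesis by (simp add: circle_mean_def integral_unique)
qed

text \<open>A zero-free holomorphic function on a disc is exp h, and ln |g| = Re h then has the mean
  value property.\<close>

lemma circle_mean_ln_nonvanishing:
  assumes "g holomorphic_on ball 0 R" "\<And>z. z \<in> ball 0 R \<Longrightarrow> g z \<noteq> 0" "0 < r" "r < R"
  shows "circle_mean r (\<lambda>z. ln (norm (g z))) = ln (norm (g 0))"
proof -
  obtain h where h: "h holomorphic_on ball 0 R" "\<And>z. z \<in> ball 0 R \<Longrightarrow> g z = exp (h z)"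
    using holomorphic_convex_primitive contractible_imp_holomorphic_log[OF assms(1)] assms(2)
      convex_imp_contractible[OF convex_ball] by metis
  have "circle_mean r (\<lambda>z. ln (norm (g z))) = circle_mean r (\<lambda>z. Re (h z))"
    by (rule circle_mean_cong) (use assms h(2) in auto)
  also have "\<dots> = Re (h 0)" by (rule circle_mean_Re_holomorphic[OF h(1) assms(3,4)])
  also have "\<dots> = ln (norm (g 0))" using h(2)[of 0] assms by simp
  finally show ?thesis .
qed

text \<open>On the circle, \<open>|z - a| = |r - cnj a * z / r|\<close>, which has no zero in the disc when \<open>|a| < r\<close>.\<close>

lemma circle_mean_ln_linear:
  assumes "0 < r" "norm a \<noteq> r"
  shows "circle_mean r (\<lambda>z. ln (norm (z - a))) = ln (max r (norm a))"
proof (cases "norm a > r")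
  case True
  have "circle_mean r (\<lambda>z. ln (norm (z - a))) = ln (norm (0 - a))"
    by (rule circle_mean_ln_nonvanishing[of _ "norm a"]) (use True assms in \<open>auto intro!: holomorphic_intros\<close>)
  thus ?thesis using True by simp
next
  case False
  hence a: "norm a < r" using assms by simp
  have eq: "norm (z - a) = norm (of_real r - cnj a * z / of_real r)" if "norm z = r" for z
  proof -
    have "z \<noteq> 0" using that assms by auto
    have "z * cnj z = of_real (r\<^sup>2)" using that by (metis complex_norm_square of_real_power)
    hence "of_real r - cnj a * z / of_real r = z * (cnj z - cnj a) / of_real r"
      using assms by (simp add: field_simps power2_eq_square)
    hence "norm (of_real r - cnj a * z / of_real r) = norm z * norm (cnj (z - a)) / r"
      using assms by (simp add: norm_mult norm_divide)
    thus ?thesis using that assms by (simp del: complex_cnj_diff)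
  qed
  have "circle_mean r (\<lambda>z. ln (norm (z - a))) = circle_mean r (\<lambda>z. ln (norm (of_real r - cnj a * z / of_real r)))"
    by (rule circle_mean_cong) (use eq assms in auto)
  also have "\<dots> = ln (norm (of_real r - cnj a * 0 / of_real r))"
  \<comment> \<open>For a nonzero, the new function vanishes only at r^2 / cnj a, outside the
    circle. Taking the midpoint of |a| and r as denominator instead of |a| gives a radius that still
    exceeds r, does not reach that zero, and makes sense for a = 0.\<close>
  proof (rule circle_mean_ln_nonvanishing[of _ "r\<^sup>2 / (norm a + (r - norm a)/2)"])
    show "r < r\<^sup>2 / (norm a + (r - norm a)/2)"
      using a assms by (simp add: field_simps power2_eq_square add_pos_nonneg)
    fix z :: complex assume z: "z \<in> ball 0 (r\<^sup>2 / (norm a + (r - norm a)/2))"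
    show "of_real r - cnj a * z / of_real r \<noteq> 0"
    proof
      assume "of_real r - cnj a * z / of_real r = 0"
      hence "cnj a * z = of_real (r\<^sup>2)" using assms by (simp add: field_simps power2_eq_square)
      hence "norm (cnj a * z) = r\<^sup>2" by (simp only: norm_of_real) simp
      hence "norm a * norm z = r\<^sup>2" by (simp add: norm_mult)
      moreover have "(norm a + (r - norm a)/2) * norm z < r\<^sup>2"
        using z a assms by (simp add: field_simps add_pos_nonneg)
      moreover have "norm a * norm z \<le> (norm a + (r - norm a)/2) * norm z"
        by (rule mult_right_mono) (use a in auto)
      ultimately show False by simp
    qed
  qed (use assms in \<open>auto intro!: holomorphic_intros\<close>)
  finally show ?thesis using a assms by simp
qed

text \<open>This is the differentiated Schwarz formula: pi h'(z) is the integral over \<theta> of Re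
  h(w) w / (w - z)^2, where w runs over the circle. Only the real part may occur in the bound, since
  ln |u| controls Re h but not h. As |w - z| >= R/2, the kernel is at most 4/R in modulus, and the
  factor 2 in h + cnj h = 2 Re h makes this 8/R.\<close>

lemma deriv_bound_circle_mean_Re:
  assumes h: "h holomorphic_on ball 0 R'" and R: "0 < R" "R < R'" and z: "norm z \<le> R / 2"
  shows "norm (deriv h z) \<le> 8 / R * circle_mean R (\<lambda>w. \<bar>Re (h w)\<bar>)"
proof -
  let ?w = "\<lambda>\<theta>. complex_of_real R * cis \<theta>"
  have zR: "norm z < R" using z R by auto
  have hR: "h holomorphic_on cball 0 R" by (rule holomorphic_on_subset[OF h]) (use R in auto)
  have cont: "continuous_on (sphere 0 R) h"
    by (rule holomorphic_on_imp_continuous_on[OF holomorphic_on_subset[OF hR]]) auto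
  have ne: "R\<^sup>2 - cnj z * w \<noteq> 0" if "norm w < 2 * R" for w
  proof
    assume "R\<^sup>2 - cnj z * w = 0"
    hence "cnj z * w = of_real (R\<^sup>2)" by simp
    hence "norm (cnj z * w) = norm (complex_of_real (R\<^sup>2))" by (rule arg_cong)
    hence "norm z * norm w = R\<^sup>2" by (simp add: norm_mult norm_power)
    moreover have "norm z * norm w \<le> (R/2) * norm w" using z that R by (intro mult_right_mono) auto
    moreover have "(R/2) * norm w < (R/2) * (2 * R)" using that R by (intro mult_strict_left_mono) auto
    ultimately show False by (simp add: power2_eq_square)
  qed
  have I1: "((\<lambda>\<theta>. h (?w \<theta>) / (?w \<theta> - z)^2 * ?w \<theta>) has_integral (2 * pi * deriv h z)) {0..2*pi}"
  proof -
    have "((\<lambda>u. h u / (u - z) ^ Suc 1) has_contour_integral (2 * pi * \<i>) / fact 1 * (deriv ^^ 1) h z) (circlepath 0 R)"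
      by (rule Cauchy_has_contour_integral_higher_derivative_circlepath)
         (use zR R in \<open>auto intro!: holomorphic_on_imp_continuous_on holomorphic_on_subset[OF hR]\<close>)
    hence 1: "((\<lambda>u. h u / (u - z) ^ 2) has_contour_integral (2 * pi * \<i> * deriv h z)) (circlepath 0 R)"
      by (simp add: numeral_2_eq_2)
    have "2 * pi * \<i> * deriv h z / \<i> = 2 * pi * deriv h z" by simp
    thus ?thesis using has_integral_circle[OF 1] by metis
  qed
  \<comment> \<open>The antiholomorphic half contributes nothing: on the circle cnj w = R^2 / w, so
    the integrand is the conjugate of a function of w whose denominator vanishes only at modulus at
    least 2 R, and Cauchy's theorem applies.\<close>
  have I2: "((\<lambda>\<theta>. cnj (h (?w \<theta>)) / (?w \<theta> - z)^2 * ?w \<theta>) has_integral 0) {0..2*pi}"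
  proof -
    have "((\<lambda>w. h w * R\<^sup>2 / (R\<^sup>2 - cnj z * w)\<^sup>2) has_contour_integral 0) (circlepath 0 R)"
      by (rule Cauchy_theorem_disc_simple[of _ 0 "min R' (2 * R)"])
         (use R ne in \<open>auto intro!: holomorphic_intros holomorphic_on_subset[OF h]\<close>)
    from has_integral_linear[OF has_integral_circle[OF this] bounded_linear_cnj]
    have *: "((\<lambda>\<theta>. cnj (h (?w \<theta>) * R\<^sup>2 / (R\<^sup>2 - cnj z * ?w \<theta>)\<^sup>2 * ?w \<theta>)) has_integral 0) {0..2*pi}"
      by (simp add: o_def)
    have "cnj (h (?w \<theta>) * R\<^sup>2 / (R\<^sup>2 - cnj z * ?w \<theta>)\<^sup>2 * ?w \<theta>) = cnj (h (?w \<theta>)) / (?w \<theta> - z)^2 * ?w \<theta>" for \<theta>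
    proof -
      define w where "w = ?w \<theta>"
      have nw: "norm w = R" using R by (simp add: w_def norm_mult)
      hence w0: "w \<noteq> 0" "w \<noteq> z" using R zR by auto
      have "w * cnj w = of_real (R\<^sup>2)" using nw by (metis complex_norm_square of_real_power)
      hence c: "cnj w = R\<^sup>2 / w" using w0 by (simp add: field_simps)
      have *: "x / (x * d / w)\<^sup>2 * (x / w) = w / d\<^sup>2" if "d \<noteq> 0" "x \<noteq> 0" for x d :: complex
        using that w0 by (simp add: field_simps power2_eq_square)
      have "R\<^sup>2 - z * cnj w = R\<^sup>2 * (w - z) / w" using w0 by (simp add: c field_simps)
      hence "cnj (R\<^sup>2 / (R\<^sup>2 - cnj z * w)\<^sup>2 * w) = R\<^sup>2 / (R\<^sup>2 * (w - z) / w)\<^sup>2 * (R\<^sup>2 / w)"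
        by (simp add: c)
      also have "\<dots> = w / (w - z)\<^sup>2" by (rule *) (use w0 R in auto)
      finally have "cnj (h w) * cnj (R\<^sup>2 / (R\<^sup>2 - cnj z * w)\<^sup>2 * w) = cnj (h w) * (w / (w - z)\<^sup>2)"
        by (rule arg_cong)
      thus ?thesis unfolding w_def by (simp add: field_simps)
    qed
    thus ?thesis using * by simp
  qed
  have I3: "((\<lambda>\<theta>. of_real (2 * Re (h (?w \<theta>))) * (?w \<theta> / (?w \<theta> - z)^2)) has_integral (2 * pi * deriv h z)) {0..2*pi}"
  proof -
    have "h x / (x - z)^2 * x + cnj (h x) / (x - z)^2 * x = of_real (2 * Re (h x)) * (x / (x - z)^2)" for x
      unfolding complex_add_cnj[symmetric] by (simp add: add_divide_distrib algebra_simps)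
    thus ?thesis using has_integral_add[OF I1 I2] by simp
  qed
  have intR: "(\<lambda>\<theta>. \<bar>Re (h (?w \<theta>))\<bar>) integrable_on {0..2*pi}"
    by (rule circle_integrable) (use R cont in \<open>auto intro!: continuous_intros\<close>)
  have "norm (integral {0..2*pi} (\<lambda>\<theta>. of_real (2 * Re (h (?w \<theta>))) * (?w \<theta> / (?w \<theta> - z)^2)))
        \<le> integral {0..2*pi} (\<lambda>\<theta>. 8 / R * \<bar>Re (h (?w \<theta>))\<bar>)"
  proof (rule integral_norm_bound_integral)
    fix \<theta> assume "\<theta> \<in> {0..2*pi}"
    define w where "w = ?w \<theta>"
    have nw: "norm w = R" using R by (simp add: w_def norm_mult)
    have "norm (w - z) \<ge> R / 2" using norm_triangle_ineq2[of w z] nw z by simp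
    hence "norm ((w - z)^2) \<ge> (R/2)^2" unfolding norm_power using R by (intro power_mono) auto
    hence "norm (w / (w - z)^2) \<le> R / (R/2)^2"
      unfolding norm_divide nw using R by (intro divide_left_mono mult_pos_pos) (auto intro: less_le_trans[rotated])
    also have "\<dots> = 4 / R" using R by (simp add: field_simps power2_eq_square)
    finally have "2 * \<bar>Re (h w)\<bar> * norm (w / (w - z)^2) \<le> 2 * \<bar>Re (h w)\<bar> * (4 / R)"
      by (intro mult_left_mono) auto
    thus "norm (of_real (2 * Re (h (?w \<theta>))) * (?w \<theta> / (?w \<theta> - z)^2)) \<le> 8 / R * \<bar>Re (h (?w \<theta>))\<bar>"
      unfolding w_def[symmetric] by (simp add: norm_mult norm_divide)
  qed (use I3 has_integral_integrable in blast, rule integrable_on_mult_right[OF intR])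
  hence "2 * pi * norm (deriv h z) \<le> 8 / R * integral {0..2*pi} (\<lambda>\<theta>. \<bar>Re (h (?w \<theta>))\<bar>)"
    using I3 by (simp add: integral_unique norm_mult)
  thus ?thesis using R by (simp add: circle_mean_def field_simps)
qed

text \<open>The positive part of the integrand is at most \<open>ln 2\<close> and its mean vanishes, so
  its absolute value is controlled uniformly in the position of \<open>a\<close>.\<close>

lemma circle_mean_abs_ln_linear:
  assumes "0 < r" "norm a \<noteq> r"
  shows "circle_mean r (\<lambda>z. \<bar>ln (norm (z - a)) - ln (max r (norm a))\<bar>) \<le> 2 * ln 2"
proof -
  have ne: "z - a \<noteq> 0" if "norm z = r" for z using that assms by auto
  have cont: "continuous_on (sphere 0 r) (\<lambda>z. ln (norm (z - a)))"
    using ne by (intro continuous_intros) auto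
  let ?g = "\<lambda>z. ln (norm (z - a)) - ln (max r (norm a))"
  have "circle_mean r ?g = 0"
    using circle_mean_diff[OF _ cont continuous_on_const] assms circle_mean_ln_linear[OF assms] by simp
  have "circle_mean r (\<lambda>z. \<bar>?g z\<bar>) = circle_mean r (\<lambda>z. 2 * max 0 (?g z) - ?g z)"
    by (rule circle_mean_cong) (use assms in \<open>auto simp: max_def abs_if\<close>)
  also have "\<dots> = 2 * circle_mean r (\<lambda>z. max 0 (?g z))"
    using \<open>circle_mean r ?g = 0\<close> assms
    by (subst circle_mean_diff) (auto intro!: continuous_intros cont simp: circle_mean_cmult)
  also have "circle_mean r (\<lambda>z. max 0 (?g z)) \<le> ln 2"
  proof (rule circle_mean_le_const)
    fix z :: complex assume z: "norm z = r"
    have "norm (z - a) \<le> 2 * max r (norm a)" using norm_triangle_ineq4[of z a] z by auto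
    hence "ln (norm (z - a)) \<le> ln (2 * max r (norm a))" using ne[OF z] assms by (subst ln_le_cancel_iff) auto
    thus "max 0 (?g z) \<le> ln 2" using assms by (simp add: ln_mult split: if_splits)
  qed (use assms in \<open>auto intro!: continuous_intros cont\<close>)
  finally show ?thesis by simp
qed

section \<open>Meromorphic functions and orders\<close>

text \<open>Identically vanishing functions are excluded because \<open>zorder\<close> carries no
  information for them; under both conditions orders add under products at every point.\<close>

definition merom_nonzero :: "(complex \<Rightarrow> complex) \<Rightarrow> bool" where
  "merom_nonzero u \<longleftrightarrow> u meromorphic_on UNIV \<and> nonzero_function u"

text \<open>Analyticity also fixes the value at the point, which a function that is merely
  meromorphic there may take arbitrarily. Means over circles made of such points therefore see the
  represented function itself.\<close>

definition regular_at :: "(complex \<Rightarrow> complex) \<Rightarrow> complex \<Rightarrow> bool" where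
  "regular_at u z \<longleftrightarrow> u analytic_on {z} \<and> u z \<noteq> 0"

definition good_radius :: "(complex \<Rightarrow> complex) \<Rightarrow> real \<Rightarrow> bool" where
  "good_radius u r \<longleftrightarrow> (\<forall>z. norm z = r \<longrightarrow> regular_at u z)"

lemma merom_nonzero_mero: "merom_nonzero u \<Longrightarrow> u meromorphic_on A"
  by (auto simp: merom_nonzero_def intro: meromorphic_on_subset)

lemma merom_nonzero_eventually:
  assumes "merom_nonzero u"
  shows "\<forall>\<^sub>\<approx>z. u z \<noteq> 0"
  using meromorphic_imp_constant_or_avoid[of u UNIV 0] assms
  by (auto simp: merom_nonzero_def nonzero_function_def)

lemma merom_nonzeroI:
  assumes "u meromorphic_on UNIV" "\<forall>\<^sub>\<approx>z. u z \<noteq> 0"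
  shows "merom_nonzero u"
  unfolding merom_nonzero_def nonzero_function_def
proof (intro conjI notI)
  assume "\<forall>\<^sub>\<approx>z. u z = 0"
  with assms(2) have "eventually (\<lambda>_::complex. False) (cosparse UNIV)" by eventually_elim auto
  thus False by simp
qed (use assms in auto)

lemma merom_nonzero_at:
  assumes "merom_nonzero u"
  shows "\<forall>\<^sub>F w in at z. u w \<noteq> 0"
  using eventually_cosparse_imp_eventually_at[OF merom_nonzero_eventually[OF assms]] by auto

lemma merom_nonzero_freq: "merom_nonzero u \<Longrightarrow> \<exists>\<^sub>F w in at z. u w \<noteq> 0"
  using merom_nonzero_at eventually_frequently at_neq_bot by blast

lemma merom_nonzero_regular:
  assumes "merom_nonzero u"
  shows "\<forall>\<^sub>\<approx>z. regular_at u z"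
  using merom_nonzero_eventually[OF assms] meromorphic_on_imp_analytic_cosparse[OF merom_nonzero_mero[OF assms]]
  by eventually_elim (simp add: regular_at_def)

lemma merom_nonzero_cong:
  assumes "merom_nonzero u" "\<forall>\<^sub>\<approx>z. u z = v z"
  shows "merom_nonzero v"
proof (rule merom_nonzeroI)
  show "v meromorphic_on UNIV"
    using meromorphic_on_cong'[OF assms(2) refl] merom_nonzero_mero[OF assms(1)] by blast
  show "\<forall>\<^sub>\<approx>z. v z \<noteq> 0"
    using assms(2) merom_nonzero_eventually[OF assms(1)] by eventually_elim auto
qed

lemma merom_nonzero_mult:
  assumes "merom_nonzero u" "merom_nonzero v"
  shows "merom_nonzero (\<lambda>z. u z * v z)"
proof (rule merom_nonzeroI)
  show "\<forall>\<^sub>\<approx>z. u z * v z \<noteq> 0"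
    using merom_nonzero_eventually[OF assms(1)] merom_nonzero_eventually[OF assms(2)]
    by eventually_elim auto
qed (intro meromorphic_intros merom_nonzero_mero assms)

lemma merom_nonzero_inverse:
  assumes "merom_nonzero u"
  shows "merom_nonzero (\<lambda>z. inverse (u z))"
proof (rule merom_nonzeroI)
  show "\<forall>\<^sub>\<approx>z. inverse (u z) \<noteq> 0"
    using merom_nonzero_eventually[OF assms] by eventually_elim auto
qed (intro meromorphic_intros merom_nonzero_mero assms)

lemma merom_nonzero_divide:
  assumes "merom_nonzero u" "merom_nonzero v"
  shows "merom_nonzero (\<lambda>z. u z / v z)"
  using merom_nonzero_mult[OF assms(1) merom_nonzero_inverse[OF assms(2)]] by (simp add: field_simps)

lemma merom_nonzero_const: "c \<noteq> 0 \<Longrightarrow> merom_nonzero (\<lambda>_. c)"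
  by (rule merom_nonzeroI) auto

lemma merom_nonzero_linear: "merom_nonzero (\<lambda>z. z - a)"
proof (rule merom_nonzeroI)
  have "\<forall>\<^sub>\<approx>z. z \<notin> {a}" by (rule eventually_not_in_cosparse) auto
  thus "\<forall>\<^sub>\<approx>z. z - a \<noteq> 0" by simp
qed (intro meromorphic_intros)

lemma merom_nonzero_powi:
  assumes "merom_nonzero u"
  shows "merom_nonzero (\<lambda>z. u z powi n)"
proof (rule merom_nonzeroI)
  show "\<forall>\<^sub>\<approx>z. u z powi n \<noteq> 0"
    using merom_nonzero_eventually[OF assms] by eventually_elim auto
qed (intro meromorphic_intros merom_nonzero_mero assms)

lemma merom_nonzero_power: "merom_nonzero u \<Longrightarrow> merom_nonzero (\<lambda>z. u z ^ n)"
  using merom_nonzero_powi[of u "int n"] by simp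

lemma merom_nonzero_prod:
  assumes "\<And>i. i \<in> I \<Longrightarrow> merom_nonzero (u i)"
  shows "merom_nonzero (\<lambda>z. \<Prod>i\<in>I. u i z)"
  using assms by (induction I rule: infinite_finite_induct)
    (auto intro!: merom_nonzero_mult merom_nonzero_const)

lemma zorder_mero_mult:
  assumes "merom_nonzero u" "merom_nonzero v"
  shows "zorder (\<lambda>z. u z * v z) z = zorder u z + zorder v z"
  by (intro zorder_mult merom_nonzero_mero merom_nonzero_freq assms)

lemma zorder_mero_divide:
  assumes "merom_nonzero u" "merom_nonzero v"
  shows "zorder (\<lambda>z. u z / v z) z = zorder u z - zorder v z"
  by (intro zorder_divide merom_nonzero_mero merom_nonzero_freq assms)

lemma zorder_mero_powi:
  assumes "merom_nonzero u"
  shows "zorder (\<lambda>z. u z powi n) z = n * zorder u z"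
  by (intro zorder_power_int merom_nonzero_mero merom_nonzero_freq assms)

lemma zorder_mero_inverse:
  assumes "merom_nonzero u"
  shows "zorder (\<lambda>z. inverse (u z)) z = - zorder u z"
  using zorder_mero_powi[OF assms, of "-1"] by (simp add: power_int_minus)

lemma zorder_mero_prod:
  assumes "\<And>i. i \<in> I \<Longrightarrow> merom_nonzero (u i)"
  shows "zorder (\<lambda>z. \<Prod>i\<in>I. u i z) z = (\<Sum>i\<in>I. zorder (u i) z)"
  by (intro zorder_prod merom_nonzero_mero merom_nonzero_at merom_nonzero_prod assms)

lemma zorder_linear: "zorder (\<lambda>z. z - a) z = (if z = a then 1 else 0)"
proof (cases "z = a")
  case True
  have "zorder (\<lambda>z. z - a) a = 1"
    by (rule zorder_eqI[of UNIV _ "\<lambda>_. 1"]) auto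
  thus ?thesis using True by simp
next
  case False
  thus ?thesis by (auto intro!: zorder_eq_0I analytic_intros)
qed

lemma is_pole_iff_zorder:
  assumes "merom_nonzero u"
  shows "is_pole u z \<longleftrightarrow> zorder u z < 0"
proof
  assume "is_pole u z"
  thus "zorder u z < 0"
    using isolated_pole_imp_neg_zorder merom_nonzero_mero[OF assms] meromorphic_at_iff by blast
next
  assume "zorder u z < 0"
  thus "is_pole u z"
    by (intro zorder_neg_imp_is_pole merom_nonzero_mero merom_nonzero_at assms)
qed

lemma isolated_zero_iff_zorder:
  assumes "merom_nonzero u"
  shows "isolated_zero u z \<longleftrightarrow> zorder u z > 0"
  using zorder_isolated_zero_pos' zorder_pos_imp_isolated_zero[OF merom_nonzero_mero[OF assms] merom_nonzero_at[OF assms]]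
    merom_nonzero_mero[OF assms] meromorphic_at_iff by blast

lemma regular_at_zorder: "regular_at u z \<Longrightarrow> zorder u z = 0"
  by (auto simp: regular_at_def intro: zorder_eq_0I)

lemma zorder_nonneg_analytic:
  assumes "merom_nonzero u" "u analytic_on {z}"
  shows "zorder u z \<ge> 0"
  by (intro zorder_ge_0 assms merom_nonzero_freq)

lemma zorder_support_sparse:
  assumes "merom_nonzero u"
  shows "{z. zorder u z \<noteq> 0} sparse_in UNIV"
proof (rule sparse_in_subset2)
  show "{z. \<not> regular_at u z} sparse_in UNIV"
    using merom_nonzero_regular[OF assms] by (simp add: eventually_cosparse)
qed (use regular_at_zorder in auto)

lemma finite_zorder_support:
  assumes "merom_nonzero u"
  shows "finite {z \<in> cball 0 r. zorder u z \<noteq> 0}"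
proof -
  have "finite (cball 0 r \<inter> {z. zorder u z \<noteq> 0})"
    by (rule sparse_in_compact_finite[OF sparse_in_subset[OF zorder_support_sparse[OF assms]] compact_cball]) simp
  thus ?thesis by (rule rev_finite_subset) blast
qed

lemma regular_at_divide: "regular_at u z \<Longrightarrow> regular_at v z \<Longrightarrow> regular_at (\<lambda>z. u z / v z) z"
  unfolding regular_at_def by (auto intro!: analytic_on_divide)

lemma regular_at_inverse: "regular_at u z \<Longrightarrow> regular_at (\<lambda>z. inverse (u z)) z"
  unfolding regular_at_def by (auto intro!: analytic_on_inverse)

lemma good_radius_countable:
  assumes "merom_nonzero u"
  shows "countable {r. \<not> good_radius u r}"
proof -
  have "countable {z. \<not> regular_at u z}"
    using sparse_imp_countable[of UNIV "{z. \<not> regular_at u z}"] merom_nonzero_regular[OF assms]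
    by (simp add: eventually_cosparse)
  hence "countable (norm ` {z. \<not> regular_at u z})" by simp
  thus ?thesis by (rule countable_subset[rotated]) (auto simp: good_radius_def)
qed

lemma good_radius_inverse: "good_radius u r \<Longrightarrow> good_radius (\<lambda>z. inverse (u z)) r"
  by (simp add: good_radius_def regular_at_inverse)

lemma analytic_on_sphere_continuous:
  "(\<And>z. norm z = r \<Longrightarrow> u analytic_on {z}) \<Longrightarrow> continuous_on (sphere 0 r) u"
  by (meson analytic_at_imp_isCont continuous_at_imp_continuous_on mem_sphere_0)

lemma good_radius_continuous: "good_radius u r \<Longrightarrow> continuous_on (sphere 0 r) u"
  by (intro analytic_on_sphere_continuous) (auto simp: good_radius_def regular_at_def)

lemma good_radius_nonzero: "good_radius u r \<Longrightarrow> norm z = r \<Longrightarrow> u z \<noteq> 0"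
  by (auto simp: good_radius_def regular_at_def)

lemma good_radius_continuous_ln:
  "good_radius u r \<Longrightarrow> continuous_on (sphere 0 r) (\<lambda>z. ln (norm (u z)))"
  by (intro continuous_intros good_radius_continuous) (auto dest: good_radius_nonzero)

lemma log_plus_continuous [continuous_intros]:
  "continuous_on A f \<Longrightarrow> continuous_on A (\<lambda>x. log_plus (f x))"
  unfolding log_plus_def by (intro continuous_intros) (auto simp: max_def)

lemma log_plus_nonneg [simp]: "log_plus x \<ge> 0"
  by (simp add: log_plus_def)

lemma log_plus_mono: "x \<le> y \<Longrightarrow> log_plus x \<le> log_plus y"
  by (auto simp: log_plus_def)

lemma log_plus_eq: "0 < x \<Longrightarrow> log_plus x = max 0 (ln x)"
  by (auto simp: log_plus_def max_def ln_ge_zero_iff)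

lemma log_plus_mult_le: "0 \<le> x \<Longrightarrow> 0 \<le> y \<Longrightarrow> log_plus (x * y) \<le> log_plus x + log_plus y"
proof (cases "x = 0 \<or> y = 0")
  case True thus ?thesis by (auto simp: log_plus_def)
next
  case False thus ?thesis if "0 \<le> x" "0 \<le> y" using that by (simp add: log_plus_eq ln_mult)
qed

lemma log_plus_le_ln_add_one: "0 \<le> x \<Longrightarrow> log_plus x \<le> ln (1 + x)"
  by (auto simp: log_plus_def)

text \<open>The sum is at most the number of terms times the largest one. The \<open>max 1\<close>
  keeps the correction nonnegative for an empty index set.\<close>

lemma log_plus_sum_le:
  assumes "finite I" "\<And>i. i \<in> I \<Longrightarrow> 0 \<le> x i"
  shows "log_plus (\<Sum>i\<in>I. x i) \<le> (\<Sum>i\<in>I. log_plus (x i)) + ln (max 1 (real (card I)))"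
proof (cases "I = {}")
  case True thus ?thesis by (simp add: log_plus_def)
next
  case False
  define M where "M = Max (x ` I)"
  have Mi: "M \<in> x ` I" unfolding M_def using assms False by (intro Max_in) auto
  then obtain i where i: "i \<in> I" "M = x i" by auto
  have M0: "0 \<le> M" using Mi assms by auto
  have "(\<Sum>i\<in>I. x i) \<le> real (card I) * M"
    using sum_bounded_above[of I x M] assms by (auto simp: M_def)
  hence "log_plus (\<Sum>i\<in>I. x i) \<le> log_plus (real (card I) * M)" by (rule log_plus_mono)
  also have "\<dots> \<le> log_plus (real (card I)) + log_plus M" using M0 by (intro log_plus_mult_le) auto
  also have "log_plus M \<le> (\<Sum>i\<in>I. log_plus (x i))"
    unfolding i(2) using i(1) assms(1) by (intro member_le_sum) auto
  finally show ?thesis by (simp add: log_plus_def)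
qed

section \<open>Counting functions and Jensen's formula\<close>

text \<open>Since \<open>ln 0 = 0\<close>, the term at the origin is \<open>w 0 * ln r\<close>, as in the definition of \<open>N\<close>.\<close>

definition log_count :: "real \<Rightarrow> (complex \<Rightarrow> real) \<Rightarrow> real" where
  "log_count r w = (\<Sum>a | norm a \<le> r \<and> w a \<noteq> 0. w a * (ln r - ln (norm a)))"

text \<open>A sum over an infinite set is 0 by convention, so additivity and monotonicity of
  \<open>log_count\<close> are proved under this condition.\<close>

definition loc_finite :: "(complex \<Rightarrow> real) \<Rightarrow> bool" where
  "loc_finite w \<longleftrightarrow> (\<forall>r. finite {a. norm a \<le> r \<and> w a \<noteq> 0})"

definition zero_mult :: "(complex \<Rightarrow> complex) \<Rightarrow> complex \<Rightarrow> real" where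
  "zero_mult u a = real (nat (zorder u a))"

definition pole_mult :: "(complex \<Rightarrow> complex) \<Rightarrow> complex \<Rightarrow> real" where
  "pole_mult u a = real (nat (- zorder u a))"

lemma loc_finiteD: "loc_finite w \<Longrightarrow> finite {a. norm a \<le> r \<and> w a \<noteq> 0}"
  by (simp add: loc_finite_def)

lemma loc_finite_subset:
  assumes "loc_finite v" "\<And>a. v a = 0 \<Longrightarrow> w a = 0"
  shows "loc_finite w"
  unfolding loc_finite_def
proof
  fix r show "finite {a. norm a \<le> r \<and> w a \<noteq> 0}"
    by (rule finite_subset[OF _ loc_finiteD[OF assms(1), of r]]) (use assms(2) in auto)
qed

lemma loc_finite_add:
  assumes "loc_finite v" "loc_finite w"
  shows "loc_finite (\<lambda>a. v a + w a)"
  unfolding loc_finite_def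
proof
  fix r show "finite {a. norm a \<le> r \<and> v a + w a \<noteq> 0}"
    by (rule finite_subset[OF _ finite_UnI[OF loc_finiteD[OF assms(1), of r] loc_finiteD[OF assms(2), of r]]]) auto
qed

lemma loc_finite_0: "loc_finite (\<lambda>_. 0)"
  by (simp add: loc_finite_def)

lemma loc_finite_sum:
  "(\<And>i. i \<in> I \<Longrightarrow> loc_finite (w i)) \<Longrightarrow> loc_finite (\<lambda>a. \<Sum>i\<in>I. w i a)"
  by (induction I rule: infinite_finite_induct) (simp_all add: loc_finite_add loc_finite_0)

lemma loc_finite_zorder:
  assumes "merom_nonzero u"
  shows "loc_finite (\<lambda>a. real_of_int (zorder u a))"
  unfolding loc_finite_def using finite_zorder_support[OF assms] by simp

lemma loc_finite_zero_mult: "merom_nonzero u \<Longrightarrow> loc_finite (zero_mult u)"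
  by (rule loc_finite_subset[OF loc_finite_zorder]) (auto simp: zero_mult_def)

lemma loc_finite_pole_mult: "merom_nonzero u \<Longrightarrow> loc_finite (pole_mult u)"
  by (rule loc_finite_subset[OF loc_finite_zorder]) (auto simp: pole_mult_def)

lemma log_count_superset:
  assumes "finite A" "{a. norm a \<le> r \<and> w a \<noteq> 0} \<subseteq> A" "A \<subseteq> {a. norm a \<le> r}"
  shows "log_count r w = (\<Sum>a\<in>A. w a * (ln r - ln (norm a)))"
  unfolding log_count_def by (rule sum.mono_neutral_left) (use assms in auto)

lemma log_count_add:
  assumes "loc_finite v" "loc_finite w"
  shows "log_count r (\<lambda>a. v a + w a) = log_count r v + log_count r w"
proof -
  let ?A = "{a. norm a \<le> r \<and> v a \<noteq> 0} \<union> {a. norm a \<le> r \<and> w a \<noteq> 0}"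
  have fin: "finite ?A" using loc_finiteD assms by blast
  show ?thesis
    by (subst (1 2 3) log_count_superset[OF fin]) (auto simp: sum.distrib distrib_right)
qed

lemma log_count_cmult: "log_count r (\<lambda>a. c * w a) = c * log_count r w"
  unfolding log_count_def by (cases "c = 0") (auto simp: sum_distrib_left mult_ac)

lemma loc_finite_uminus: "loc_finite w \<Longrightarrow> loc_finite (\<lambda>a. - w a)"
  by (simp add: loc_finite_def)

lemma loc_finite_diff: "loc_finite v \<Longrightarrow> loc_finite w \<Longrightarrow> loc_finite (\<lambda>a. v a - w a)"
  using loc_finite_add[OF _ loc_finite_uminus, of v w] by simp

lemma log_count_diff:
  assumes "loc_finite v" "loc_finite w"
  shows "log_count r (\<lambda>a. v a - w a) = log_count r v - log_count r w"
  using log_count_add[OF assms(1) loc_finite_uminus[OF assms(2)], of r] log_count_cmult[of r "-1" w]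
  by simp

lemma log_count_sum:
  assumes "finite I" "\<And>i. i \<in> I \<Longrightarrow> loc_finite (w i)"
  shows "log_count r (\<lambda>a. \<Sum>i\<in>I. w i a) = (\<Sum>i\<in>I. log_count r (w i))"
  using assms
proof (induction rule: finite_induct)
  case (insert x F)
  thus ?case by (simp add: log_count_add loc_finite_sum)
qed (simp add: log_count_def)

text \<open>At the origin the weight is \<open>ln r\<close>, because \<open>ln 0 = 0\<close>. This
  is the source of the hypothesis \<open>1 \<le> r\<close> in the counting estimates that
  follow.\<close>

lemma log_weight_nonneg: "1 \<le> r \<Longrightarrow> norm a \<le> r \<Longrightarrow> 0 \<le> ln r - ln (norm a)"
  by (cases "a = 0") auto

lemma log_count_mono:
  assumes "1 \<le> r" "loc_finite w" "\<And>a. v a \<le> w a" "loc_finite v"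
  shows "log_count r v \<le> log_count r w"
proof -
  let ?A = "{a. norm a \<le> r \<and> v a \<noteq> 0} \<union> {a. norm a \<le> r \<and> w a \<noteq> 0}"
  have fin: "finite ?A" using loc_finiteD assms by blast
  have "(\<Sum>a\<in>?A. v a * (ln r - ln (norm a))) \<le> (\<Sum>a\<in>?A. w a * (ln r - ln (norm a)))"
    by (intro sum_mono mult_right_mono) (use assms log_weight_nonneg in auto)
  thus ?thesis
    by (subst (1 2) log_count_superset[OF fin]) auto
qed

lemma log_count_nonneg:
  assumes "1 \<le> r" "\<And>a. 0 \<le> w a"
  shows "0 \<le> log_count r w"
  unfolding log_count_def by (intro sum_nonneg mult_nonneg_nonneg) (use assms log_weight_nonneg in auto)

lemma has_integral_inverse_tail:
  fixes \<rho> r :: real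
  assumes "0 < \<rho>" "\<rho> \<le> r"
  shows "((\<lambda>t. if \<rho> \<le> t then 1 / t else 0) has_integral (ln r - ln \<rho>)) {0..r}"
proof -
  have "((\<lambda>t. 1 / t) has_integral (ln r - ln \<rho>)) {\<rho>..r}"
    by (rule fundamental_theorem_of_calculus)
       (use assms in \<open>auto intro!: derivative_eq_intros simp: has_real_derivative_iff_has_vector_derivative[symmetric]\<close>)
  hence "((\<lambda>t. if t \<in> {\<rho>..r} then 1 / t else 0) has_integral (ln r - ln \<rho>)) {0..r}"
    by (subst has_integral_restrict) (use assms in auto)
  thus ?thesis by (rule has_integral_eq[rotated]) auto
qed

lemma is_pole_iff_pole_mult: "merom_nonzero u \<Longrightarrow> is_pole u a \<longleftrightarrow> pole_mult u a \<noteq> 0"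
  by (auto simp: is_pole_iff_zorder pole_mult_def)

text \<open>A pole a outside the origin enters \<open>pole_count t\<close> at t = |a| and so
  contributes the integral of 1/t from |a| to r, that is ln r - ln |a|. A pole at the origin is
  removed from the integrand and restored with the factor ln r, which is its weight in
  \<open>log_count\<close>.\<close>

lemma nevanlinna_N_log_count:
  assumes "merom_nonzero u" "0 < r"
  shows "nevanlinna_N r u = log_count r (pole_mult u)"
proof -
  define A where "A = {a. norm a \<le> r \<and> pole_mult u a \<noteq> 0}"
  have fin: "finite A" unfolding A_def by (intro loc_finiteD loc_finite_pole_mult assms)
  have pc: "real (pole_count t u) = (\<Sum>a\<in>A. if norm a \<le> t then pole_mult u a else 0)" if "t \<le> r" for t
  proof -
    have "real (pole_count t u) = (\<Sum>a | norm a \<le> t \<and> is_pole u a. pole_mult u a)"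
      by (simp add: pole_count_def pole_mult_def)
    also have "{a. norm a \<le> t \<and> is_pole u a} = {a\<in>A. norm a \<le> t}"
      unfolding A_def is_pole_iff_pole_mult[OF assms(1)] using that by (intro Collect_cong) (simp, meson order_trans)
    also have "(\<Sum>a\<in>{a\<in>A. norm a \<le> t}. pole_mult u a) = (\<Sum>a\<in>A. if norm a \<le> t then pole_mult u a else 0)"
      using fin by (simp add: sum.inter_filter)
    finally show ?thesis .
  qed
  have "((\<lambda>t. \<Sum>a\<in>A - {0}. pole_mult u a * (if norm a \<le> t then 1 / t else 0)) has_integral
           (\<Sum>a\<in>A - {0}. pole_mult u a * (ln r - ln (norm a)))) {0..r}"
    by (intro has_integral_sum has_integral_mult_right has_integral_inverse_tail) (use fin in \<open>auto simp: A_def\<close>)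
  moreover have "(\<Sum>a\<in>A - {0}. pole_mult u a * (if norm a \<le> t then 1 / t else 0)) =
      (real (pole_count t u) - real (pole_count 0 u)) / t" if "t \<in> {0..r}" for t
  proof -
    have "real (pole_count t u) - real (pole_count 0 u) =
        (\<Sum>a\<in>A. (if norm a \<le> t then pole_mult u a else 0) - (if norm a \<le> 0 then pole_mult u a else 0))"
      using that assms by (simp add: pc sum_subtractf)
    also have "\<dots> = (\<Sum>a\<in>A - {0}. if norm a \<le> t then pole_mult u a else 0)"
      by (rule sum.mono_neutral_cong_right) (use fin that in auto)
    finally have *: "real (pole_count t u) - real (pole_count 0 u) = \<dots>" .
    show ?thesis unfolding * sum_divide_distrib by (rule sum.cong) auto
  qed
  ultimately have "((\<lambda>t. (real (pole_count t u) - real (pole_count 0 u)) / t) has_integral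
           (\<Sum>a\<in>A - {0}. pole_mult u a * (ln r - ln (norm a)))) {0..r}"
    by (rule has_integral_eq[rotated])
  hence I: "integral {0..r} (\<lambda>t. (real (pole_count t u) - real (pole_count 0 u)) / t) =
      (\<Sum>a\<in>A - {0}. pole_mult u a * (ln r - ln (norm a)))"
    by (rule integral_unique)
  have P0: "real (pole_count 0 u) = (if 0 \<in> A then pole_mult u 0 else 0)"
  proof -
    have "real (pole_count 0 u) = (\<Sum>a\<in>A. if a = 0 then pole_mult u a else 0)"
      using assms(2) by (subst pc) (auto intro!: sum.cong)
    thus ?thesis using fin by simp
  qed
  have "log_count r (pole_mult u) = (\<Sum>a\<in>A. pole_mult u a * (ln r - ln (norm a)))"
    by (simp add: log_count_def A_def)
  also have "\<dots> = (\<Sum>a\<in>A - {0}. pole_mult u a * (ln r - ln (norm a))) + (if 0 \<in> A then pole_mult u 0 * ln r else 0)"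
    using sum.remove[OF fin, of 0 "\<lambda>a. pole_mult u a * (ln r - ln (norm a))"] by auto
  finally have L: "log_count r (pole_mult u) = \<dots>" .
  show ?thesis unfolding nevanlinna_N_def I unfolding L P0 by simp
qed

lemma pole_mult_inverse: "merom_nonzero u \<Longrightarrow> pole_mult (\<lambda>z. inverse (u z)) = zero_mult u"
  by (simp add: fun_eq_iff pole_mult_def zero_mult_def zorder_mero_inverse)

lemma nevanlinna_N_inverse:
  assumes "merom_nonzero u" "0 < r"
  shows "nevanlinna_N r (\<lambda>z. inverse (u z)) = log_count r (zero_mult u)"
  using assms by (simp add: nevanlinna_N_log_count merom_nonzero_inverse pole_mult_inverse)

lemma zorder_eq_mults: "real_of_int (zorder u a) = zero_mult u a - pole_mult u a"
  by (simp add: zero_mult_def pole_mult_def)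

text \<open>Dividing by the finite product over the zeros and poles in the disc leaves order 0
  everywhere. The quotient still has arbitrary values on \<open>S\<close>, hence
  \<open>remove_sings\<close>; after that it is holomorphic and zero-free on a disc and has a
  logarithm. The identity is claimed at regular points, where the value of \<open>u\<close> is
  meaningful.\<close>

lemma local_factorization:
  fixes R :: real
  assumes u: "merom_nonzero u"
  defines "S \<equiv> {a \<in> ball 0 R. zorder u a \<noteq> 0}"
  obtains h where "h holomorphic_on ball 0 R"
    "\<And>z. z \<in> ball 0 R \<Longrightarrow> regular_at u z \<Longrightarrow> u z = exp (h z) * (\<Prod>a\<in>S. (z - a) powi zorder u a)"
proof -
  have finS: "finite S"
    unfolding S_def by (rule finite_subset[OF _ finite_zorder_support[OF u, of R]]) auto
  define p where "p = (\<lambda>z. \<Prod>a\<in>S. (z - a) powi zorder u a)"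
  have p: "merom_nonzero p"
    unfolding p_def by (intro merom_nonzero_prod merom_nonzero_powi merom_nonzero_linear)
  have ordp: "zorder p z = (if z \<in> S then zorder u z else 0)" for z
  proof -
    have "zorder p z = (\<Sum>a\<in>S. zorder u a * (if z = a then 1 else 0))"
      unfolding p_def
      by (subst zorder_mero_prod) (auto intro!: merom_nonzero_powi merom_nonzero_linear simp: zorder_mero_powi merom_nonzero_linear zorder_linear)
    also have "\<dots> = (\<Sum>a\<in>S. if z = a then zorder u a else 0)" by (rule sum.cong) auto
    finally show ?thesis using finS by simp
  qed
  define w where "w = (\<lambda>z. u z / p z)"
  have w: "merom_nonzero w" unfolding w_def by (intro merom_nonzero_divide u p)
  have ordw: "zorder w z = 0" if "z \<in> ball 0 R" for z
    using that unfolding w_def by (simp add: zorder_mero_divide u p ordp S_def)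
  define g where "g = remove_sings w"
  have g: "g analytic_on {z} \<and> g z \<noteq> 0" if z: "z \<in> ball 0 R" for z
  proof -
    have iso: "isolated_singularity_at w z" and ness: "not_essential w z"
      using merom_nonzero_mero[OF w] meromorphic_at_iff by blast+
    have "\<not> is_pole w z" using is_pole_iff_zorder[OF w] ordw[OF z] by simp
    hence ana: "g analytic_on {z}"
      unfolding g_def using iso ness by (auto simp: not_essential_def intro: remove_sings_analytic_at)
    have "merom_nonzero g"
      by (rule merom_nonzero_cong[OF w]) (use eventually_remove_sings_eq[OF merom_nonzero_mero[OF w, of UNIV]] in \<open>simp add: g_def eq_commute\<close>)
    moreover have "zorder g z = 0" using ordw[OF z] iso by (simp add: g_def)
    ultimately show ?thesis using ana zorder_eq_0_iff merom_nonzero_freq by blast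
  qed
  have "g holomorphic_on ball 0 R"
    using g analytic_on_analytic_at analytic_imp_holomorphic by blast
  then obtain h where h: "h holomorphic_on ball 0 R" "\<And>z. z \<in> ball 0 R \<Longrightarrow> g z = exp (h z)"
    using contractible_imp_holomorphic_log[OF _ convex_imp_contractible[OF convex_ball]] g by metis
  show thesis
  proof (rule that[OF h(1)])
    fix z assume z: "z \<in> ball 0 R" "regular_at u z"
    have "z \<notin> S" using regular_at_zorder[OF z(2)] by (simp add: S_def)
    hence "regular_at p z"
      unfolding regular_at_def p_def using finS
      by (auto intro!: analytic_on_prod analytic_on_power_int analytic_intros)
    hence "regular_at w z" unfolding w_def by (intro regular_at_divide z)
    hence "g z = w z" by (auto simp: g_def regular_at_def)
    thus "u z = exp (h z) * (\<Prod>a\<in>S. (z - a) powi zorder u a)"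
      using h(2)[OF z(1)] \<open>regular_at p z\<close> by (simp add: w_def regular_at_def p_def field_simps)
  qed
qed

lemma ln_norm_prod_powi:
  assumes "finite S" "\<And>a. a \<in> S \<Longrightarrow> x a \<noteq> (0::complex)"
  shows "ln (norm (\<Prod>a\<in>S. x a powi k a)) = (\<Sum>a\<in>S. of_int (k a) * ln (norm (x a)))"
proof -
  have "ln (norm (\<Prod>a\<in>S. x a powi k a)) = (\<Sum>a\<in>S. ln (norm (x a powi k a)))"
    using assms by (simp add: prod_norm[symmetric] ln_prod)
  also have "\<dots> = (\<Sum>a\<in>S. of_int (k a) * ln (norm (x a)))"
    by (rule sum.cong) (use assms in \<open>auto simp: norm_power_int powr_real_of_int' [symmetric] ln_powr\<close>)
  finally show ?thesis .
qed

lemma ln_norm_factorization: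
  assumes u: "merom_nonzero u" 
    and fac: "\<And>z. z \<in> ball 0 R \<Longrightarrow> regular_at u z \<Longrightarrow> u z = exp (h z) * (\<Prod>a\<in>{a \<in> ball 0 R. zorder u a \<noteq> 0}. (z - a) powi zorder u a)"
    and z: "z \<in> ball 0 R" "regular_at u z"
  shows "ln (norm (u z)) = Re (h z) + (\<Sum>a\<in>{a \<in> ball 0 R. zorder u a \<noteq> 0}. of_int (zorder u a) * ln (norm (z - a)))"
proof -
  let ?S = "{a \<in> ball 0 R. zorder u a \<noteq> 0}"
  have fin: "finite ?S" by (rule finite_subset[OF _ finite_zorder_support[OF u, of R]]) auto
  have ne: "z - a \<noteq> 0" if "a \<in> ?S" for a using that regular_at_zorder[OF z(2)] by auto
  have "(\<Prod>a\<in>?S. (z - a) powi zorder u a) \<noteq> 0" using fin ne by auto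
  thus ?thesis
    using ln_norm_prod_powi[OF fin ne] by (subst fac[OF z]) (simp add: norm_mult ln_mult)
qed

text \<open>The constant is left abstract: it is the logarithm of the modulus of the leading Laurent
  coefficient at 0, and later only its independence of r matters.\<close>

theorem jensen:
  assumes u: "merom_nonzero u"
  shows "\<exists>c. \<forall>r>0. good_radius u r \<longrightarrow>
    circle_mean r (\<lambda>z. ln (norm (u z))) = c + log_count r (\<lambda>a. of_int (zorder u a))"
proof -
  define J where "J r = circle_mean r (\<lambda>z. ln (norm (u z))) - log_count r (\<lambda>a. of_int (zorder u a))" for r
  \<comment> \<open>The factorization lives on a disc, so constancy of \<open>J\<close> is shown
    below each R separately; any two good radii are then compared inside a common disc.\<close>
  have "\<exists>c. \<forall>r. 0 < r \<longrightarrow> r < R \<longrightarrow> good_radius u r \<longrightarrow> J r = c" for R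
  proof -
    define S where "S = {a \<in> ball 0 R. zorder u a \<noteq> 0}"
    have finS: "finite S"
      unfolding S_def by (rule finite_subset[OF _ finite_zorder_support[OF u, of R]]) auto
    obtain h where h: "h holomorphic_on ball 0 R"
      "\<And>z. z \<in> ball 0 R \<Longrightarrow> regular_at u z \<Longrightarrow> u z = exp (h z) * (\<Prod>a\<in>S. (z - a) powi zorder u a)"
      using local_factorization[OF u, of R, folded S_def] by blast
    show ?thesis
    proof (intro exI[of _ "Re (h 0) + (\<Sum>a\<in>S. of_int (zorder u a) * ln (norm a))"] allI impI)
      fix r assume r: "0 < r" "r < R" "good_radius u r"
      have neS: "norm a \<noteq> r" if "a \<in> S" for a
        using that r(3) regular_at_zorder by (auto simp: S_def good_radius_def)
      have cont: "continuous_on (sphere 0 r) h"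
        by (rule holomorphic_on_imp_continuous_on[OF holomorphic_on_subset[OF h(1)]]) (use r in auto)
      have contl: "continuous_on (sphere 0 r) (\<lambda>z. ln (norm (z - a)))" if "a \<in> S" for a
        using neS[OF that] by (auto intro!: continuous_intros)
      have "circle_mean r (\<lambda>z. ln (norm (u z))) = 
            circle_mean r (\<lambda>z. Re (h z) + (\<Sum>a\<in>S. of_int (zorder u a) * ln (norm (z - a))))"
      proof (rule circle_mean_cong)
        fix z :: complex assume "norm z = r"
        thus "ln (norm (u z)) = Re (h z) + (\<Sum>a\<in>S. of_int (zorder u a) * ln (norm (z - a)))"
          using r unfolding S_def
          by (intro ln_norm_factorization[OF u h(2)[unfolded S_def]]) (auto simp: good_radius_def)
      qed (use r in simp)
      also have "\<dots> = Re (h 0) + (\<Sum>a\<in>S. of_int (zorder u a) * ln (max r (norm a)))"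
      proof -
        have "circle_mean r (\<lambda>z. Re (h z) + (\<Sum>a\<in>S. of_int (zorder u a) * ln (norm (z - a)))) =
            circle_mean r (\<lambda>z. Re (h z)) + circle_mean r (\<lambda>z. \<Sum>a\<in>S. of_int (zorder u a) * ln (norm (z - a)))"
          by (rule circle_mean_add)
            (use r cont contl in \<open>auto intro!: continuous_on_sum continuous_on_mult continuous_on_Re\<close>)
        also have "circle_mean r (\<lambda>z. \<Sum>a\<in>S. of_int (zorder u a) * ln (norm (z - a))) =
            (\<Sum>a\<in>S. circle_mean r (\<lambda>z. of_int (zorder u a) * ln (norm (z - a))))"
          by (rule circle_mean_sum) (use r finS contl in \<open>auto intro!: continuous_on_mult\<close>)
        also have "\<dots> = (\<Sum>a\<in>S. of_int (zorder u a) * ln (max r (norm a)))"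
          by (rule sum.cong) (use neS r in \<open>simp_all add: circle_mean_cmult circle_mean_ln_linear\<close>)
        finally show ?thesis by (simp add: circle_mean_Re_holomorphic[OF h(1) r(1,2)])
      qed
      finally have 1: "circle_mean r (\<lambda>z. ln (norm (u z))) = Re (h 0) + (\<Sum>a\<in>S. of_int (zorder u a) * ln (max r (norm a)))" .
      have "log_count r (\<lambda>a. of_int (zorder u a)) = (\<Sum>a | a \<in> S \<and> norm a \<le> r. of_int (zorder u a) * (ln r - ln (norm a)))"
        by (rule log_count_superset) (use finS r in \<open>auto simp: S_def elim: rev_finite_subset\<close>)
      also have "\<dots> = (\<Sum>a\<in>S. if norm a \<le> r then of_int (zorder u a) * (ln r - ln (norm a)) else 0)"
        using finS by (simp add: sum.inter_filter)
      finally have 2: "log_count r (\<lambda>a. of_int (zorder u a)) = \<dots>" .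
      \<comment> \<open>For |a| <= r the terms ln r cancel, and for |a| > r nothing was counted;
        both cases leave ln |a|, and \<open>ln 0 = 0\<close> makes this correct at the origin as
        well.\<close>
      have "J r = Re (h 0) + (\<Sum>a\<in>S. of_int (zorder u a) * ln (max r (norm a)) - 
          (if norm a \<le> r then of_int (zorder u a) * (ln r - ln (norm a)) else 0))"
        unfolding J_def 1 2 by (simp add: sum_subtractf)
      also have "\<dots> = Re (h 0) + (\<Sum>a\<in>S. of_int (zorder u a) * ln (norm a))"
        by (intro arg_cong2[where f="(+)"] refl sum.cong) (auto simp: algebra_simps max_def)
      finally show "J r = \<dots>" .
    qed
  qed
  hence eq: "J r = J r'" if "0 < r" "0 < r'" "good_radius u r" "good_radius u r'" for r r'
    using that by (metis max.strict_boundedE gt_ex max_less_iff_conj)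
  show ?thesis
  proof (cases "\<exists>r>0. good_radius u r")
    case True
    then obtain r0 where "r0 > 0" "good_radius u r0" by blast
    thus ?thesis using eq[of _ r0] by (intro exI[of _ "J r0"]) (auto simp: J_def algebra_simps)
  qed auto
qed

text \<open>For x > 0, ln x is the difference of log+ x and log+ (1/x), and |ln x| is their sum. On
  a good circle both parts are continuous, so the means can be split.\<close>

lemma circle_mean_ln_eq_m_diff:
  assumes "good_radius u r" "0 \<le> r"
  shows "circle_mean r (\<lambda>z. ln (norm (u z))) = nevanlinna_m r u - nevanlinna_m r (\<lambda>z. inverse (u z))"
proof -
  have "nevanlinna_m r u - nevanlinna_m r (\<lambda>z. inverse (u z)) =
      circle_mean r (\<lambda>z. log_plus (norm (u z)) - log_plus (norm (inverse (u z))))"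
    unfolding nevanlinna_m_circle_mean using assms good_radius_continuous[OF assms(1)] good_radius_nonzero[OF assms(1)]
    by (subst circle_mean_diff) (auto intro!: continuous_intros)
  also have "\<dots> = circle_mean r (\<lambda>z. ln (norm (u z)))"
    by (rule circle_mean_cong)
       (use assms good_radius_nonzero in \<open>auto simp: log_plus_eq norm_inverse ln_inverse max_def\<close>)
  finally show ?thesis by simp
qed

lemma circle_mean_abs_ln_eq:
  assumes "good_radius u r" "0 \<le> r"
  shows "circle_mean r (\<lambda>z. \<bar>ln (norm (u z))\<bar>) = nevanlinna_m r u + nevanlinna_m r (\<lambda>z. inverse (u z))"
proof -
  have "nevanlinna_m r u + nevanlinna_m r (\<lambda>z. inverse (u z)) =
      circle_mean r (\<lambda>z. log_plus (norm (u z)) + log_plus (norm (inverse (u z))))"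
    unfolding nevanlinna_m_circle_mean using assms good_radius_continuous[OF assms(1)] good_radius_nonzero[OF assms(1)]
    by (subst circle_mean_add) (auto intro!: continuous_intros)
  also have "\<dots> = circle_mean r (\<lambda>z. \<bar>ln (norm (u z))\<bar>)"
    by (rule circle_mean_cong)
       (use assms good_radius_nonzero in \<open>auto simp: log_plus_eq norm_inverse ln_inverse max_def\<close>)
  finally show ?thesis by simp
qed

text \<open>Jensen's formula with the mean split into m(r, u) - m(r, 1/u) and the divisor into zeros
  minus poles.\<close>

theorem first_main_theorem:
  assumes u: "merom_nonzero u"
  obtains c where "\<And>r. 0 < r \<Longrightarrow> good_radius u r \<Longrightarrow> nevanlinna_T r u = nevanlinna_T r (\<lambda>z. inverse (u z)) + c"
proof -
  obtain c where c: "\<And>r. 0 < r \<Longrightarrow> good_radius u r \<Longrightarrow>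
    circle_mean r (\<lambda>z. ln (norm (u z))) = c + log_count r (\<lambda>a. of_int (zorder u a))"
    using jensen[OF u] by blast
  show thesis
  proof (rule that[of c])
    fix r :: real assume r: "0 < r" "good_radius u r"
    have "log_count r (\<lambda>a. real_of_int (zorder u a)) = log_count r (zero_mult u) - log_count r (pole_mult u)"
      unfolding zorder_eq_mults by (intro log_count_diff loc_finite_zero_mult loc_finite_pole_mult u)
    thus "nevanlinna_T r u = nevanlinna_T r (\<lambda>z. inverse (u z)) + c"
      using c[OF r] circle_mean_ln_eq_m_diff[OF r(2)] r u
      by (simp add: nevanlinna_T_def nevanlinna_N_inverse nevanlinna_N_log_count)
  qed
qed

section \<open>Local factorization and the logarithmic derivative\<close>

text \<open>In classical notation n(R, u) + n(R, 1/u), taken over the open disc.\<close>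

definition divisor_count :: "(complex \<Rightarrow> complex) \<Rightarrow> real \<Rightarrow> real" where
  "divisor_count u R = (\<Sum>a | a \<in> ball 0 R \<and> zorder u a \<noteq> 0. real_of_int \<bar>zorder u a\<bar>)"

text \<open>On a good circle this is m(r, u) + m(r, 1/u), by \<open>circle_mean_abs_ln_eq\<close>.
  As a single mean of |ln |u|| it is what the Schwarz formula asks for.\<close>

definition proximity_sum :: "real \<Rightarrow> (complex \<Rightarrow> complex) \<Rightarrow> real" where
  "proximity_sum r u = circle_mean r (\<lambda>z. \<bar>ln (norm (u z))\<bar>)"

lemma finite_divisor: "merom_nonzero u \<Longrightarrow> finite {a. a \<in> ball 0 R \<and> zorder u a \<noteq> 0}"
  by (rule finite_subset[OF _ finite_zorder_support[of u R]]) auto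

lemma divisor_count_nonneg: "0 \<le> divisor_count u R"
  unfolding divisor_count_def by (intro sum_nonneg) auto

lemma proximity_sum_nonneg: "good_radius u r \<Longrightarrow> 0 \<le> r \<Longrightarrow> 0 \<le> proximity_sum r u"
  unfolding proximity_sum_def
  by (intro circle_mean_nonneg continuous_on_rabs good_radius_continuous_ln) auto

text \<open>Every zero or pole with |a| < R has weight at least ln (R'/R) in the counting functions
  at R'. Dividing by this logarithm is what makes the number of zeros and poles negligible in a long
  window.\<close>

lemma divisor_count_bound:
  assumes u: "merom_nonzero u" and "1 \<le> R" "R < R'"
  shows "divisor_count u R * ln (R' / R) \<le> nevanlinna_N R' u + nevanlinna_N R' (\<lambda>z. inverse (u z))"
proof -
  let ?S = "{a. a \<in> ball 0 R \<and> zorder u a \<noteq> 0}" 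
  let ?w = "\<lambda>a. pole_mult u a + zero_mult u a"
  have w: "?w a = real_of_int \<bar>zorder u a\<bar>" for a by (auto simp: pole_mult_def zero_mult_def)
  have "nevanlinna_N R' u + nevanlinna_N R' (\<lambda>z. inverse (u z)) = log_count R' ?w"
    using assms by (simp add: nevanlinna_N_log_count[OF u] nevanlinna_N_inverse[OF u] log_count_add loc_finite_pole_mult loc_finite_zero_mult)
  also have "\<dots> \<ge> (\<Sum>a\<in>?S. ?w a * (ln R' - ln (norm a)))"
    unfolding log_count_def
  proof (rule sum_mono2)
    show "finite {a. norm a \<le> R' \<and> ?w a \<noteq> 0}"
      by (intro loc_finiteD loc_finite_add loc_finite_pole_mult loc_finite_zero_mult u)
    show "?S \<subseteq> {a. norm a \<le> R' \<and> ?w a \<noteq> 0}" using assms unfolding w by auto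
    fix a assume "a \<in> {a. norm a \<le> R' \<and> ?w a \<noteq> 0} - ?S"
    thus "0 \<le> ?w a * (ln R' - ln (norm a))"
      using log_weight_nonneg[of R' a] assms unfolding w by (intro mult_nonneg_nonneg) auto
  qed
  moreover have "(\<Sum>a\<in>?S. ?w a * (ln R' - ln (norm a))) \<ge> (\<Sum>a\<in>?S. ?w a * ln (R' / R))"
  proof (intro sum_mono mult_left_mono)
    fix a assume "a \<in> ?S"
    hence "ln (norm a) \<le> ln R" using assms by (cases "a = 0") auto
    thus "ln (R' / R) \<le> ln R' - ln (norm a)" using assms by (simp add: ln_div)
  qed (auto simp: w)
  moreover have "(\<Sum>a\<in>?S. ?w a * ln (R' / R)) = divisor_count u R * ln (R' / R)"
    unfolding divisor_count_def w by (simp add: sum_distrib_right)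
  ultimately show ?thesis by linarith
qed

text \<open>Common frame of the estimates below: \<open>k a\<close> will be the absolute order at a,
  so that the sum becomes \<open>divisor_count\<close>, and \<open>\<psi> a\<close> a function whose
  mean is bounded independently of a.\<close>

lemma circle_mean_sum_bound:
  assumes "0 \<le> r" "continuous_on (sphere 0 r) f" "continuous_on (sphere 0 r) \<phi>" "finite S"
    and "\<And>a. a \<in> S \<Longrightarrow> continuous_on (sphere 0 r) (\<psi> a)" "\<And>a. a \<in> S \<Longrightarrow> 0 \<le> k a"
    and "\<And>a. a \<in> S \<Longrightarrow> circle_mean r (\<psi> a) \<le> c"
    and "\<And>z. norm z = r \<Longrightarrow> f z \<le> \<phi> z + (\<Sum>a\<in>S. k a * \<psi> a z)"
  shows "circle_mean r f \<le> circle_mean r \<phi> + c * (\<Sum>a\<in>S. k a)"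
proof -
  have cs: "continuous_on (sphere 0 r) (\<lambda>z. \<Sum>a\<in>S. k a * \<psi> a z)"
    by (intro continuous_on_sum continuous_on_mult continuous_on_const assms)
  have "circle_mean r f \<le> circle_mean r (\<lambda>z. \<phi> z + (\<Sum>a\<in>S. k a * \<psi> a z))"
    by (intro circle_mean_mono continuous_on_add cs assms)
  also have "\<dots> = circle_mean r \<phi> + circle_mean r (\<lambda>z. \<Sum>a\<in>S. k a * \<psi> a z)"
    by (intro circle_mean_add cs assms)
  also have "circle_mean r (\<lambda>z. \<Sum>a\<in>S. k a * \<psi> a z) = (\<Sum>a\<in>S. circle_mean r (\<lambda>z. k a * \<psi> a z))"
    by (intro circle_mean_sum continuous_on_mult continuous_on_const assms)
  also have "\<dots> = (\<Sum>a\<in>S. k a * circle_mean r (\<psi> a))" by (simp add: circle_mean_cmult)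
  also have "\<dots> \<le> (\<Sum>a\<in>S. k a * c)" by (intro sum_mono mult_left_mono assms)
  finally show ?thesis by (simp add: sum_distrib_left mult.commute)
qed

lemma ln2_le_1: "ln (2::real) \<le> 1"
  using ln_le_minus_one[of "2::real"] by simp

lemma continuous_on_circle_ln_linear:
  "norm a \<noteq> r \<Longrightarrow> continuous_on (sphere 0 r) (\<lambda>z. ln (norm (z - a)))"
  by (auto intro!: continuous_intros)

text \<open>Common source of the three estimates. On |w| = R, up to a constant, Re h is ln |u| minus
  the logarithms of the linear factors. Each of those has a bounded absolute mean after
  normalization, so \<open>deriv_bound_circle_mean_Re\<close> controls h' on the half disc by the
  proximity sum and the number of zeros and poles.\<close>

lemma master_factorization:
  assumes u: "merom_nonzero u" and R: "0 < R" "good_radius u R"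
  defines "S \<equiv> {a. a \<in> ball 0 (2 * R) \<and> zorder u a \<noteq> 0}"
  obtains h where "h holomorphic_on ball 0 (2 * R)"
    "\<And>z. norm z < 2 * R \<Longrightarrow> regular_at u z \<Longrightarrow> u z = exp (h z) * (\<Prod>a\<in>S. (z - a) powi zorder u a)"
    "\<And>z. norm z < 2 * R \<Longrightarrow> regular_at u z \<Longrightarrow>
       ln (norm (u z)) = Re (h z) + (\<Sum>a\<in>S. of_int (zorder u a) * ln (norm (z - a)))"
    "\<And>z. norm z \<le> R / 2 \<Longrightarrow> norm (deriv h z) \<le> 8 / R * (proximity_sum R u + 3 * divisor_count u (2 * R))"
proof -
  have finS: "finite S" unfolding S_def by (rule finite_divisor[OF u])
  have Seq: "{a \<in> ball 0 (2 * R). zorder u a \<noteq> 0} = S" by (auto simp: S_def)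
  obtain h where h: "h holomorphic_on ball 0 (2 * R)"
    "\<And>z. z \<in> ball 0 (2 * R) \<Longrightarrow> regular_at u z \<Longrightarrow> u z = exp (h z) * (\<Prod>a\<in>S. (z - a) powi zorder u a)"
    using local_factorization[OF u, of "2 * R", unfolded Seq] by blast
  have lnu: "ln (norm (u z)) = Re (h z) + (\<Sum>a\<in>S. of_int (zorder u a) * ln (norm (z - a)))"
    if "norm z < 2 * R" "regular_at u z" for z
    using ln_norm_factorization[OF u, of "2 * R" h z, unfolded Seq, OF h(2)] that by simp
  show thesis
  proof (rule that[OF h(1)])
    show "u z = exp (h z) * (\<Prod>a\<in>S. (z - a) powi zorder u a)" if "norm z < 2 * R" "regular_at u z" for z
      using h(2)[of z] that by simp
    fix z :: complex assume z: "norm z \<le> R / 2"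
    \<comment> \<open>Adding a constant does not change h', but it turns ln |w - a| into ln (|w - a|
      / R). Without it every zero and pole would cost a further ln R.\<close>
    define K where "K = (\<Sum>a\<in>S. of_int (zorder u a) * ln R)"
    define h1 where "h1 = (\<lambda>z. h z + of_real K)"
    have hd: "h field_differentiable at z"
      using h(1) z R by (intro holomorphic_on_imp_differentiable_at[of h "ball 0 (2*R)"]) auto
    have "norm (deriv h1 z) \<le> 8 / R * circle_mean R (\<lambda>w. \<bar>Re (h1 w)\<bar>)"
      by (rule deriv_bound_circle_mean_Re[of _ "2 * R"])
         (use h(1) R z in \<open>auto simp: h1_def intro!: holomorphic_intros\<close>)
    moreover have "deriv h1 z = deriv h z" using hd by (simp add: h1_def)
    moreover have "circle_mean R (\<lambda>w. \<bar>Re (h1 w)\<bar>) \<le> proximity_sum R u + 3 * divisor_count u (2 * R)"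
    proof -
      have ne: "norm a \<noteq> R" if "a \<in> S" for a
        using that R regular_at_zorder by (auto simp: S_def good_radius_def)
      have "circle_mean R (\<lambda>w. \<bar>Re (h1 w)\<bar>) \<le> circle_mean R (\<lambda>z. \<bar>ln (norm (u z))\<bar>) +
          3 * (\<Sum>a\<in>S. real_of_int \<bar>zorder u a\<bar>)"
      proof (rule circle_mean_sum_bound[where \<psi> = "\<lambda>a z. \<bar>ln (norm (z - a)) - ln (max R (norm a))\<bar> + ln 2"])
        show "continuous_on (sphere 0 R) (\<lambda>w. \<bar>Re (h1 w)\<bar>)"
          unfolding h1_def by (intro continuous_intros holomorphic_on_imp_continuous_on holomorphic_on_subset[OF h(1)])
            (use R in auto)
        show "continuous_on (sphere 0 R) (\<lambda>z. \<bar>ln (norm (u z))\<bar>)"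
          by (intro continuous_on_rabs good_radius_continuous_ln R)
      next
        fix a assume a: "a \<in> S"
        show "continuous_on (sphere 0 R) (\<lambda>z. \<bar>ln (norm (z - a)) - ln (max R (norm a))\<bar> + ln 2)"
          by (intro continuous_on_add continuous_on_rabs continuous_on_diff continuous_on_const continuous_on_circle_ln_linear ne[OF a])
        \<comment> \<open>The mean is at most 2 ln 2; another ln 2 pays for replacing max R |a| by
          R, since |a| < 2 R. The total 3 ln 2 is at most 3.\<close>
        show "circle_mean R (\<lambda>z. \<bar>ln (norm (z - a)) - ln (max R (norm a))\<bar> + ln 2) \<le> 3"
          using circle_mean_abs_ln_linear[OF R(1) ne[OF a]] ln2_le_1 R
          by (subst circle_mean_add)
             (auto intro!: continuous_on_rabs continuous_on_diff continuous_on_circle_ln_linear ne[OF a])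
      next
        fix w :: complex assume w: "norm w = R"
        have reg: "regular_at u w" using w R by (simp add: good_radius_def)
        have "Re (h1 w) = ln (norm (u w)) - (\<Sum>a\<in>S. of_int (zorder u a) * (ln (norm (w - a)) - ln R))"
          using lnu[OF _ reg] w R by (simp add: h1_def K_def sum_subtractf algebra_simps)
        hence "\<bar>Re (h1 w)\<bar> \<le> \<bar>ln (norm (u w))\<bar> + \<bar>\<Sum>a\<in>S. of_int (zorder u a) * (ln (norm (w - a)) - ln R)\<bar>"
          by linarith
        also have "\<bar>\<Sum>a\<in>S. of_int (zorder u a) * (ln (norm (w - a)) - ln R)\<bar> \<le>
            (\<Sum>a\<in>S. \<bar>of_int (zorder u a) * (ln (norm (w - a)) - ln R)\<bar>)" by (rule sum_abs)
        also have "\<dots> \<le> (\<Sum>a\<in>S. real_of_int \<bar>zorder u a\<bar> * (\<bar>ln (norm (w - a)) - ln (max R (norm a))\<bar> + ln 2))"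
        proof (rule sum_mono)
          fix a assume a: "a \<in> S"
          have "norm a < 2 * R" using a by (simp add: S_def)
          hence "ln (max R (norm a)) \<le> ln (2 * R)" using R by (subst ln_le_cancel_iff) auto
          moreover have "ln R \<le> ln (max R (norm a))" using R by (subst ln_le_cancel_iff) auto
          moreover have "ln (2 * R) = ln 2 + ln R" using R by (simp add: ln_mult)
          ultimately have "\<bar>ln (norm (w - a)) - ln R\<bar> \<le> \<bar>ln (norm (w - a)) - ln (max R (norm a))\<bar> + ln 2"
            by linarith
          thus "\<bar>of_int (zorder u a) * (ln (norm (w - a)) - ln R)\<bar> \<le>
              real_of_int \<bar>zorder u a\<bar> * (\<bar>ln (norm (w - a)) - ln (max R (norm a))\<bar> + ln 2)"
            unfolding abs_mult by (intro mult_mono) auto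
        qed
        finally show "\<bar>Re (h1 w)\<bar> \<le> \<bar>ln (norm (u w))\<bar> +
           (\<Sum>a\<in>S. real_of_int \<bar>zorder u a\<bar> * (\<bar>ln (norm (w - a)) - ln (max R (norm a))\<bar> + ln 2))" by simp
      qed (use R finS in auto)
      thus ?thesis by (simp add: proximity_sum_def divisor_count_def S_def)
    qed
    ultimately show "norm (deriv h z) \<le> 8 / R * (proximity_sum R u + 3 * divisor_count u (2 * R))"
      using R by (smt (verit) divide_nonneg_pos mult_left_mono)
  qed (use lnu in auto)
qed

lemma logderiv_prod_powi:
  assumes "finite S" "z \<notin> S"
  shows "((\<lambda>z. \<Prod>a\<in>S. (z - a) powi k a) has_field_derivative
    (\<Prod>a\<in>S. (z - a) powi k a) * (\<Sum>a\<in>S. of_int (k a) / (z - a))) (at (z::complex))"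
  using assms
proof (induction rule: finite_induct)
  case (insert x F)
  have ne: "z - x \<noteq> 0" using insert by auto
  have "((\<lambda>z. (z - x) powi k x) has_field_derivative of_int (k x) * (z - x) powi (k x - 1)) (at z)"
    using ne by (auto intro!: derivative_eq_intros)
  hence "((\<lambda>z. (z - x) powi k x) has_field_derivative (z - x) powi k x * (of_int (k x) / (z - x))) (at z)"
    using ne by (simp add: power_int_diff mult_ac)
  moreover have "((\<lambda>z. \<Prod>a\<in>F. (z - a) powi k a) has_field_derivative
    (\<Prod>a\<in>F. (z - a) powi k a) * (\<Sum>a\<in>F. of_int (k a) / (z - a))) (at z)" using insert by auto
  ultimately have "((\<lambda>z. (z - x) powi k x * (\<Prod>a\<in>F. (z - a) powi k a)) has_field_derivative
    (z - x) powi k x * (of_int (k x) / (z - x)) * (\<Prod>a\<in>F. (z - a) powi k a) +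
    (\<Prod>a\<in>F. (z - a) powi k a) * (\<Sum>a\<in>F. of_int (k a) / (z - a)) * (z - x) powi k x) (at z)"
    by (rule DERIV_mult)
  thus ?case using insert by (simp add: algebra_simps)
qed auto

text \<open>The argument of the logarithm is at most (1 + x) times the product of the 1 + k y, and
  Bernoulli's inequality bounds 1 + k y by (1 + y)^k. Multiplicities thus enter linearly, matching
  \<open>divisor_count\<close>, and no logarithm of the number of summands appears.\<close>

lemma log_plus_weighted_sum:
  fixes x :: real
  assumes "finite S" "0 \<le> x" "\<And>a. a \<in> S \<Longrightarrow> 0 \<le> y a"
  shows "ln (1 + (x + (\<Sum>a\<in>S. real (k a) * y a))) \<le> x + (\<Sum>a\<in>S. real (k a) * ln (1 + y a))"
  using assms(1,3)
proof (induction rule: finite_induct)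
  case empty
  show ?case using ln_add_one_self_le_self[OF assms(2)] by simp
next
  case (insert b F)
  define s where "s = x + (\<Sum>a\<in>F. real (k a) * y a)"
  have s: "0 \<le> s" unfolding s_def using insert assms by (intro add_nonneg_nonneg sum_nonneg) auto
  have yb: "0 \<le> y b" using insert by auto
  have "1 + (s + real (k b) * y b) \<le> (1 + s) * (1 + real (k b) * y b)"
    using s yb by (simp add: algebra_simps)
  also have "\<dots> \<le> (1 + s) * (1 + y b) ^ k b"
    using Bernoulli_inequality[of "y b" "k b"] s yb by (intro mult_left_mono) auto
  finally have "ln (1 + (s + real (k b) * y b)) \<le> ln ((1 + s) * (1 + y b) ^ k b)"
    using s yb by (subst ln_le_cancel_iff) (auto intro!: add_pos_nonneg mult_pos_pos)
  also have "\<dots> = ln (1 + s) + real (k b) * ln (1 + y b)"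
    using s yb by (simp add: ln_mult ln_realpow)
  finally show ?case using insert by (simp add: s_def algebra_simps)
qed

lemma eventually_regular_at:
  assumes "regular_at u z"
  shows "eventually (\<lambda>w. regular_at u w) (nhds z)"
proof -
  obtain A where A: "open A" "z \<in> A" "u holomorphic_on A"
    using assms unfolding regular_at_def analytic_at by blast
  have "eventually (\<lambda>w. w \<in> A) (nhds z)" using A by (intro eventually_nhds_in_open)
  moreover have "eventually (\<lambda>w. u w \<noteq> 0) (nhds z)"
    using assms analytic_at_neq_imp_eventually_neq[of u z 0]
    by (simp add: regular_at_def eventually_nhds_conv_at)
  ultimately show ?thesis
    by eventually_elim (use A analytic_at in \<open>auto simp: regular_at_def\<close>)
qed

text \<open>From the factorization, u'/u = h' + sum of ord(a) / (z - a). The bound for h' is kept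
  without a logarithm, since it carries the factor 8/R and is negligible anyway; each fraction
  contributes a bounded mean per multiplicity.\<close>

theorem log_derivative_bound:
  assumes u: "merom_nonzero u" and r: "1 \<le> r" "2 * r \<le> R" "good_radius u r" "good_radius u R"
    and cont: "continuous_on (sphere 0 r) (deriv u)"
  shows "nevanlinna_m r (\<lambda>z. deriv u z / u z) \<le>
    8 / R * (proximity_sum R u + 3 * divisor_count u (2 * R)) + 3 * divisor_count u (2 * R)"
proof -
  define S where "S = {a. a \<in> ball 0 (2 * R) \<and> zorder u a \<noteq> 0}"
  define H where "H = 8 / R * (proximity_sum R u + 3 * divisor_count u (2 * R))"
  have finS: "finite S" unfolding S_def by (rule finite_divisor[OF u])
  have R0: "0 < R" using r by simp
  obtain h where h: "h holomorphic_on ball 0 (2 * R)"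
    "\<And>z. norm z < 2 * R \<Longrightarrow> regular_at u z \<Longrightarrow> u z = exp (h z) * (\<Prod>a\<in>S. (z - a) powi zorder u a)"
    "\<And>z. norm z < 2 * R \<Longrightarrow> regular_at u z \<Longrightarrow>
       ln (norm (u z)) = Re (h z) + (\<Sum>a\<in>S. of_int (zorder u a) * ln (norm (z - a)))"
    "\<And>z. norm z \<le> R / 2 \<Longrightarrow> norm (deriv h z) \<le> H"
    by (rule master_factorization[OF u R0 r(4), folded S_def H_def]) (rule that)
  have ne: "norm a \<noteq> r" if "a \<in> S" for a
    using that r regular_at_zorder by (auto simp: S_def good_radius_def)
  have logd: "deriv u z / u z = deriv h z + (\<Sum>a\<in>S. of_int (zorder u a) / (z - a))" if z: "norm z = r" for z
  proof -
    have reg: "regular_at u z" using z r by (simp add: good_radius_def)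
    have zS: "z \<notin> S" using ne z by auto
    have "eventually (\<lambda>w. w \<in> ball 0 (2 * R)) (nhds z)"
      using z r by (intro eventually_nhds_in_open) auto
    moreover have "eventually (\<lambda>w. regular_at u w) (nhds z)" by (rule eventually_regular_at[OF reg])
    ultimately have ev: "eventually (\<lambda>w. u w = exp (h w) * (\<Prod>a\<in>S. (w - a) powi zorder u a)) (nhds z)"
      by eventually_elim (use h(2) in auto)
    let ?P = "\<Prod>a\<in>S. (z - a) powi zorder u a"
    have "(h has_field_derivative deriv h z) (at z)"
      using z r by (intro holomorphic_derivI[OF h(1)]) auto
    hence "((\<lambda>w. exp (h w) * (\<Prod>a\<in>S. (w - a) powi zorder u a)) has_field_derivative
        (exp (h z) * deriv h z) * ?P + (?P * (\<Sum>a\<in>S. of_int (zorder u a) / (z - a))) * exp (h z)) (at z)"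
      by (intro DERIV_mult logderiv_prod_powi finS zS DERIV_fun_exp)
    hence "deriv u z = (exp (h z) * deriv h z) * ?P + (?P * (\<Sum>a\<in>S. of_int (zorder u a) / (z - a))) * exp (h z)"
      using deriv_cong_ev[OF ev refl] DERIV_imp_deriv by simp
    also have "\<dots> = exp (h z) * ?P * (deriv h z + (\<Sum>a\<in>S. of_int (zorder u a) / (z - a)))"
      by (simp add: algebra_simps)
    also have "exp (h z) * ?P = u z" using h(2)[of z] reg z r by simp
    finally show ?thesis using reg by (simp add: regular_at_def)
  qed
  have "circle_mean r (\<lambda>z. log_plus (norm (deriv u z / u z))) \<le> circle_mean r (\<lambda>_. H) + 3 * (\<Sum>a\<in>S. real_of_int \<bar>zorder u a\<bar>)"
  proof (rule circle_mean_sum_bound[where \<psi> = "\<lambda>a z. ln 2 + \<bar>ln (norm (z - a)) - ln (max r (norm a))\<bar>"])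
    show "continuous_on (sphere 0 r) (\<lambda>z. log_plus (norm (deriv u z / u z)))"
      using cont good_radius_continuous[OF r(3)] good_radius_nonzero[OF r(3)]
      by (intro continuous_intros) auto
  next
    fix a assume a: "a \<in> S"
    show "continuous_on (sphere 0 r) (\<lambda>z. ln 2 + \<bar>ln (norm (z - a)) - ln (max r (norm a))\<bar>)"
      by (intro continuous_on_add continuous_on_rabs continuous_on_diff continuous_on_const continuous_on_circle_ln_linear ne[OF a])
    show "circle_mean r (\<lambda>z. ln 2 + \<bar>ln (norm (z - a)) - ln (max r (norm a))\<bar>) \<le> 3"
      using circle_mean_abs_ln_linear[of r a] ln2_le_1 r ne[OF a]
      by (subst circle_mean_add)
         (auto intro!: continuous_on_rabs continuous_on_diff continuous_on_circle_ln_linear)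
  next
    fix z :: complex assume z: "norm z = r"
    let ?k = "\<lambda>a. nat \<bar>zorder u a\<bar>"
    have "norm (deriv u z / u z) \<le> norm (deriv h z) + norm (\<Sum>a\<in>S. of_int (zorder u a) / (z - a))"
      unfolding logd[OF z] by (rule norm_triangle_ineq)
    also have "\<dots> \<le> norm (deriv h z) + (\<Sum>a\<in>S. norm (of_int (zorder u a) / (z - a)))"
      by (intro add_left_mono norm_sum)
    also have "\<dots> \<le> H + (\<Sum>a\<in>S. real (?k a) * (1 / norm (z - a)))"
      using h(4)[of z] z r by (intro add_mono sum_mono) (auto simp: norm_divide)
    finally have "log_plus (norm (deriv u z / u z)) \<le> log_plus (H + (\<Sum>a\<in>S. real (?k a) * (1 / norm (z - a))))"
      by (rule log_plus_mono)
    also have H0: "0 \<le> H" using h(4)[of 0] R0 by (auto intro: order_trans[OF norm_ge_zero])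
    hence "log_plus (H + (\<Sum>a\<in>S. real (?k a) * (1 / norm (z - a)))) \<le> ln (1 + (H + (\<Sum>a\<in>S. real (?k a) * (1 / norm (z - a)))))"
      by (intro log_plus_le_ln_add_one add_nonneg_nonneg sum_nonneg) auto
    also have "\<dots> \<le> H + (\<Sum>a\<in>S. real (?k a) * ln (1 + 1 / norm (z - a)))"
      by (rule log_plus_weighted_sum[OF finS H0]) auto
    also have "\<dots> \<le> H + (\<Sum>a\<in>S. real_of_int \<bar>zorder u a\<bar> * (ln 2 + \<bar>ln (norm (z - a)) - ln (max r (norm a))\<bar>))"
    proof (intro add_left_mono sum_mono)
      fix a assume a: "a \<in> S"
      define t where "t = norm (z - a)"
      have t: "0 < t" using ne[OF a] z by (auto simp: t_def)
      \<comment> \<open>For t >= 1 the left side is at most ln 2. For t < 1 it is at most ln 2 - ln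
        t, and - ln t is bounded by the absolute value because max r |a| >= 1.\<close>
      have "ln (1 + 1 / t) \<le> ln 2 + \<bar>ln t - ln (max r (norm a))\<bar>"
      proof (cases "t \<ge> 1")
        case True
        hence "ln (1 + 1 / t) \<le> ln 2" using t by (subst ln_le_cancel_iff) (auto intro: add_pos_pos)
        thus ?thesis by simp
      next
        case False
        hence "ln (1 + 1 / t) \<le> ln (2 / t)" using t by (subst ln_le_cancel_iff) (auto simp: field_simps intro: add_pos_pos)
        also have "\<dots> = ln 2 - ln t" using t by (simp add: ln_div)
        also have "0 \<le> ln (max r (norm a))" using r by simp
        ultimately show ?thesis by linarith
      qed
      thus "real (?k a) * ln (1 + 1 / norm (z - a)) \<le>
          real_of_int \<bar>zorder u a\<bar> * (ln 2 + \<bar>ln (norm (z - a)) - ln (max r (norm a))\<bar>)"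
        unfolding t_def by (simp add: mult_left_mono)
    qed
    finally show "log_plus (norm (deriv u z / u z)) \<le> H + 
        (\<Sum>a\<in>S. real_of_int \<bar>zorder u a\<bar> * (ln 2 + \<bar>ln (norm (z - a)) - ln (max r (norm a))\<bar>))" .
  qed (use r finS in auto)
  thus ?thesis unfolding nevanlinna_m_circle_mean H_def S_def divisor_count_def by simp
qed

section \<open>Shifts, and functions with few zeros and poles\<close>

lemma regular_at_affine:
  assumes "regular_at (\<lambda>z. u (q * z + c)) z" "q \<noteq> 0"
  shows "regular_at u (q * z + c)"
proof -
  have "(\<lambda>w. (w - c) / q) analytic_on {q * z + c}"
    using assms(2) by (intro analytic_intros) auto
  hence "(\<lambda>z. u (q * z + c)) \<circ> (\<lambda>w. (w - c) / q) analytic_on {q * z + c}"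
    by (rule analytic_on_compose) (use assms in \<open>auto simp: regular_at_def\<close>)
  moreover have "(\<lambda>z. u (q * z + c)) \<circ> (\<lambda>w. (w - c) / q) = u"
    using assms(2) by (auto simp: fun_eq_iff)
  ultimately show ?thesis using assms by (simp add: regular_at_def)
qed

lemma master_difference:
  assumes "h holomorphic_on ball 0 (2 * R)" "0 < R" 
    and "\<And>z. norm z \<le> R / 2 \<Longrightarrow> norm (deriv h z) \<le> B"
    and "norm z \<le> R / 2" "norm w \<le> R / 2"
  shows "norm (h z - h w) \<le> B * norm (z - w)"
  by (rule field_differentiable_bound[of "cball 0 (R / 2)" h "deriv h"])
     (use assms in \<open>auto intro!: holomorphic_derivI[OF assms(1)]\<close>)

text \<open>The two quantities under the logarithms bound each other up to one factor that depends
  only on q and c; the translation by c is absorbed because r >= 1. Hence pulling a zero or pole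
  back along q z + c changes its normalizing constant by a bounded amount, uniformly in a and
  r.\<close>

lemma ln_max_affine:
  fixes q c a :: complex
  assumes "q \<noteq> 0" "1 \<le> r"
  shows "\<bar>ln (norm q * max r (norm ((a - c) / q))) - ln (max r (norm a))\<bar>
          \<le> ln (1 + norm q + norm c + 1 / norm q + norm c / norm q)"
proof -
  define B where "B = 1 + norm q + norm c + 1 / norm q + norm c / norm q"
  define X where "X = max (norm q * r) (norm (a - c))"
  define Y where "Y = max r (norm a)"
  have q: "0 < norm q" using assms by simp
  have X: "norm q * max r (norm ((a - c) / q)) = X"
    using q by (simp add: X_def norm_divide max_mult_distrib_left)
  have pos: "0 < X" "0 < Y" using q assms by (auto simp: X_def Y_def less_max_iff_disj)
  have B1: "1 \<le> B" unfolding B_def using q by simp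
  have "norm q * r \<le> norm q * Y" "norm (a - c) \<le> (1 + norm c) * Y"
  proof -
    show "norm q * r \<le> norm q * Y" using q by (simp add: Y_def)
    have "norm (a - c) \<le> norm a + norm c" by (rule norm_triangle_ineq4)
    also have "\<dots> \<le> Y + norm c * Y"
      using assms by (intro add_mono) (auto simp: Y_def intro!: mult_left_le[of 1, simplified] mult_le_cancel_left1[THEN iffD2] )
    finally show "norm (a - c) \<le> (1 + norm c) * Y" by (simp add: algebra_simps)
  qed
  moreover have "norm q * Y \<le> B * Y" "(1 + norm c) * Y \<le> B * Y"
    using pos q by (intro mult_right_mono; simp add: B_def)+
  ultimately have XY: "X \<le> B * Y" by (simp add: X_def)
  have "r \<le> 1 / norm q * X"
    using q by (auto simp: X_def field_simps)
  moreover have "norm a \<le> (1 + norm c / norm q) * X"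
  proof -
    have "norm a \<le> norm (a - c) + norm c" using norm_triangle_ineq[of "a - c" c] by simp
    moreover have "norm c * norm q \<le> norm c * X"
    proof (rule mult_left_mono)
      have "norm q * 1 \<le> norm q * r" using assms by (intro mult_left_mono) auto
      thus "norm q \<le> X" by (simp add: X_def)
    qed simp
    hence "norm c \<le> norm c / norm q * X" using q by (simp add: field_simps)
    moreover have "norm (a - c) \<le> X" by (simp add: X_def)
    ultimately show ?thesis by (simp add: algebra_simps)
  qed
  moreover have "1 / norm q * X \<le> B * X" "(1 + norm c / norm q) * X \<le> B * X"
    using pos q by (intro mult_right_mono; simp add: B_def)+
  ultimately have YX: "Y \<le> B * X" by (simp add: Y_def)
  have "ln X \<le> ln (B * Y)" using XY pos B1 by (subst ln_le_cancel_iff) auto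
  moreover have "ln Y \<le> ln (B * X)" using YX pos B1 by (subst ln_le_cancel_iff) auto
  ultimately show ?thesis unfolding X Y_def[symmetric] B_def[symmetric]
    using pos B1 by (simp add: ln_mult split: if_splits)
qed

text \<open>In ln |u(q z + c)| - ln |u(z)| the part from h is at most sup |h'| times the distance |q
  z + c - z| = O(r), hence carries r/R. Each linear factor at q z + c is, up to |q|, the linear
  factor at z with the point (a - c)/q, so it has the same kind of bounded mean.\<close>

lemma shift_mean_bound:
  assumes u: "merom_nonzero u" and q: "q \<noteq> 0"
  obtains K where "0 < K"
    "\<And>r R. \<lbrakk>1 \<le> r; K * r \<le> R; good_radius u r; good_radius (\<lambda>z. u (q * z + c)) r; good_radius u R\<rbrakk> \<Longrightarrow>
       circle_mean r (\<lambda>z. \<bar>ln (norm (u (q * z + c))) - ln (norm (u z))\<bar>)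
         \<le> K * (r / R * (proximity_sum R u + 3 * divisor_count u (2 * R)) + divisor_count u (2 * R))"
proof -
  define B where "B = ln (1 + norm q + norm c + 1 / norm q + norm c / norm q)"
  define A where "A = norm q + norm c + 1"
  \<comment> \<open>8 A comes from the bound 8/R for h' times the distance at most A r; 4 + B is the
    mean per multiplicity, 2 for each of the two linear factors and B from
    \<open>ln_max_affine\<close>. Moreover K >= 2 A, so \<open>K * r \<le> R\<close> puts both
    points into the half disc.\<close>
  define K where "K = 8 * A + 4 + B"
  have qp: "0 < norm q" using q by simp
  have A1: "1 \<le> A" by (simp add: A_def)
  have B0: "0 \<le> B" unfolding B_def using qp by (intro ln_ge_zero) simp
  show thesis
  proof (rule that[of K])
    show "0 < K" using A1 B0 by (simp add: K_def)
    fix r R assume r: "1 \<le> r" "K * r \<le> R" and good: "good_radius u r" "good_radius (\<lambda>z. u (q * z + c)) r" "good_radius u R"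
    define D where "D = proximity_sum R u + 3 * divisor_count u (2 * R)"
    define S where "S = {a. a \<in> ball 0 (2 * R) \<and> zorder u a \<noteq> 0}"
    have finS: "finite S" unfolding S_def by (rule finite_divisor[OF u])
    have KA: "2 * A * r \<le> R"
      by (rule order_trans[OF mult_right_mono r(2)]) (use A1 B0 r in \<open>auto simp: K_def\<close>)
    have Ar: "1 * r \<le> A * r" using A1 r by (intro mult_right_mono) auto
    have R0: "0 < R" using KA Ar r by linarith
    obtain h where h: "h holomorphic_on ball 0 (2 * R)"
      "\<And>z. norm z < 2 * R \<Longrightarrow> regular_at u z \<Longrightarrow> u z = exp (h z) * (\<Prod>a\<in>S. (z - a) powi zorder u a)"
      "\<And>z. norm z < 2 * R \<Longrightarrow> regular_at u z \<Longrightarrow>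
         ln (norm (u z)) = Re (h z) + (\<Sum>a\<in>S. of_int (zorder u a) * ln (norm (z - a)))"
      "\<And>z. norm z \<le> R / 2 \<Longrightarrow> norm (deriv h z) \<le> 8 / R * D"
      by (rule master_factorization[OF u R0 good(3), folded S_def D_def]) (rule that)
    have ne: "norm a \<noteq> r" if "a \<in> S" for a
      using that good regular_at_zorder by (auto simp: S_def good_radius_def)
    have ne': "norm ((a - c) / q) \<noteq> r" if "a \<in> S" for a
    proof
      assume *: "norm ((a - c) / q) = r"
      have "regular_at (\<lambda>z. u (q * z + c)) ((a - c) / q)"
        using good(2) * unfolding good_radius_def by blast
      hence "regular_at u (q * ((a - c) / q) + c)" using q by (rule regular_at_affine)
      thus False using that regular_at_zorder q by (auto simp: S_def)
    qed
    let ?a' = "\<lambda>a. (a - c) / q"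
    let ?\<psi> = "\<lambda>a z. \<bar>ln (norm (z - a)) - ln (max r (norm a))\<bar>"
    have c\<psi>: "continuous_on (sphere 0 r) (?\<psi> a)" if "norm a \<noteq> r" for a
      by (intro continuous_on_rabs continuous_on_diff continuous_on_const continuous_on_circle_ln_linear that)
    have "circle_mean r (\<lambda>z. \<bar>ln (norm (u (q * z + c))) - ln (norm (u z))\<bar>)
        \<le> circle_mean r (\<lambda>_. 8 / R * D * (A * r)) + (4 + B) * (\<Sum>a\<in>S. real_of_int \<bar>zorder u a\<bar>)"
    proof (rule circle_mean_sum_bound[where \<psi> = "\<lambda>a z. ?\<psi> (?a' a) z + ?\<psi> a z + B"])
      show "continuous_on (sphere 0 r) (\<lambda>z. \<bar>ln (norm (u (q * z + c))) - ln (norm (u z))\<bar>)"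
        by (intro continuous_on_rabs continuous_on_diff good_radius_continuous_ln[OF good(1)] good_radius_continuous_ln[OF good(2)])
    next
      fix a assume a: "a \<in> S"
      show "continuous_on (sphere 0 r) (\<lambda>z. ?\<psi> (?a' a) z + ?\<psi> a z + B)"
        by (intro continuous_on_add continuous_on_const c\<psi> ne ne' a)
      have "circle_mean r (\<lambda>z. ?\<psi> (?a' a) z + ?\<psi> a z + B) = circle_mean r (?\<psi> (?a' a)) + circle_mean r (?\<psi> a) + B"
      proof -
        have c1: "continuous_on (sphere 0 r) (?\<psi> (?a' a))" and c2: "continuous_on (sphere 0 r) (?\<psi> a)"
          by (rule c\<psi>, rule ne' ne, rule a)+
        show ?thesis using r
          circle_mean_add[OF _ continuous_on_add[OF c1 c2] continuous_on_const, of B] circle_mean_add[OF _ c1 c2]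
          by simp
      qed
      also have "\<dots> \<le> 2 + 2 + B"
        using circle_mean_abs_ln_linear[of r "?a' a"] circle_mean_abs_ln_linear[of r a] ne[OF a] ne'[OF a] r ln2_le_1
        by (intro add_mono) auto
      finally show "circle_mean r (\<lambda>z. ?\<psi> (?a' a) z + ?\<psi> a z + B) \<le> 4 + B" by simp
    next
      fix z :: complex assume z: "norm z = r"
      let ?w = "q * z + c"
      have reg: "regular_at u z" using good(1) z by (simp add: good_radius_def)
      have reg': "regular_at u ?w" using good(2) z q by (auto simp: good_radius_def intro: regular_at_affine)
      have nw: "norm ?w + norm z \<le> A * r"
      proof -
        have "norm ?w \<le> norm q * r + norm c * 1" using norm_triangle_ineq[of "q * z" c] z by (simp add: norm_mult)
        also have "\<dots> \<le> norm q * r + norm c * r" using r by (intro add_left_mono mult_left_mono) auto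
        finally show ?thesis using z by (simp add: A_def algebra_simps)
      qed
      hence nw': "norm ?w \<le> R / 2" "norm z \<le> R / 2" using KA norm_ge_zero[of ?w] norm_ge_zero[of z] by linarith+
      have "norm (h ?w - h z) \<le> 8 / R * D * norm (?w - z)"
        by (rule master_difference[OF h(1) R0 h(4) nw'])
      also have "\<dots> \<le> 8 / R * D * (A * r)"
      proof (rule mult_left_mono)
        show "norm (?w - z) \<le> A * r" using norm_triangle_ineq4[of ?w z] nw by linarith
        show "0 \<le> 8 / R * D" using h(4)[of 0] R0 by (auto intro: order_trans[OF norm_ge_zero])
      qed
      finally have hd: "\<bar>Re (h ?w) - Re (h z)\<bar> \<le> 8 / R * D * (A * r)"
        using abs_Re_le_cmod[of "h ?w - h z"] by simp
      have "ln (norm (u ?w)) - ln (norm (u z)) = Re (h ?w) - Re (h z) +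
          (\<Sum>a\<in>S. of_int (zorder u a) * (ln (norm (?w - a)) - ln (norm (z - a))))"
        using h(3)[OF _ reg'] h(3)[OF _ reg] nw' R0 by (simp add: sum_subtractf algebra_simps)
      hence "\<bar>ln (norm (u ?w)) - ln (norm (u z))\<bar> \<le> 8 / R * D * (A * r) +
          \<bar>\<Sum>a\<in>S. of_int (zorder u a) * (ln (norm (?w - a)) - ln (norm (z - a)))\<bar>"
        using hd by linarith
      also have "\<dots> \<le> 8 / R * D * (A * r) +
          (\<Sum>a\<in>S. \<bar>of_int (zorder u a) * (ln (norm (?w - a)) - ln (norm (z - a)))\<bar>)"
        by (intro add_left_mono sum_abs)
      also have "\<dots> \<le> 8 / R * D * (A * r) +
          (\<Sum>a\<in>S. real_of_int \<bar>zorder u a\<bar> * (?\<psi> (?a' a) z + ?\<psi> a z + B))"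
      proof (intro add_left_mono sum_mono)
        fix a assume a: "a \<in> S"
        have ne1: "z - ?a' a \<noteq> 0" using ne'[OF a] z by auto
        have "?w - a = q * (z - ?a' a)" using q by (simp add: field_simps)
        hence "ln (norm (?w - a)) = ln (norm q) + ln (norm (z - ?a' a))"
          using ne1 q by (simp add: norm_mult ln_mult)
        moreover have "\<bar>ln (norm q * max r (norm (?a' a))) - ln (max r (norm a))\<bar> \<le> B"
          unfolding B_def by (rule ln_max_affine[OF q r(1)])
        moreover have "ln (norm q * max r (norm (?a' a))) = ln (norm q) + ln (max r (norm (?a' a)))"
          using q r by (subst ln_mult) auto
        ultimately have "\<bar>ln (norm (?w - a)) - ln (norm (z - a))\<bar> \<le> ?\<psi> (?a' a) z + ?\<psi> a z + B"
          by linarith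
        thus "\<bar>of_int (zorder u a) * (ln (norm (?w - a)) - ln (norm (z - a)))\<bar> \<le>
            real_of_int \<bar>zorder u a\<bar> * (?\<psi> (?a' a) z + ?\<psi> a z + B)"
          unfolding abs_mult by (intro mult_mono) auto
      qed
      finally show "\<bar>ln (norm (u ?w)) - ln (norm (u z))\<bar> \<le> 8 / R * D * (A * r) +
          (\<Sum>a\<in>S. real_of_int \<bar>zorder u a\<bar> * (?\<psi> (?a' a) z + ?\<psi> a z + B))" .
    qed (use r finS in auto)
    also have "\<dots> = 8 * A * (r / R * D) + (4 + B) * divisor_count u (2 * R)"
      by (simp add: divisor_count_def S_def)
    also have "\<dots> \<le> K * (r / R * D) + K * divisor_count u (2 * R)"
    proof (intro add_mono mult_right_mono)
      show "0 \<le> r / R * D"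
        unfolding D_def using r R0 divisor_count_nonneg[of u "2 * R"] proximity_sum_nonneg[OF good(3)] by auto
    qed (use A1 B0 divisor_count_nonneg in \<open>auto simp: K_def\<close>)
    finally show "circle_mean r (\<lambda>z. \<bar>ln (norm (u (q * z + c))) - ln (norm (u z))\<bar>)
         \<le> K * (r / R * (proximity_sum R u + 3 * divisor_count u (2 * R)) + divisor_count u (2 * R))"
      unfolding D_def by (simp add: distrib_left)
  qed
qed

text \<open>The factorization shows that ln |u| deviates from its own mean over the circle by little
  on average, and Jensen's formula computes this mean as C + N(r, 1/u) - N(r, u). So few zeros and
  few poles force ln |u| itself to be small in mean.\<close>

lemma balanced_mean_bound:
  assumes u: "merom_nonzero u"
  obtains C where "\<And>r R. \<lbrakk>1 \<le> r; 2 * r \<le> R; good_radius u r; good_radius u R\<rbrakk> \<Longrightarrow>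
     proximity_sum r u \<le> C + nevanlinna_N r u + nevanlinna_N r (\<lambda>z. inverse (u z)) +
       8 * (r / R) * (proximity_sum R u + 3 * divisor_count u (2 * R)) + 2 * divisor_count u (2 * R)"
proof -
  obtain C where C: "\<And>r. 0 < r \<Longrightarrow> good_radius u r \<Longrightarrow>
    circle_mean r (\<lambda>z. ln (norm (u z))) = C + log_count r (\<lambda>a. of_int (zorder u a))"
    using jensen[OF u] by blast
  show thesis
  proof (rule that[of "\<bar>C\<bar>"])
    fix r R :: real assume r: "1 \<le> r" "2 * r \<le> R" and good: "good_radius u r" "good_radius u R"
    define D where "D = proximity_sum R u + 3 * divisor_count u (2 * R)"
    define S where "S = {a. a \<in> ball 0 (2 * R) \<and> zorder u a \<noteq> 0}"
    have finS: "finite S" unfolding S_def by (rule finite_divisor[OF u])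
    have R0: "0 < R" using r by linarith
    obtain h where h: "h holomorphic_on ball 0 (2 * R)"
      "\<And>z. norm z < 2 * R \<Longrightarrow> regular_at u z \<Longrightarrow> u z = exp (h z) * (\<Prod>a\<in>S. (z - a) powi zorder u a)"
      "\<And>z. norm z < 2 * R \<Longrightarrow> regular_at u z \<Longrightarrow>
         ln (norm (u z)) = Re (h z) + (\<Sum>a\<in>S. of_int (zorder u a) * ln (norm (z - a)))"
      "\<And>z. norm z \<le> R / 2 \<Longrightarrow> norm (deriv h z) \<le> 8 / R * D"
      by (rule master_factorization[OF u R0 good(2), folded S_def D_def]) (rule that)
    have ne: "norm a \<noteq> r" if "a \<in> S" for a
      using that good regular_at_zorder by (auto simp: S_def good_radius_def)
    have conth: "continuous_on (sphere 0 r) h"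
      by (rule holomorphic_on_imp_continuous_on[OF holomorphic_on_subset[OF h(1)]]) (use r in auto)
    define b where "b = Re (h 0) + (\<Sum>a\<in>S. of_int (zorder u a) * ln (max r (norm a)))"
    have mean: "circle_mean r (\<lambda>z. ln (norm (u z))) = b"
    proof -
      have "circle_mean r (\<lambda>z. ln (norm (u z))) = 
            circle_mean r (\<lambda>z. Re (h z) + (\<Sum>a\<in>S. of_int (zorder u a) * ln (norm (z - a))))"
      proof (rule circle_mean_cong)
        fix z :: complex assume "norm z = r"
        thus "ln (norm (u z)) = Re (h z) + (\<Sum>a\<in>S. of_int (zorder u a) * ln (norm (z - a)))"
          using r good(1) by (intro h(3)) (auto simp: good_radius_def)
      qed (use r in simp)
      also have "\<dots> =
            circle_mean r (\<lambda>z. Re (h z)) + circle_mean r (\<lambda>z. \<Sum>a\<in>S. of_int (zorder u a) * ln (norm (z - a)))"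
        by (rule circle_mean_add)
          (use r conth ne in \<open>auto intro!: continuous_on_sum continuous_on_mult continuous_on_Re continuous_on_circle_ln_linear\<close>)
      also have "circle_mean r (\<lambda>z. \<Sum>a\<in>S. of_int (zorder u a) * ln (norm (z - a))) =
            (\<Sum>a\<in>S. circle_mean r (\<lambda>z. of_int (zorder u a) * ln (norm (z - a))))"
        by (rule circle_mean_sum) (use r finS ne in \<open>auto intro!: continuous_on_mult continuous_on_circle_ln_linear\<close>)
      also have "\<dots> = (\<Sum>a\<in>S. of_int (zorder u a) * ln (max r (norm a)))"
        by (rule sum.cong) (use ne r in \<open>simp_all add: circle_mean_cmult circle_mean_ln_linear\<close>)
      finally show ?thesis using circle_mean_Re_holomorphic[OF h(1), of r] r by (simp add: b_def)
    qed
    have "proximity_sum r u \<le> circle_mean r (\<lambda>_. \<bar>b\<bar> + 8 / R * D * r) + 2 * (\<Sum>a\<in>S. real_of_int \<bar>zorder u a\<bar>)"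
      unfolding proximity_sum_def
    proof (rule circle_mean_sum_bound[where \<psi> = "\<lambda>a z. \<bar>ln (norm (z - a)) - ln (max r (norm a))\<bar>"])
      show "continuous_on (sphere 0 r) (\<lambda>z. \<bar>ln (norm (u z))\<bar>)"
        by (intro continuous_on_rabs good_radius_continuous_ln good)
      show "continuous_on (sphere 0 r) (\<lambda>z. \<bar>ln (norm (z - a)) - ln (max r (norm a))\<bar>)" if "a \<in> S" for a
        by (intro continuous_on_rabs continuous_on_diff continuous_on_const continuous_on_circle_ln_linear ne that)
      show "circle_mean r (\<lambda>z. \<bar>ln (norm (z - a)) - ln (max r (norm a))\<bar>) \<le> 2" if "a \<in> S" for a
        using circle_mean_abs_ln_linear[of r a] ne[OF that] r ln2_le_1 by auto
      fix z :: complex assume z: "norm z = r"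
      have reg: "regular_at u z" using good(1) z by (simp add: good_radius_def)
      have "norm (h z - h 0) \<le> 8 / R * D * norm (z - 0)"
        by (rule master_difference[OF h(1) R0 h(4)]) (use z r R0 in auto)
      hence "\<bar>Re (h z) - Re (h 0)\<bar> \<le> 8 / R * D * r"
        using abs_Re_le_cmod[of "h z - h 0"] z by simp
      moreover have "ln (norm (u z)) = b + (Re (h z) - Re (h 0)) +
          (\<Sum>a\<in>S. of_int (zorder u a) * (ln (norm (z - a)) - ln (max r (norm a))))"
        using h(3)[OF _ reg] z r by (simp add: b_def sum_subtractf algebra_simps)
      ultimately have "\<bar>ln (norm (u z))\<bar> \<le> \<bar>b\<bar> + 8 / R * D * r + 
          \<bar>\<Sum>a\<in>S. of_int (zorder u a) * (ln (norm (z - a)) - ln (max r (norm a)))\<bar>"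
        by linarith
      also have "\<dots> \<le> \<bar>b\<bar> + 8 / R * D * r + 
          (\<Sum>a\<in>S. \<bar>of_int (zorder u a) * (ln (norm (z - a)) - ln (max r (norm a)))\<bar>)"
        by (intro add_left_mono sum_abs)
      finally show "\<bar>ln (norm (u z))\<bar> \<le> \<bar>b\<bar> + 8 / R * D * r + 
          (\<Sum>a\<in>S. real_of_int \<bar>zorder u a\<bar> * \<bar>ln (norm (z - a)) - ln (max r (norm a))\<bar>)"
        by (simp add: abs_mult)
    qed (use r finS in auto)
    also have "\<dots> = \<bar>b\<bar> + 8 * (r / R) * D + 2 * divisor_count u (2 * R)"
      by (simp add: divisor_count_def S_def)
    finally have 1: "proximity_sum r u \<le> \<bar>b\<bar> + 8 * (r / R) * D + 2 * divisor_count u (2 * R)" .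
    have "b = C + log_count r (\<lambda>a. zero_mult u a - pole_mult u a)"
      using mean C[OF _ good(1)] r by (simp add: zorder_eq_mults)
    also have "\<dots> = C + (nevanlinna_N r (\<lambda>z. inverse (u z)) - nevanlinna_N r u)"
      using r by (simp add: nevanlinna_N_log_count[OF u] nevanlinna_N_inverse[OF u] log_count_diff
          loc_finite_pole_mult loc_finite_zero_mult u)
    finally have "b = \<dots>" .
    moreover have "0 \<le> nevanlinna_N r u" "0 \<le> nevanlinna_N r (\<lambda>z. inverse (u z))"
      using r by (auto simp: nevanlinna_N_log_count[OF u] nevanlinna_N_inverse[OF u] pole_mult_def zero_mult_def
        intro!: log_count_nonneg)
    ultimately show "proximity_sum r u \<le> \<bar>C\<bar> + nevanlinna_N r u + nevanlinna_N r (\<lambda>z. inverse (u z)) +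
       8 * (r / R) * (proximity_sum R u + 3 * divisor_count u (2 * R)) + 2 * divisor_count u (2 * R)"
      using 1 unfolding D_def by linarith
  qed
qed

lemma nevanlinna_N_nonneg: "merom_nonzero u \<Longrightarrow> 1 \<le> r \<Longrightarrow> 0 \<le> nevanlinna_N r u"
  by (auto simp: nevanlinna_N_log_count pole_mult_def intro!: log_count_nonneg)

lemma zorder_affine:
  assumes u: "merom_nonzero u" and q: "q \<noteq> 0"
  shows "zorder (\<lambda>z. u (q * z + c)) z = zorder u (q * z + c)"
proof -
  have "zorder (u \<circ> (\<lambda>z. q * z + c)) z = zorder u (q * z + c) * zorder (\<lambda>x. (q * x + c) - (q * z + c)) z"
  proof (rule zorder_compose')
    show "isolated_singularity_at u (q * z + c)" "not_essential u (q * z + c)"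
      using merom_nonzero_mero[OF u] meromorphic_at_iff by blast+
    show "\<forall>\<^sub>F w in at (q * z + c). u w \<noteq> 0" by (rule merom_nonzero_at[OF u])
    show "\<forall>\<^sub>F w in at z. q * w + c \<noteq> q * z + c"
      using eventually_neq_at_within[of z z] by eventually_elim (use q in auto)
  qed (auto intro!: analytic_intros)
  also have "(\<lambda>x. (q * x + c) - (q * z + c)) = (\<lambda>x. q * (x - z))" by (auto simp: algebra_simps)
  also have "zorder (\<lambda>x. q * (x - z)) z = 1"
    using zorder_mero_mult[OF merom_nonzero_const[OF q] merom_nonzero_linear, of z z] q
    by (simp add: zorder_linear)
  finally show ?thesis by (simp add: o_def)
qed

lemma merom_nonzero_affine:
  assumes u: "merom_nonzero u" and q: "q \<noteq> 0"
  shows "merom_nonzero (\<lambda>z. u (q * z + c))"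
proof (rule merom_nonzeroI)
  show "(\<lambda>z. u (q * z + c)) meromorphic_on UNIV"
    by (rule meromorphic_on_compose[OF merom_nonzero_mero[OF u, of UNIV]]) (auto intro!: analytic_intros)
  have "\<forall>\<^sub>F z in at z0. u (q * z + c) \<noteq> 0" for z0
  proof (rule eventually_compose_filterlim[OF merom_nonzero_at[OF u]])
    show "filterlim (\<lambda>z. q * z + c) (at (q * z0 + c)) (at z0)"
    proof (rule filterlim_atI)
      show "\<forall>\<^sub>F w in at z0. q * w + c \<noteq> q * z0 + c"
        using eventually_neq_at_within[of z0 z0] by eventually_elim (use q in auto)
    qed (auto intro!: tendsto_intros)
  qed
  thus "\<forall>\<^sub>\<approx>z. u (q * z + c) \<noteq> 0" by (simp add: eventually_cosparse_open_eq)
qed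

text \<open>A pole b of u becomes a pole at (b - c)/q, and the weights of the two differ by a
  bounded amount. The exception is b = c, which moves to the origin and receives the full weight ln
  r; this explains the additional \<open>ln r\<close>.\<close>

lemma shift_N_bound:
  assumes u: "merom_nonzero u" and q: "q \<noteq> 0"
  obtains K where "0 \<le> K"
    "\<And>r R. \<lbrakk>1 \<le> r; (norm q + norm c + 1) * r \<le> R\<rbrakk> \<Longrightarrow>
       nevanlinna_N r (\<lambda>z. u (q * z + c)) \<le> nevanlinna_N r u + K * (divisor_count u R + ln r)"
proof -
  have qp: "0 < norm q" using q by simp
  define P where "P = {a. zorder u a < 0}"
  have "P sparse_in UNIV"
    by (rule sparse_in_subset2[OF zorder_support_sparse[OF u]]) (auto simp: P_def)
  hence "eventually (\<lambda>y. y \<notin> P) (at c)"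
    using sparse_in_eventually_iff[of UNIV P] by simp
  \<comment> \<open>All poles other than c keep at least the distance d from c. Without such a gap
    ln (|b| / |b - c|) would be unbounded.\<close>
  then obtain d where d: "0 < d" "\<And>x. x \<noteq> c \<Longrightarrow> dist x c < d \<Longrightarrow> x \<notin> P"
    unfolding eventually_at by blast
  have far: "d \<le> norm (b - c)" if "b \<in> P" "b \<noteq> c" for b
    using d(2)[OF that(2)] that(1) by (force simp: dist_norm)
  \<comment> \<open>The first two terms bound the change of weight for b nonzero and for b = 0; the
    multiplicity at c pays for the pole that moves to the origin.\<close>
  define K where "K = \<bar>ln (norm q * (1 + norm c / d))\<bar> + \<bar>ln (norm q / d)\<bar> + pole_mult u c"
  have K0: "0 \<le> K" by (simp add: K_def pole_mult_def)
  show thesis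
  proof (rule that[OF K0])
    fix r R assume r: "1 \<le> r" "(norm q + norm c + 1) * r \<le> R"
    let ?v = "\<lambda>z. u (q * z + c)"
    let ?\<nu> = "pole_mult u"
    have v: "merom_nonzero ?v" by (rule merom_nonzero_affine[OF u q])
    have pv: "pole_mult ?v b = ?\<nu> (q * b + c)" for b
      by (simp add: pole_mult_def zorder_affine[OF u q])
    have rR: "r < R \<and> norm q * r + norm c < R"
    proof -
      have "norm c * 1 \<le> norm c * r" "0 \<le> norm q * r" using r mult_left_mono[OF r(1), of "norm c"] by auto
      moreover have "norm q * r + norm c * r + r \<le> R" using r by (simp add: algebra_simps)
      moreover have "0 < r" using r by simp
      show ?thesis
      proof (cases "norm c * r = 0")
        case True
        thus ?thesis using calculation qp \<open>0 < r\<close> by (smt (verit) mult_pos_pos)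
      next
        case False
        thus ?thesis using calculation qp \<open>0 < r\<close> by (smt (verit) mult_pos_pos mult_nonneg_nonneg norm_ge_zero)
      qed
    qed
    define A where "A = {b. b \<in> P \<and> norm (b - c) \<le> norm q * r}"
    have A_ball: "A \<subseteq> {b. b \<in> ball 0 R \<and> zorder u b \<noteq> 0}"
    proof
      fix b assume b: "b \<in> A"
      hence "norm b \<le> norm q * r + norm c" using norm_triangle_ineq[of "b - c" c] by (auto simp: A_def)
      thus "b \<in> {b. b \<in> ball 0 R \<and> zorder u b \<noteq> 0}" using b rR by (auto simp: A_def P_def)
    qed
    hence finA: "finite A" using finite_divisor[OF u] finite_subset by blast
    have "nevanlinna_N r ?v = log_count r (pole_mult ?v)" using r v by (intro nevanlinna_N_log_count) auto
    also have "\<dots> = (\<Sum>b'\<in>{b'. norm b' \<le> r \<and> pole_mult ?v b' \<noteq> 0}. pole_mult ?v b' * (ln r - ln (norm b')))"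
      by (simp add: log_count_def)
    also have "\<dots> = (\<Sum>b\<in>A. ?\<nu> b * (ln r - ln (norm ((b - c) / q))))"
    proof (rule sum.reindex_bij_witness[of _ "\<lambda>b. (b - c) / q" "\<lambda>z. q * z + c"])
      fix b assume "b \<in> A"
      thus "(b - c) / q \<in> {b'. norm b' \<le> r \<and> pole_mult ?v b' \<noteq> 0}"
        unfolding mem_Collect_eq pv using q qp by (auto simp: A_def P_def pole_mult_def norm_divide pos_divide_le_eq mult.commute)
    next
      fix b' assume "b' \<in> {b'. norm b' \<le> r \<and> pole_mult ?v b' \<noteq> 0}"
      thus "q * b' + c \<in> A"
        unfolding mem_Collect_eq pv using q qp by (auto simp: A_def P_def pole_mult_def norm_mult)
    qed (use q in \<open>auto simp: pv\<close>)
    also have "\<dots> \<le> (\<Sum>b\<in>A. ?\<nu> b * ((if norm b \<le> r then ln r - ln (norm b) else 0) + K + (if b = c then ln r else 0)))"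
    proof (intro sum_mono mult_left_mono)
      fix b assume b: "b \<in> A"
      show "ln r - ln (norm ((b - c) / q)) \<le> (if norm b \<le> r then ln r - ln (norm b) else 0) + K + (if b = c then ln r else 0)"
      proof (cases "b = c")
        case True
        thus ?thesis using log_weight_nonneg[OF r(1), of b] K0 by auto
      next
        case False
        have bc: "d \<le> norm (b - c)" using far b False by (auto simp: A_def)
        hence bc0: "0 < norm (b - c)" using d by linarith
        \<comment> \<open>Serves the case b = 0, whose own weight is ln r because
          \<open>ln 0 = 0\<close>.\<close>
        have 1: "- ln (norm ((b - c) / q)) \<le> \<bar>ln (norm q / d)\<bar>"
        proof -
          have "- ln (norm ((b - c) / q)) = ln (norm q / norm (b - c))"
            using bc0 qp by (simp add: norm_divide ln_div)
          also have "\<dots> \<le> ln (norm q / d)" using bc bc0 qp d by (subst ln_le_cancel_iff) (auto intro!: divide_left_mono)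
          finally show ?thesis by linarith
        qed
        have 2: "ln (norm b) - ln (norm ((b - c) / q)) \<le> \<bar>ln (norm q * (1 + norm c / d))\<bar>" if "b \<noteq> 0"
        proof -
          have "norm b \<le> norm (b - c) + norm c" using norm_triangle_ineq[of "b - c" c] by simp
          also have "norm c \<le> norm c / d * norm (b - c)"
            using bc d mult_left_mono[OF bc, of "norm c"] by (simp add: field_simps)
          finally have "norm b \<le> (1 + norm c / d) * norm (b - c)" by (simp add: algebra_simps)
          hence "norm b * norm q \<le> norm q * (1 + norm c / d) * norm (b - c)" using qp by (simp add: mult.commute mult_left_mono mult.assoc)
          hence le: "norm b / norm ((b - c) / q) \<le> norm q * (1 + norm c / d)"
            using bc0 qp by (simp add: norm_divide field_simps)
          have "ln (norm b) - ln (norm ((b - c) / q)) = ln (norm b / norm ((b - c) / q))"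
            using that False q by (subst ln_div) auto
          also have "\<dots> \<le> ln (norm q * (1 + norm c / d))"
            using le that False q qp d by (subst ln_le_cancel_iff) (auto intro!: mult_pos_pos add_pos_nonneg divide_pos_pos)
          finally show ?thesis by linarith
        qed
        \<comment> \<open>Serves poles outside the disc, which count 0 for u at radius r: there ln r
          may be replaced by ln |b|, and the comparison of weights applies.\<close>
        have 3: "ln r \<le> ln (norm b)" if "\<not> norm b \<le> r" using that r by (subst ln_le_cancel_iff) auto
        have "0 \<le> ?\<nu> c" by (simp add: pole_mult_def)
        hence K: "\<bar>ln (norm q * (1 + norm c / d))\<bar> \<le> K" "\<bar>ln (norm q / d)\<bar> \<le> K" by (auto simp: K_def)
        show ?thesis
        proof (cases "b = 0")
          case True
          thus ?thesis using 1 K False r by simp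
        next
          case b0: False
          show ?thesis
          proof (cases "norm b \<le> r")
            case True
            thus ?thesis using 2[OF b0] K False by simp
          next
            case nr: False
            have "(if norm b \<le> r then ln r - ln (norm b) else 0) + K + (if b = c then ln r else 0) = K"
              using nr False by simp
            thus ?thesis using 2[OF b0] 3[OF nr] K by linarith
          qed
        qed
      qed
    qed (auto simp: pole_mult_def)
    also have "\<dots> = (\<Sum>b\<in>A. if norm b \<le> r then ?\<nu> b * (ln r - ln (norm b)) else 0) +
        K * (\<Sum>b\<in>A. ?\<nu> b) + (\<Sum>b\<in>A. if b = c then ?\<nu> c * ln r else 0)"
      unfolding sum_distrib_left sum.distrib[symmetric] by (rule sum.cong) (auto simp: algebra_simps)
    also have "(\<Sum>b\<in>A. if norm b \<le> r then ?\<nu> b * (ln r - ln (norm b)) else 0) \<le> nevanlinna_N r u"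
    proof -
      have "(\<Sum>b\<in>A. if norm b \<le> r then ?\<nu> b * (ln r - ln (norm b)) else 0) = (\<Sum>b | b \<in> A \<and> norm b \<le> r. ?\<nu> b * (ln r - ln (norm b)))"
        using finA by (simp add: sum.inter_filter)
      also have "\<dots> \<le> (\<Sum>b | norm b \<le> r \<and> ?\<nu> b \<noteq> 0. ?\<nu> b * (ln r - ln (norm b)))"
      proof (rule sum_mono2)
        show "finite {b. norm b \<le> r \<and> ?\<nu> b \<noteq> 0}" by (intro loc_finiteD loc_finite_pole_mult u)
        show "{b. b \<in> A \<and> norm b \<le> r} \<subseteq> {b. norm b \<le> r \<and> ?\<nu> b \<noteq> 0}" by (auto simp: A_def P_def pole_mult_def)
        show "\<And>b. b \<in> {b. norm b \<le> r \<and> ?\<nu> b \<noteq> 0} - {b. b \<in> A \<and> norm b \<le> r} \<Longrightarrow> 0 \<le> ?\<nu> b * (ln r - ln (norm b))"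
          by (intro mult_nonneg_nonneg log_weight_nonneg[OF r(1)]) (auto simp: pole_mult_def)
      qed
      also have "\<dots> = nevanlinna_N r u" using r by (subst nevanlinna_N_log_count[OF u]) (auto simp: log_count_def)
      finally show ?thesis .
    qed
    also have "(\<Sum>b\<in>A. ?\<nu> b) \<le> divisor_count u R"
    proof -
      have "(\<Sum>b\<in>A. ?\<nu> b) = (\<Sum>b\<in>A. real_of_int \<bar>zorder u b\<bar>)"
        by (rule sum.cong) (auto simp: A_def P_def pole_mult_def)
      also have "\<dots> \<le> divisor_count u R"
        unfolding divisor_count_def by (intro sum_mono2 finite_divisor u A_ball) auto
      finally show ?thesis .
    qed
    also have "(\<Sum>b\<in>A. if b = c then ?\<nu> c * ln r else 0) \<le> K * ln r"
    proof -
      have "?\<nu> c * ln r \<le> K * ln r" using r by (intro mult_right_mono) (auto simp: K_def)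
      moreover have "0 \<le> K * ln r" using r K0 by simp
      ultimately show ?thesis using finA by simp
    qed
    finally show "nevanlinna_N r ?v \<le> nevanlinna_N r u + K * (divisor_count u R + ln r)"
      using K0 by (simp add: distrib_left mult_left_mono add_mono)
  qed
qed

section \<open>The characteristic and the second main theorem\<close>

lemma merom_nonzero_limit:
  assumes "merom_nonzero w" "zorder w a \<ge> 0"
  shows "\<exists>c. (w \<longlongrightarrow> c) (at a)"
proof -
  have "not_essential w a" using merom_nonzero_mero[OF assms(1)] meromorphic_at_iff by blast
  moreover have "\<not> is_pole w a" using is_pole_iff_zorder[OF assms(1)] assms(2) by auto
  ultimately show ?thesis by (auto simp: not_essential_def)
qed

text \<open>After multiplication by (z - a)^p, where p is the sum of all the pole orders, every
  summand has a finite limit at a, hence so has the sum.\<close>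

lemma pole_mult_sum_le:
  assumes "finite I" "\<And>i. i \<in> I \<Longrightarrow> merom_nonzero (u i)" "merom_nonzero (\<lambda>z. \<Sum>i\<in>I. u i z)"
  shows "pole_mult (\<lambda>z. \<Sum>i\<in>I. u i z) a \<le> (\<Sum>i\<in>I. pole_mult (u i) a)"
proof -
  define p where "p = (\<Sum>i\<in>I. nat (- zorder (u i) a))"
  have pw: "merom_nonzero (\<lambda>z. (z - a) ^ p)" by (intro merom_nonzero_power merom_nonzero_linear)
  have ordp: "zorder (\<lambda>z. (z - a) ^ p) a = int p"
    using zorder_mero_powi[OF merom_nonzero_linear[of a], of "int p" a] by (simp add: zorder_linear)
  have "\<exists>c. ((\<lambda>z. u i z * (z - a) ^ p) \<longlongrightarrow> c) (at a)" if i: "i \<in> I" for i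
  proof (rule merom_nonzero_limit)
    show "merom_nonzero (\<lambda>z. u i z * (z - a) ^ p)" by (intro merom_nonzero_mult pw assms i)
    have "nat (- zorder (u i) a) \<le> p" unfolding p_def using assms(1) i by (intro member_le_sum) auto
    thus "0 \<le> zorder (\<lambda>z. u i z * (z - a) ^ p) a"
      by (simp add: zorder_mero_mult assms i pw ordp)
  qed
  then obtain c where c: "\<And>i. i \<in> I \<Longrightarrow> ((\<lambda>z. u i z * (z - a) ^ p) \<longlongrightarrow> c i) (at a)" by metis
  have "((\<lambda>z. \<Sum>i\<in>I. u i z * (z - a) ^ p) \<longlongrightarrow> (\<Sum>i\<in>I. c i)) (at a)" by (intro tendsto_sum c)
  hence lim: "((\<lambda>z. (\<Sum>i\<in>I. u i z) * (z - a) ^ p) \<longlongrightarrow> (\<Sum>i\<in>I. c i)) (at a)"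
    by (simp add: sum_distrib_right)
  have "\<not> is_pole (\<lambda>z. (\<Sum>i\<in>I. u i z) * (z - a) ^ p) a"
    using lim not_tendsto_and_filterlim_at_infinity[OF at_neq_bot] unfolding is_pole_def by blast
  hence "0 \<le> zorder (\<lambda>z. (\<Sum>i\<in>I. u i z) * (z - a) ^ p) a"
    using is_pole_iff_zorder[OF merom_nonzero_mult[OF assms(3) pw]] by (auto simp: not_less)
  hence "- zorder (\<lambda>z. \<Sum>i\<in>I. u i z) a \<le> int p"
    by (simp add: zorder_mero_mult assms(3) pw ordp)
  hence "nat (- zorder (\<lambda>z. \<Sum>i\<in>I. u i z) a) \<le> p" by simp
  thus ?thesis unfolding pole_mult_def p_def by (metis of_nat_le_iff of_nat_sum)
qed

lemma nevanlinna_m_mult_le: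
  assumes "0 \<le> r" "continuous_on (sphere 0 r) u" "continuous_on (sphere 0 r) v"
  shows "nevanlinna_m r (\<lambda>z. u z * v z) \<le> nevanlinna_m r u + nevanlinna_m r v"
proof -
  have "nevanlinna_m r (\<lambda>z. u z * v z) \<le> circle_mean r (\<lambda>z. log_plus (norm (u z)) + log_plus (norm (v z)))"
    unfolding nevanlinna_m_circle_mean
    by (intro circle_mean_mono assms continuous_intros) (auto simp: norm_mult intro: log_plus_mult_le)
  also have "\<dots> = nevanlinna_m r u + nevanlinna_m r v"
    unfolding nevanlinna_m_circle_mean by (intro circle_mean_add assms continuous_intros)
  finally show ?thesis .
qed

lemma nevanlinna_m_sum_le:
  assumes "0 \<le> r" "finite I" "\<And>i. i \<in> I \<Longrightarrow> continuous_on (sphere 0 r) (u i)"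
  shows "nevanlinna_m r (\<lambda>z. \<Sum>i\<in>I. u i z) \<le> (\<Sum>i\<in>I. nevanlinna_m r (u i)) + ln (max 1 (real (card I)))"
proof -
  have c: "continuous_on (sphere 0 r) (\<lambda>z. \<Sum>i\<in>I. log_plus (norm (u i z)))"
    by (intro continuous_on_sum log_plus_continuous continuous_on_norm assms)
  have "nevanlinna_m r (\<lambda>z. \<Sum>i\<in>I. u i z) \<le> 
      circle_mean r (\<lambda>z. (\<Sum>i\<in>I. log_plus (norm (u i z))) + ln (max 1 (real (card I))))"
    unfolding nevanlinna_m_circle_mean
  proof (rule circle_mean_mono)
    fix z
    have "log_plus (norm (\<Sum>i\<in>I. u i z)) \<le> log_plus (\<Sum>i\<in>I. norm (u i z))"
      by (intro log_plus_mono norm_sum)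
    also have "\<dots> \<le> (\<Sum>i\<in>I. log_plus (norm (u i z))) + ln (max 1 (real (card I)))"
      by (rule log_plus_sum_le) (use assms in auto)
    finally show "log_plus (norm (\<Sum>i\<in>I. u i z)) \<le> (\<Sum>i\<in>I. log_plus (norm (u i z))) + ln (max 1 (real (card I)))" .
  qed (intro assms c log_plus_continuous continuous_on_norm continuous_on_sum continuous_on_add continuous_on_const; assumption)+
  also have "\<dots> = (\<Sum>i\<in>I. nevanlinna_m r (u i)) + ln (max 1 (real (card I)))"
    unfolding nevanlinna_m_circle_mean
    using circle_mean_add[OF assms(1) c continuous_on_const]
      circle_mean_sum[OF assms(1,2), of "\<lambda>i z. log_plus (norm (u i z))"]
    by (simp add: log_plus_continuous continuous_on_norm assms)
  finally show ?thesis .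
qed

lemma nevanlinna_m_nonneg:
  assumes "0 \<le> r" "continuous_on (sphere 0 r) u"
  shows "0 \<le> nevanlinna_m r u"
  unfolding nevanlinna_m_circle_mean
  by (intro circle_mean_nonneg assms log_plus_continuous continuous_on_norm) simp

lemma nevanlinna_T_nonneg:
  assumes "merom_nonzero u" "1 \<le> r" "good_radius u r"
  shows "0 \<le> nevanlinna_T r u" "nevanlinna_N r u \<le> nevanlinna_T r u" "nevanlinna_m r u \<le> nevanlinna_T r u"
  using nevanlinna_m_nonneg[of r u] nevanlinna_N_nonneg[OF assms(1,2)] assms good_radius_continuous[OF assms(3)]
  by (auto simp: nevanlinna_T_def)

lemma nevanlinna_T_mult_le:
  assumes u: "merom_nonzero u" and v: "merom_nonzero v" and r: "1 \<le> r"
    and cont: "continuous_on (sphere 0 r) u" "continuous_on (sphere 0 r) v"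
  shows "nevanlinna_T r (\<lambda>z. u z * v z) \<le> nevanlinna_T r u + nevanlinna_T r v"
proof -
  have uv: "merom_nonzero (\<lambda>z. u z * v z)" by (intro merom_nonzero_mult u v)
  have "nevanlinna_N r (\<lambda>z. u z * v z) \<le> log_count r (\<lambda>a. pole_mult u a + pole_mult v a)"
  proof -
    have "pole_mult (\<lambda>z. u z * v z) a \<le> pole_mult u a + pole_mult v a" for a
      by (simp add: pole_mult_def zorder_mero_mult[OF u v])
    thus ?thesis using r
      by (simp add: nevanlinna_N_log_count[OF uv] log_count_mono loc_finite_add loc_finite_pole_mult u v uv)
  qed
  also have "\<dots> = nevanlinna_N r u + nevanlinna_N r v"
    using r by (simp add: log_count_add loc_finite_pole_mult nevanlinna_N_log_count u v)
  finally show ?thesis using nevanlinna_m_mult_le[OF _ cont] r by (simp add: nevanlinna_T_def)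
qed

lemma nevanlinna_N_sum_le:
  assumes "finite I" "\<And>i. i \<in> I \<Longrightarrow> merom_nonzero (u i)" "merom_nonzero (\<lambda>z. \<Sum>i\<in>I. u i z)" and r: "1 \<le> r"
  shows "nevanlinna_N r (\<lambda>z. \<Sum>i\<in>I. u i z) \<le> (\<Sum>i\<in>I. nevanlinna_N r (u i))"
proof -
  have "nevanlinna_N r (\<lambda>z. \<Sum>i\<in>I. u i z) \<le> log_count r (\<lambda>a. \<Sum>i\<in>I. pole_mult (u i) a)"
    using r pole_mult_sum_le[OF assms(1-3)] assms
    by (simp add: nevanlinna_N_log_count) (intro log_count_mono loc_finite_sum loc_finite_pole_mult; simp)
  also have "\<dots> = (\<Sum>i\<in>I. nevanlinna_N r (u i))"
    using r assms by (simp add: log_count_sum loc_finite_pole_mult nevanlinna_N_log_count)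
  finally show ?thesis .
qed

lemma nevanlinna_T_sum_le:
  assumes "finite I" "\<And>i. i \<in> I \<Longrightarrow> merom_nonzero (u i)" "merom_nonzero (\<lambda>z. \<Sum>i\<in>I. u i z)" and r: "1 \<le> r"
    and cont: "\<And>i. i \<in> I \<Longrightarrow> continuous_on (sphere 0 r) (u i)"
  shows "nevanlinna_T r (\<lambda>z. \<Sum>i\<in>I. u i z) \<le> (\<Sum>i\<in>I. nevanlinna_T r (u i)) + ln (max 1 (real (card I)))"
  using nevanlinna_N_sum_le[OF assms(1-4)] nevanlinna_m_sum_le[of r I u] cont r assms(1)
  by (simp add: nevanlinna_T_def sum.distrib)

lemma nevanlinna_T_add_le:
  assumes "merom_nonzero u" "merom_nonzero v" "merom_nonzero (\<lambda>z. u z + v z)" "1 \<le> r"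
    and "continuous_on (sphere 0 r) u" "continuous_on (sphere 0 r) v"
  shows "nevanlinna_T r (\<lambda>z. u z + v z) \<le> nevanlinna_T r u + nevanlinna_T r v + ln 2"
  using nevanlinna_T_sum_le[of "{True, False}" "\<lambda>b. if b then u else v" r] assms by auto

lemma nevanlinna_T_const:
  assumes "c \<noteq> 0" "0 < r"
  shows "nevanlinna_T r (\<lambda>_. c) = log_plus (norm c)"
  using assms by (simp add: nevanlinna_T_def nevanlinna_m_circle_mean nevanlinna_N_log_count
      merom_nonzero_const pole_mult_def log_count_def)

lemma pole_mult_uminus: "merom_nonzero u \<Longrightarrow> pole_mult (\<lambda>z. - u z) = pole_mult u"
  using zorder_mero_mult[OF merom_nonzero_const[of "-1"], of u] by (simp add: pole_mult_def fun_eq_iff)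

lemma merom_nonzero_uminus: "merom_nonzero u \<Longrightarrow> merom_nonzero (\<lambda>z. - u z)"
  using merom_nonzero_mult[OF merom_nonzero_const[of "-1"], of u] by simp

lemma nevanlinna_T_uminus:
  assumes "merom_nonzero u" "0 < r"
  shows "nevanlinna_T r (\<lambda>z. - u z) = nevanlinna_T r u"
  using assms by (simp add: nevanlinna_T_def nevanlinna_m_def nevanlinna_N_log_count merom_nonzero_uminus pole_mult_uminus)

lemma nevanlinna_T_diff_le:
  assumes "merom_nonzero u" "merom_nonzero v" "merom_nonzero (\<lambda>z. u z - v z)" "1 \<le> r"
    and "continuous_on (sphere 0 r) u" "continuous_on (sphere 0 r) v"
  shows "nevanlinna_T r (\<lambda>z. u z - v z) \<le> nevanlinna_T r u + nevanlinna_T r v + ln 2"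
  using nevanlinna_T_add_le[of u "\<lambda>z. - v z" r] assms
  by (simp add: merom_nonzero_uminus nevanlinna_T_uminus continuous_on_minus)

text \<open>Stated through all differences f - c so that each of them has meaningful orders; c = 0
  gives meromorphy of f itself.\<close>

definition nonconstant_mero :: "(complex \<Rightarrow> complex) \<Rightarrow> bool" where
  "nonconstant_mero f \<longleftrightarrow> (\<forall>c. merom_nonzero (\<lambda>z. f z - c))"

lemma nonconstant_meroD: "nonconstant_mero f \<Longrightarrow> merom_nonzero (\<lambda>z. f z - c)"
  by (simp add: nonconstant_mero_def)

lemma nonconstant_mero_nonzero: "nonconstant_mero f \<Longrightarrow> merom_nonzero f"
  using nonconstant_meroD[of f 0] by simp

lemma zorder_diff_const:
  assumes f: "nonconstant_mero f"
  shows "zorder f a < 0 \<Longrightarrow> zorder (\<lambda>z. f z - c) a = zorder f a"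
    and "zorder (\<lambda>z. f z - c) a < 0 \<Longrightarrow> zorder f a < 0"
proof -
  have pole: "zorder (\<lambda>z. f z - c) a = zorder f a" if "zorder f a < 0" and f: "nonconstant_mero f" for f c
  proof (cases "c = 0")
    case False
    have f0: "merom_nonzero f" using f by (rule nonconstant_mero_nonzero)
    show ?thesis
      by (rule zorder_diff1[OF merom_nonzero_mero[OF f0] merom_nonzero_freq[OF f0]]) (use that False in auto)
  qed auto
  show "zorder f a < 0 \<Longrightarrow> zorder (\<lambda>z. f z - c) a = zorder f a" using pole f by blast
  assume *: "zorder (\<lambda>z. f z - c) a < 0"
  have "nonconstant_mero (\<lambda>z. f z - c)"
    unfolding nonconstant_mero_def
  proof
    fix d show "merom_nonzero (\<lambda>z. f z - c - d)" using nonconstant_meroD[OF f, of "c + d"] by (simp add: algebra_simps)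
  qed
  from pole[OF * this, of "-c"] * show "zorder f a < 0" by simp
qed

lemma poly_decompose_apply:
  fixes P :: "complex poly"
  shows "poly P w = lead_coeff P * (\<Prod>e | poly P e = 0. (w - e) ^ order e P)"
proof -
  have "poly P w = poly (smult (lead_coeff P) (\<Prod>e | poly P e = 0. [:-e, 1:] ^ order e P)) w"
    by (simp add: complex_poly_decompose)
  also have "\<dots> = lead_coeff P * (\<Prod>e | poly P e = 0. (w - e) ^ order e P)"
    by (simp add: poly_prod)
  finally show ?thesis .
qed

lemma poly_comp_decompose:
  fixes P :: "complex poly"
  shows "(\<lambda>z. poly P (f z)) = (\<lambda>z. lead_coeff P * (\<Prod>e | poly P e = 0. (f z - e) ^ order e P))"
  by (rule ext) (rule poly_decompose_apply)

lemma sum_order_complex_poly: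
  fixes P :: "complex poly"
  assumes "P \<noteq> 0"
  shows "(\<Sum>e | poly P e = 0. order e P) = degree P"
proof -
  have "degree P = degree (smult (lead_coeff P) (\<Prod>e | poly P e = 0. [:-e, 1:] ^ order e P))"
    by (simp add: complex_poly_decompose)
  also have "\<dots> = (\<Sum>e | poly P e = 0. degree ([:-e, 1:] ^ order e P))"
    using assms by (simp add: degree_prod_eq_sum_degree)
  finally show ?thesis by (simp add: degree_linear_power)
qed

lemma merom_nonzero_poly:
  assumes "nonconstant_mero f" "P \<noteq> 0"
  shows "merom_nonzero (\<lambda>z. poly P (f z))"
  unfolding poly_comp_decompose[of P f] using assms
  by (intro merom_nonzero_mult merom_nonzero_const merom_nonzero_prod merom_nonzero_power nonconstant_meroD) auto

lemma zorder_poly_comp: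
  assumes f: "nonconstant_mero f" and P: "P \<noteq> 0"
  shows "zorder (\<lambda>z. poly P (f z)) a = (\<Sum>e | poly P e = 0. int (order e P) * zorder (\<lambda>z. f z - e) a)"
proof -
  have mp: "merom_nonzero (\<lambda>z. (f z - e) ^ order e P)" for e by (intro merom_nonzero_power nonconstant_meroD f)
  have zp: "zorder (\<lambda>z. (f z - e) ^ order e P) a = int (order e P) * zorder (\<lambda>z. f z - e) a" for e
    using zorder_mero_powi[OF nonconstant_meroD[OF f, of e], of "int (order e P)" a] by simp
  have "zorder (\<lambda>z. poly P (f z)) a = zorder (\<lambda>_. lead_coeff P) a + zorder (\<lambda>z. \<Prod>e | poly P e = 0. (f z - e) ^ order e P) a"
    unfolding poly_comp_decompose[of P f] using P
    by (intro zorder_mero_mult merom_nonzero_const merom_nonzero_prod mp) auto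
  also have "zorder (\<lambda>z. \<Prod>e | poly P e = 0. (f z - e) ^ order e P) a = (\<Sum>e | poly P e = 0. zorder (\<lambda>z. (f z - e) ^ order e P) a)"
    by (intro zorder_mero_prod mp)
  finally show ?thesis using P by (simp add: zp)
qed

text \<open>At a pole of f every factor f - e has the order of f, and the multiplicities of the
  roots add up to the degree.\<close>

lemma pole_mult_poly_comp:
  assumes f: "nonconstant_mero f" and P: "P \<noteq> 0"
  shows "real (degree P) * pole_mult f a \<le> pole_mult (\<lambda>z. poly P (f z)) a"
proof (cases "zorder f a < 0")
  case True
  have "zorder (\<lambda>z. poly P (f z)) a = (\<Sum>e | poly P e = 0. int (order e P)) * zorder f a"
    unfolding zorder_poly_comp[OF f P] sum_distrib_right
    by (rule sum.cong) (auto simp: zorder_diff_const(1)[OF f True])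
  also have "(\<Sum>e | poly P e = 0. int (order e P)) = int (degree P)"
    using sum_order_complex_poly[OF P] by (metis of_nat_sum)
  finally have "- zorder (\<lambda>z. poly P (f z)) a = int (degree P) * (- zorder f a)" by simp
  hence "nat (- zorder (\<lambda>z. poly P (f z)) a) = degree P * nat (- zorder f a)"
    by (simp only: nat_mult_distrib nat_int)
  thus ?thesis unfolding pole_mult_def by (metis of_nat_mult order_refl)
qed (simp add: pole_mult_def)

text \<open>This is where the number of distinct roots enters instead of the degree: counted without
  multiplicity, a zero of P(f) needs only one root e with f = e there, and a pole of P(f) is a pole
  of f.\<close>

lemma zorder_poly_comp_ne0:
  assumes f: "nonconstant_mero f" and P: "P \<noteq> 0"
  shows "of_bool (zorder (\<lambda>z. poly P (f z)) a \<noteq> 0) \<le> pole_mult f a + (\<Sum>e | poly P e = 0. zero_mult (\<lambda>z. f z - e) a)"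
proof (cases "zorder (\<lambda>z. poly P (f z)) a \<noteq> 0")
  case True
  have fin: "finite {e. poly P e = 0}" using P by (rule poly_roots_finite)
  obtain e where e: "poly P e = 0" "zorder (\<lambda>z. f z - e) a \<noteq> 0"
    using True unfolding zorder_poly_comp[OF f P] by (metis (mono_tags, lifting) mem_Collect_eq mult_zero_right sum.neutral)
  have nn: "0 \<le> (\<Sum>e | poly P e = 0. zero_mult (\<lambda>z. f z - e) a)" by (intro sum_nonneg) (simp add: zero_mult_def)
  show ?thesis
  proof (cases "zorder (\<lambda>z. f z - e) a < 0")
    case neg: True
    hence "zorder f a < 0" by (rule zorder_diff_const(2)[OF f])
    hence "1 \<le> pole_mult f a" by (simp add: pole_mult_def)
    thus ?thesis using True nn by simp
  next
    case False
    hence "1 \<le> zero_mult (\<lambda>z. f z - e) a" using e by (simp add: zero_mult_def)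
    also have "\<dots> \<le> (\<Sum>e | poly P e = 0. zero_mult (\<lambda>z. f z - e) a)"
      using e fin by (intro member_le_sum) (auto simp: zero_mult_def)
    finally show ?thesis using True by (simp add: pole_mult_def)
  qed
next
  case False
  thus ?thesis by (auto simp: pole_mult_def zero_mult_def intro!: add_nonneg_nonneg sum_nonneg)
qed

text \<open>Far out |P(w)| is at least half the modulus of the leading coefficient times |w|^n; on
  the remaining disc the left side is bounded.\<close>

lemma log_plus_poly_lower:
  fixes P :: "complex poly"
  assumes "P \<noteq> 0"
  obtains C where "\<And>w. real (degree P) * log_plus (norm w) \<le> log_plus (norm (poly P w)) + C"
proof -
  let ?n = "degree P"
  have l: "((\<lambda>w. poly P w / w ^ ?n) \<longlongrightarrow> lead_coeff P) at_infinity"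
    by (rule poly_divide_tendsto_aux)
  define d where "d = norm (lead_coeff P)"
  have d: "0 < d" using assms by (simp add: d_def)
  have "((\<lambda>w. norm (poly P w / w ^ ?n)) \<longlongrightarrow> d) at_infinity" unfolding d_def by (intro tendsto_norm l)
  hence "eventually (\<lambda>w. d / 2 < norm (poly P w / w ^ ?n)) at_infinity"
    by (rule order_tendstoD) (use d in auto)
  then obtain b where b: "\<And>w. b \<le> norm w \<Longrightarrow> d / 2 < norm (poly P w / w ^ ?n)"
    unfolding eventually_at_infinity by blast
  define b1 where "b1 = max b 1"
  define C where "C = log_plus (2 / d) + real ?n * log_plus b1"
  have pw: "real ?n * log_plus (norm w) = log_plus (norm w ^ ?n)" if "1 \<le> norm w" for w :: complex
  proof -
    have "1 \<le> norm w ^ ?n" using that by (rule one_le_power)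
    thus ?thesis using that by (simp add: log_plus_def max_def ln_realpow)
  qed
  show thesis
  proof (rule that[of C])
    fix w :: complex
    show "real ?n * log_plus (norm w) \<le> log_plus (norm (poly P w)) + C"
    proof (cases "b1 \<le> norm w")
      case True
      hence w: "b \<le> norm w" "1 \<le> norm w" by (auto simp: b1_def)
      have w0: "0 < norm w ^ ?n" using w by (intro zero_less_power) linarith
      have "d / 2 * norm w ^ ?n \<le> norm (poly P w)"
        using b[OF w(1)] w0 by (simp add: norm_divide norm_power field_simps)
      hence "norm w ^ ?n \<le> norm (poly P w) * (2 / d)" using d by (simp add: field_simps)
      hence "log_plus (norm w ^ ?n) \<le> log_plus (norm (poly P w) * (2 / d))" by (rule log_plus_mono)
      also have "\<dots> \<le> log_plus (norm (poly P w)) + log_plus (2 / d)" using d by (intro log_plus_mult_le) auto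
      also have "\<dots> \<le> log_plus (norm (poly P w)) + C" by (simp add: C_def)
      finally show ?thesis using pw[OF w(2)] by simp
    next
      case False
      hence "real ?n * log_plus (norm w) \<le> real ?n * log_plus b1" by (intro mult_left_mono log_plus_mono) auto
      also have "\<dots> \<le> log_plus (norm (poly P w)) + C" by (simp add: C_def)
      finally show ?thesis .
    qed
  qed
qed

lemma nevanlinna_T_poly_lower:
  assumes f: "nonconstant_mero f" and P: "P \<noteq> 0"
  obtains C where "\<And>r. 1 \<le> r \<Longrightarrow> continuous_on (sphere 0 r) f \<Longrightarrow>
    real (degree P) * nevanlinna_T r f \<le> nevanlinna_T r (\<lambda>z. poly P (f z)) + C"
proof -
  obtain C where C: "\<And>w. real (degree P) * log_plus (norm w) \<le> log_plus (norm (poly P w)) + C"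
    using log_plus_poly_lower[OF P] by blast
  have f0: "merom_nonzero f" by (rule nonconstant_mero_nonzero[OF f])
  have Pf: "merom_nonzero (\<lambda>z. poly P (f z))" by (rule merom_nonzero_poly[OF f P])
  show thesis
  proof (rule that[of C])
    fix r :: real assume r: "1 \<le> r" and c: "continuous_on (sphere 0 r) f"
    have cP: "continuous_on (sphere 0 r) (\<lambda>z. log_plus (norm (poly P (f z))))"
      by (intro log_plus_continuous continuous_on_norm continuous_on_poly c)
    have "real (degree P) * nevanlinna_m r f \<le> circle_mean r (\<lambda>z. log_plus (norm (poly P (f z))) + C)"
      unfolding nevanlinna_m_circle_mean circle_mean_cmult[symmetric]
      using r C by (intro circle_mean_mono continuous_on_mult continuous_on_const continuous_on_add cP log_plus_continuous continuous_on_norm c) auto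
    also have "\<dots> = nevanlinna_m r (\<lambda>z. poly P (f z)) + C"
      using r circle_mean_add[OF _ cP continuous_on_const, of C] by (simp add: nevanlinna_m_circle_mean)
    finally have m: "real (degree P) * nevanlinna_m r f \<le> nevanlinna_m r (\<lambda>z. poly P (f z)) + C" .
    have "real (degree P) * nevanlinna_N r f = log_count r (\<lambda>a. real (degree P) * pole_mult f a)"
      using r by (simp add: nevanlinna_N_log_count[OF f0] log_count_cmult)
    also have "\<dots> \<le> nevanlinna_N r (\<lambda>z. poly P (f z))"
      using r pole_mult_poly_comp[OF f P] loc_finite_pole_mult[OF Pf] 
      by (auto simp: nevanlinna_N_log_count[OF Pf] intro!: log_count_mono loc_finite_subset[OF loc_finite_pole_mult[OF f0]])
    finally show "real (degree P) * nevanlinna_T r f \<le> nevanlinna_T r (\<lambda>z. poly P (f z)) + C"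
      using m by (simp add: nevanlinna_T_def distrib_left)
  qed
qed

lemma deriv_diff_const_cosparse:
  assumes "H meromorphic_on UNIV"
  shows "\<forall>\<^sub>\<approx>z. deriv (\<lambda>z. H z - c) z = deriv H z"
  using meromorphic_on_imp_analytic_cosparse[OF assms]
proof eventually_elim
  case (elim z)
  hence "H field_differentiable at z" using analytic_on_imp_differentiable_at by blast
  thus ?case by (subst deriv_diff) auto
qed

text \<open>Local form of the counting in the second main theorem, with B = H'/(H - 1). At a pole of
  H, B has a simple pole, so the left side is 1. At a zero of order p, B has order p - 1, and - (p -
  1) + p = 1. At a 1-point, B has a simple pole, so 1 is bounded by the multiplicity. Elsewhere B is
  holomorphic and the left side is at most 0.\<close>

lemma zorder_logderiv_weight:
  assumes H: "nonconstant_mero H" and dH: "merom_nonzero (deriv H)"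
  shows "- real_of_int (zorder (\<lambda>z. deriv H z / (H z - 1)) a) + zero_mult H a
     \<le> of_bool (zorder H a \<noteq> 0) + zero_mult (\<lambda>z. H z - 1) a"
proof -
  have H0: "merom_nonzero H" and H1: "merom_nonzero (\<lambda>z. H z - 1)"
    using H nonconstant_mero_nonzero nonconstant_meroD by auto
  have zd: "zorder (\<lambda>z. deriv H z / (H z - 1)) a = zorder (deriv H) a - zorder (\<lambda>z. H z - 1) a"
    by (rule zorder_mero_divide[OF dH H1])
  have d: "zorder (deriv u) a = zorder u a - 1" if "merom_nonzero u" "zorder u a \<noteq> 0" for u
    using that merom_nonzero_mero[OF that(1)] meromorphic_at_iff merom_nonzero_freq[OF that(1)]
    by (intro zorder_deriv_minus_1) blast+
  have dd: "zorder (deriv (\<lambda>z. H z - 1)) a = zorder (deriv H) a"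
    by (rule zorder_cong)
       (use eventually_cosparse_imp_eventually_at[OF deriv_diff_const_cosparse[OF merom_nonzero_mero[OF H0]], of a] in auto)
  consider "zorder H a < 0" | "zorder H a > 0" | "zorder H a = 0" by linarith
  thus ?thesis
  proof cases
    case 1
    have "zorder (\<lambda>z. H z - 1) a = zorder H a" by (rule zorder_diff_const(1)[OF H 1])
    thus ?thesis using 1 d[OF H0] by (simp add: zd zero_mult_def)
  next
    case 2
    have "zorder (\<lambda>z. H z - 1) a = zorder (\<lambda>_. 1::complex) a"
      by (rule zorder_diff2[OF merom_nonzero_mero[OF H0] merom_nonzero_freq[OF H0]]) (use 2 in auto)
    thus ?thesis using 2 d[OF H0] by (simp add: zd zero_mult_def)
  next
    case 3
    have nn: "0 \<le> zorder (\<lambda>z. H z - 1) a" using zorder_diff_const(2)[OF H, of 1 a] 3 by linarith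
    show ?thesis
    proof (cases "zorder (\<lambda>z. H z - 1) a = 0")
      case True
      have "\<not> is_pole H a" using is_pole_iff_zorder[OF H0] 3 by simp
      hence "\<not> is_pole (deriv H) a" using is_pole_deriv_iff[OF merom_nonzero_mero[OF H0]] by simp
      hence "0 \<le> zorder (deriv H) a" using is_pole_iff_zorder[OF dH] by (simp add: not_less)
      thus ?thesis using 3 True by (simp add: zd zero_mult_def)
    next
      case False
      hence "zorder (deriv H) a = zorder (\<lambda>z. H z - 1) a - 1" using d[OF H1] dd by simp
      thus ?thesis using 3 False nn by (simp add: zd zero_mult_def)
    qed
  qed
qed

text \<open>With \<open>A = H'/H\<close> and \<open>B = H'/(H - 1)\<close> one has \<open>1/H = (B - A)/B\<close>.\<close>

theorem second_main_theorem:
  assumes H: "nonconstant_mero H" and dH: "merom_nonzero (deriv H)"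
  obtains C where "\<And>r. \<lbrakk>1 \<le> r; good_radius H r; good_radius (\<lambda>z. H z - 1) r; good_radius (deriv H) r\<rbrakk> \<Longrightarrow>
    nevanlinna_T r H \<le> log_count r (\<lambda>a. of_bool (zorder H a \<noteq> 0) + zero_mult (\<lambda>z. H z - 1) a)
      + nevanlinna_m r (\<lambda>z. deriv H z / H z) + 2 * nevanlinna_m r (\<lambda>z. deriv H z / (H z - 1)) + C"
proof -
  have H0: "merom_nonzero H" and H1: "merom_nonzero (\<lambda>z. H z - 1)"
    using H nonconstant_mero_nonzero nonconstant_meroD by auto
  define A where "A = (\<lambda>z. deriv H z / H z)"
  define B where "B = (\<lambda>z. deriv H z / (H z - 1))"
  have B: "merom_nonzero B" unfolding B_def by (intro merom_nonzero_divide dH H1)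
  obtain c1 where c1: "\<And>r. 0 < r \<Longrightarrow> good_radius H r \<Longrightarrow> nevanlinna_T r H = nevanlinna_T r (\<lambda>z. inverse (H z)) + c1"
    using first_main_theorem[OF H0] by blast
  obtain c2 where c2: "\<And>r. 0 < r \<Longrightarrow> good_radius B r \<Longrightarrow> nevanlinna_T r B = nevanlinna_T r (\<lambda>z. inverse (B z)) + c2"
    using first_main_theorem[OF B] by blast
  show thesis
  proof (rule that[of "c1 - c2 + ln 2"])
    fix r :: real assume r: "1 \<le> r" and good: "good_radius H r" "good_radius (\<lambda>z. H z - 1) r" "good_radius (deriv H) r"
    have r0: "0 < r" using r by simp
    have gB: "good_radius B r" using good unfolding B_def good_radius_def by (auto intro: regular_at_divide)
    have gA: "good_radius A r" using good unfolding A_def good_radius_def by (auto intro: regular_at_divide)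
    have cA: "continuous_on (sphere 0 r) A" and cB: "continuous_on (sphere 0 r) B"
      and ciB: "continuous_on (sphere 0 r) (\<lambda>z. inverse (B z))"
      using gA gB good_radius_inverse good_radius_continuous by blast+
    have "nevanlinna_m r (\<lambda>z. inverse (H z)) = nevanlinna_m r (\<lambda>z. (B z + - A z) * inverse (B z))"
      unfolding nevanlinna_m_circle_mean
    proof (rule circle_mean_cong)
      fix z :: complex assume z: "norm z = r"
      have "H z \<noteq> 0" "H z - 1 \<noteq> 0" "deriv H z \<noteq> 0" using z good by (auto dest: good_radius_nonzero)
      hence "inverse (H z) = (B z + - A z) * inverse (B z)"
        by (simp add: A_def B_def field_simps)
      thus "log_plus (norm (inverse (H z))) = log_plus (norm ((B z + - A z) * inverse (B z)))" by simp
    qed (use r in simp)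
    also have "\<dots> \<le> nevanlinna_m r (\<lambda>z. B z + - A z) + nevanlinna_m r (\<lambda>z. inverse (B z))"
      by (intro nevanlinna_m_mult_le continuous_on_add continuous_on_minus cA cB ciB) (use r in simp)
    also have "nevanlinna_m r (\<lambda>z. B z + - A z) \<le> nevanlinna_m r B + nevanlinna_m r A + ln 2"
      using nevanlinna_m_sum_le[of r "{True, False}" "\<lambda>b. if b then B else (\<lambda>z. - A z)"] r cA cB
      by (simp add: continuous_on_minus nevanlinna_m_def)
    finally have 1: "nevanlinna_m r (\<lambda>z. inverse (H z)) \<le> nevanlinna_m r B + nevanlinna_m r A + ln 2 + nevanlinna_m r (\<lambda>z. inverse (B z))"
      by simp
    \<comment> \<open>The first main theorem trades m(r, 1/B) for m(r, B) + N(r, B) - N(r, 1/B), up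
      to a constant. Hence m(r, B) occurs twice in the conclusion, and exactly this combination of
      counting functions remains to be bounded.\<close>
    have "nevanlinna_N r B - nevanlinna_N r (\<lambda>z. inverse (B z)) + nevanlinna_N r (\<lambda>z. inverse (H z)) =
        log_count r (\<lambda>a. (pole_mult B a - zero_mult B a) + zero_mult H a)"
      using r0 by (simp add: nevanlinna_N_log_count[OF B] nevanlinna_N_inverse B H0 log_count_diff log_count_add
        loc_finite_pole_mult loc_finite_zero_mult loc_finite_diff)
    also have "(\<lambda>a. (pole_mult B a - zero_mult B a) + zero_mult H a) = (\<lambda>a. - real_of_int (zorder B a) + zero_mult H a)"
      by (simp add: zorder_eq_mults)
    also have "log_count r \<dots> \<le> log_count r (\<lambda>a. of_bool (zorder H a \<noteq> 0) + zero_mult (\<lambda>z. H z - 1) a)"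
    proof (rule log_count_mono[OF r])
      show "loc_finite (\<lambda>a. of_bool (zorder H a \<noteq> 0) + zero_mult (\<lambda>z. H z - 1) a)"
        by (intro loc_finite_add loc_finite_zero_mult H1 loc_finite_subset[OF loc_finite_zorder[OF H0]]) auto
      show "loc_finite (\<lambda>a. - real_of_int (zorder B a) + zero_mult H a)"
        by (intro loc_finite_add loc_finite_zero_mult H0 loc_finite_uminus loc_finite_zorder B)
    qed (use zorder_logderiv_weight[OF H dH] in \<open>simp add: B_def\<close>)
    finally have 2: "nevanlinna_N r B - nevanlinna_N r (\<lambda>z. inverse (B z)) + nevanlinna_N r (\<lambda>z. inverse (H z)) \<le>
      log_count r (\<lambda>a. of_bool (zorder H a \<noteq> 0) + zero_mult (\<lambda>z. H z - 1) a)" .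
    show "nevanlinna_T r H \<le> log_count r (\<lambda>a. of_bool (zorder H a \<noteq> 0) + zero_mult (\<lambda>z. H z - 1) a)
      + nevanlinna_m r (\<lambda>z. deriv H z / H z) + 2 * nevanlinna_m r (\<lambda>z. deriv H z / (H z - 1)) + (c1 - c2 + ln 2)"
      using 1 2 c1[OF r0 good(1)] c2[OF r0 gB] unfolding A_def[symmetric] B_def[symmetric] nevanlinna_T_def by linarith
  qed
qed

text \<open>Finitely many fixed zeros contribute O(1 + ln r), which will be negligible because f is
  transcendental.\<close>

lemma zero_mult_cofinite_log_bound:
  assumes G: "merom_nonzero G" and fin: "finite {z. isolated_zero G z}"
  obtains K where "0 \<le> K" "\<And>r. 1 \<le> r \<Longrightarrow> nevanlinna_N r (\<lambda>z. inverse (G z)) \<le> K * (1 + ln r)"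
proof -
  define Z where "Z = {z. isolated_zero G z}"
  have Z: "Z = {z. zero_mult G z \<noteq> 0}" by (auto simp: Z_def isolated_zero_iff_zorder[OF G] zero_mult_def)
  define K1 where "K1 = (\<Sum>a\<in>Z. zero_mult G a * (1 + \<bar>ln (norm a)\<bar>))"
  have K1: "0 \<le> K1" unfolding K1_def by (intro sum_nonneg mult_nonneg_nonneg) (auto simp: zero_mult_def)
  show thesis
  proof (rule that[OF K1])
    fix r :: real assume r: "1 \<le> r"
    have lr: "0 \<le> ln r" using r by simp
    have "nevanlinna_N r (\<lambda>z. inverse (G z)) = (\<Sum>a | norm a \<le> r \<and> zero_mult G a \<noteq> 0. zero_mult G a * (ln r - ln (norm a)))"
      using r by (simp add: nevanlinna_N_inverse[OF G] log_count_def)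
    also have "\<dots> \<le> (\<Sum>a | norm a \<le> r \<and> zero_mult G a \<noteq> 0. zero_mult G a * (1 + \<bar>ln (norm a)\<bar>) * (1 + ln r))"
    proof (rule sum_mono)
      fix a :: complex
      have "ln r - ln (norm a) \<le> ln r + \<bar>ln (norm a)\<bar>" by linarith
      also have "\<dots> \<le> (1 + \<bar>ln (norm a)\<bar>) * (1 + ln r)" using lr by (simp add: algebra_simps)
      finally show "zero_mult G a * (ln r - ln (norm a)) \<le> zero_mult G a * (1 + \<bar>ln (norm a)\<bar>) * (1 + ln r)"
        unfolding mult.assoc by (rule mult_left_mono) (simp add: zero_mult_def)
    qed
    also have "\<dots> \<le> (\<Sum>a\<in>Z. zero_mult G a * (1 + \<bar>ln (norm a)\<bar>) * (1 + ln r))"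
      using fin lr by (intro sum_mono2 mult_nonneg_nonneg) (auto simp: Z Z_def[symmetric] zero_mult_def)
    also have "\<dots> = K1 * (1 + ln r)" by (simp add: K1_def sum_distrib_right)
    finally show "nevanlinna_N r (\<lambda>z. inverse (G z)) \<le> K1 * (1 + ln r)" .
  qed
qed

section \<open>Growth and windows of slow growth\<close>

text \<open>The first main theorem with a single constant, so that every quantity in the
  factorization estimates is visibly O(T(r, u) + 1).\<close>

lemma nevanlinna_T_controls:
  assumes u: "merom_nonzero u"
  obtains c where "0 \<le> c"
    "\<And>r. 1 \<le> r \<Longrightarrow> good_radius u r \<Longrightarrow> proximity_sum r u \<le> 2 * nevanlinna_T r u + c"
    "\<And>r. 1 \<le> r \<Longrightarrow> good_radius u r \<Longrightarrow> nevanlinna_N r u + nevanlinna_N r (\<lambda>z. inverse (u z)) \<le> 2 * nevanlinna_T r u + c"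
    "\<And>r. 1 \<le> r \<Longrightarrow> good_radius u r \<Longrightarrow> nevanlinna_T r (\<lambda>z. inverse (u z)) \<le> nevanlinna_T r u + c"
    "\<And>r. 1 \<le> r \<Longrightarrow> good_radius u r \<Longrightarrow> nevanlinna_T r u \<le> nevanlinna_T r (\<lambda>z. inverse (u z)) + c"
proof -
  obtain c where c: "\<And>r. 0 < r \<Longrightarrow> good_radius u r \<Longrightarrow> nevanlinna_T r u = nevanlinna_T r (\<lambda>z. inverse (u z)) + c"
    using first_main_theorem[OF u] by blast
  have iu: "merom_nonzero (\<lambda>z. inverse (u z))" by (rule merom_nonzero_inverse[OF u])
  show thesis
  proof (rule that[of "\<bar>c\<bar>"])
    fix r :: real assume r: "1 \<le> r" "good_radius u r"
    note T = nevanlinna_T_nonneg[OF u r] nevanlinna_T_nonneg[OF iu r(1) good_radius_inverse[OF r(2)]]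
    have c': "nevanlinna_T r u = nevanlinna_T r (\<lambda>z. inverse (u z)) + c" using c r by simp
    show "nevanlinna_T r (\<lambda>z. inverse (u z)) \<le> nevanlinna_T r u + \<bar>c\<bar>"
      "nevanlinna_T r u \<le> nevanlinna_T r (\<lambda>z. inverse (u z)) + \<bar>c\<bar>"
      using c' by linarith+
    show "nevanlinna_N r u + nevanlinna_N r (\<lambda>z. inverse (u z)) \<le> 2 * nevanlinna_T r u + \<bar>c\<bar>"
      using c' T by linarith
    have "proximity_sum r u = nevanlinna_m r u + nevanlinna_m r (\<lambda>z. inverse (u z))"
      unfolding proximity_sum_def by (rule circle_mean_abs_ln_eq) (use r in auto)
    thus "proximity_sum r u \<le> 2 * nevanlinna_T r u + \<bar>c\<bar>" using c' T by linarith
  qed simp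
qed

lemma transcendental_imp_nonconstant:
  assumes "transcendental_meromorphic f"
  shows "nonconstant_mero f"
  unfolding nonconstant_mero_def merom_nonzero_def nonzero_function_def
proof (intro allI conjI notI)
  fix c
  show "(\<lambda>z. f z - c) meromorphic_on UNIV"
    using assms unfolding transcendental_meromorphic_def by (intro meromorphic_intros) auto
  assume "\<forall>\<^sub>\<approx>z. f z - c = 0"
  hence "\<forall>\<^sub>\<approx>z. f z = poly [:c:] z / poly 1 z" by simp
  thus False using assms unfolding transcendental_meromorphic_def by (metis one_neq_zero)
qed

lemma rational_of_constant_quotient:
  assumes f: "merom_nonzero f" and S: "finite S" "\<And>a. zorder f a \<noteq> 0 \<longleftrightarrow> a \<in> S"
    and eq: "\<And>z w. regular_at f z \<Longrightarrow> regular_at f w \<Longrightarrow>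
        f z / (\<Prod>a\<in>S. (z - a) powi zorder f a) = f w / (\<Prod>a\<in>S. (w - a) powi zorder f a)"
  shows "\<exists>p q :: complex poly. q \<noteq> 0 \<and> (\<forall>\<^sub>\<approx>z. f z = poly p z / poly q z)"
proof -
  have "\<exists>w. regular_at f w"
  proof (rule ccontr)
    assume "\<not> ?thesis"
    with merom_nonzero_regular[OF f] show False by simp
  qed
  then obtain w where w: "regular_at f w" by blast
  define C where "C = f w / (\<Prod>a\<in>S. (w - a) powi zorder f a)"
  define p where "p = smult C (\<Prod>a\<in>S. [:-a, 1:] ^ nat (zorder f a))"
  define q where "q = (\<Prod>a\<in>S. [:-a, 1:] ^ nat (- zorder f a))"
  have "f z = poly p z / poly q z" if z: "regular_at f z" for z
  proof -
    have zS: "z \<notin> S" using S(2) regular_at_zorder[OF z] by auto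
    have "(z - a) powi k = (z - a) ^ nat k / (z - a) ^ nat (- k)" for a k
      by (auto simp: power_int_def inverse_eq_divide power_one_over)
    hence "(\<Prod>a\<in>S. (z - a) powi zorder f a) = (\<Prod>a\<in>S. (z - a) ^ nat (zorder f a)) / (\<Prod>a\<in>S. (z - a) ^ nat (- zorder f a))"
      by (simp add: prod_dividef)
    moreover have "(\<Prod>a\<in>S. (z - a) powi zorder f a) \<noteq> 0" using S(1) zS by auto
    moreover have "f z = C * (\<Prod>a\<in>S. (z - a) powi zorder f a)"
      using eq[OF z w] calculation(2) unfolding C_def[symmetric] by (simp add: divide_eq_eq)
    ultimately show ?thesis by (simp add: p_def q_def poly_prod)
  qed
  hence "\<forall>\<^sub>\<approx>z. f z = poly p z / poly q z"
    using merom_nonzero_regular[OF f] by (auto elim!: eventually_mono)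
  moreover have "q \<noteq> 0" using S(1) by (simp add: q_def)
  ultimately show ?thesis by blast
qed

text \<open>If T(r, f) < K ln r on arbitrarily large good circles, Jensen's formula bounds the
  number of zeros and poles, so there are finitely many. The exponent h in the factorization then
  has derivative O(ln R / R) on larger and larger discs, so f divided by the product over its zeros
  and poles is constant and f is rational.\<close>

theorem transcendental_growth:
  assumes f: "transcendental_meromorphic f"
  shows "\<exists>r0. \<forall>r\<ge>r0. good_radius f r \<longrightarrow> K * ln r \<le> nevanlinna_T r f"
proof (rule ccontr)
  assume "\<not> ?thesis"
  hence ex: "\<exists>r\<ge>r0. good_radius f r \<and> nevanlinna_T r f < K * ln r" for r0 by (auto simp: not_le)
  have f0: "merom_nonzero f" by (rule nonconstant_mero_nonzero[OF transcendental_imp_nonconstant[OF f]])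
  obtain c where c: "0 \<le> c"
    "\<And>r. 1 \<le> r \<Longrightarrow> good_radius f r \<Longrightarrow> proximity_sum r f \<le> 2 * nevanlinna_T r f + c"
    "\<And>r. 1 \<le> r \<Longrightarrow> good_radius f r \<Longrightarrow> nevanlinna_N r f + nevanlinna_N r (\<lambda>z. inverse (f z)) \<le> 2 * nevanlinna_T r f + c"
    using nevanlinna_T_controls[OF f0] by metis
  define M where "M = 4 * \<bar>K\<bar> + 2 * c"
  have bound: "divisor_count f t \<le> M" if t: "1 \<le> t" for t
  proof -
    \<comment> \<open>r >= t^2 makes ln (r/t) at least half of ln r, so the factor ln r cancels from
      the bound; r >= e makes ln r at least 1, so that it absorbs the constant c.\<close>
    obtain r where r: "max (t\<^sup>2) (exp 1) + t \<le> r" "good_radius f r" "nevanlinna_T r f < K * ln r" using ex by blast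
    have r1: "t < r" "1 \<le> r" "t\<^sup>2 \<le> r" "exp 1 \<le> r" using r(1) t by (auto simp: max_def split: if_splits) (smt (verit) exp_gt_zero one_le_power)+
    have lr: "1 \<le> ln r" using r1 by (subst ln_ge_iff) auto
    have "ln (t\<^sup>2) \<le> ln r" using r1 t by (subst ln_le_cancel_iff) auto
    hence "ln r / 2 \<le> ln (r / t)" using t r1 by (simp add: ln_div ln_realpow)
    hence "divisor_count f t * (ln r / 2) \<le> divisor_count f t * ln (r / t)"
      by (intro mult_left_mono divisor_count_nonneg)
    also have "\<dots> \<le> nevanlinna_N r f + nevanlinna_N r (\<lambda>z. inverse (f z))"
      by (rule divisor_count_bound[OF f0 t r1(1)])
    also have "\<dots> \<le> 2 * (K * ln r) + c" using c(3)[OF r1(2) r(2)] r(3) by linarith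
    also have "\<dots> \<le> 2 * (\<bar>K\<bar> * ln r) + c * ln r"
      using lr c(1) mult_left_mono[OF lr c(1)] by (intro add_mono mult_left_mono mult_right_mono) auto
    also have "\<dots> = M * (ln r / 2)" by (simp add: M_def algebra_simps)
    finally show ?thesis using lr by simp
  qed
  define S where "S = {a. zorder f a \<noteq> 0}"
  have finS: "finite S"
  proof (rule ccontr)
    assume "infinite S"
    then obtain A where A: "A \<subseteq> S" "finite A" "card A = nat \<lceil>M\<rceil> + 1"
      using infinite_arbitrarily_large by blast
    obtain b where b: "\<And>a. a \<in> A \<Longrightarrow> norm a \<le> b" using A(2) by (meson finite_imp_bounded bounded_iff)
    define t where "t = max 1 (b + 1)"
    have "real (card A) = (\<Sum>a\<in>A. 1)" by simp
    also have "\<dots> \<le> (\<Sum>a\<in>A. real_of_int \<bar>zorder f a\<bar>)"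
      using A(1) by (intro sum_mono) (auto simp: S_def)
    also have "\<dots> \<le> divisor_count f t" unfolding divisor_count_def
    proof (intro sum_mono2 finite_divisor f0)
      show "A \<subseteq> {a. a \<in> ball 0 t \<and> zorder f a \<noteq> 0}" using A(1) b by (force simp: S_def t_def)
    qed auto
    also have "\<dots> \<le> M" by (rule bound) (simp add: t_def)
    finally show False using A(3) by linarith
  qed
  obtain b where b: "\<And>a. a \<in> S \<Longrightarrow> norm a < b" using finS by (meson finite_imp_bounded bounded_pos_less)
  have "f z / (\<Prod>a\<in>S. (z - a) powi zorder f a) = f w / (\<Prod>a\<in>S. (w - a) powi zorder f a)"
    if zw: "regular_at f z" "regular_at f w" for z w
  proof -
    define P where "P z = (\<Prod>a\<in>S. (z - a) powi zorder f a)" for z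
    have P: "P z \<noteq> 0" if "regular_at f z" for z using that regular_at_zorder[OF that] finS by (auto simp: P_def S_def)
    define A B where "A = f z / P z" and "B = f w / P w"
    define x where "x = A / B"
    \<comment> \<open>The function h depends on R, so its values at z and w cannot be equated for
      one fixed h. Instead x, which does not depend on R, is the exponential of arbitrarily small
      numbers and must be 1.\<close>
    have ev: "\<exists>d. norm d < e \<and> exp d = x" if e: "0 < e" for e
    proof -
      have "((\<lambda>R. 8 / R * (2 * (K * ln R) + c + 3 * M) * norm (z - w)) \<longlongrightarrow> 0) at_top"
        by real_asymp
      hence "eventually (\<lambda>R. 8 / R * (2 * (K * ln R) + c + 3 * M) * norm (z - w) < e) at_top"
        using e by (rule order_tendstoD)
      then obtain R1 where R1: "\<And>R. R1 \<le> R \<Longrightarrow> 8 / R * (2 * (K * ln R) + c + 3 * M) * norm (z - w) < e"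
        by (auto simp: eventually_at_top_linorder)
      obtain R where R: "max R1 (1 + \<bar>b\<bar> + 2 * norm z + 2 * norm w) \<le> R" "good_radius f R" "nevanlinna_T R f < K * ln R"
        using ex by blast
      have R0: "0 < R" "1 \<le> R" "b < 2 * R" "norm z \<le> R / 2" "norm w \<le> R / 2" using R(1)
        by (simp_all add: max_def split: if_splits) (smt (verit) norm_ge_zero)+
      have Seq: "{a. a \<in> ball 0 (2 * R) \<and> zorder f a \<noteq> 0} = S"
        using b R0 by (force simp: S_def)
      obtain h where h: "h holomorphic_on ball 0 (2 * R)"
        "\<And>z. norm z < 2 * R \<Longrightarrow> regular_at f z \<Longrightarrow> f z = exp (h z) * (\<Prod>a\<in>S. (z - a) powi zorder f a)"
        "\<And>z. norm z < 2 * R \<Longrightarrow> regular_at f z \<Longrightarrow>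
           ln (norm (f z)) = Re (h z) + (\<Sum>a\<in>S. of_int (zorder f a) * ln (norm (z - a)))"
        "\<And>z. norm z \<le> R / 2 \<Longrightarrow> norm (deriv h z) \<le> 8 / R * (proximity_sum R f + 3 * divisor_count f (2 * R))"
        by (rule master_factorization[OF f0 R0(1) R(2), unfolded Seq]) (rule that)
      have "norm (h z - h w) \<le> 8 / R * (proximity_sum R f + 3 * divisor_count f (2 * R)) * norm (z - w)"
        by (rule master_difference[OF h(1) R0(1) h(4) R0(4,5)])
      also have "\<dots> \<le> 8 / R * (2 * (K * ln R) + c + 3 * M) * norm (z - w)"
        using c(2)[OF R0(2) R(2)] R(3) bound[of "2 * R"] R0
        by (intro mult_right_mono mult_left_mono add_mono) auto
      also have "\<dots> < e" using R1 R(1) by simp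
      finally have "norm (h z - h w) < e" .
      moreover have "exp (h z - h w) = x"
        using h(2)[OF _ zw(1)] h(2)[OF _ zw(2)] R0 P[OF zw(1)] P[OF zw(2)]
        by (simp add: x_def A_def B_def exp_diff P_def)
      ultimately show ?thesis by blast
    qed
    have "x = 1"
    proof -
      have "\<exists>d. norm d < 1 / (1 + real n) \<and> exp d = x" for n by (rule ev) simp
      then obtain d where d: "\<And>n. norm (d n) < 1 / (1 + real n)" "\<And>n. exp (d n) = x" by metis
      have "(\<lambda>n. 1 / (1 + real n)) \<longlonglongrightarrow> 0" by real_asymp
      hence "d \<longlonglongrightarrow> 0" by (rule Lim_null_comparison[rotated]) (auto intro!: always_eventually less_imp_le d)
      hence "(\<lambda>n. exp (d n)) \<longlonglongrightarrow> exp 0" by (intro tendsto_exp)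
      thus "x = 1" unfolding d by (simp add: LIMSEQ_const_iff)
    qed
    moreover have "B \<noteq> 0" using P zw by (auto simp: B_def regular_at_def)
    ultimately have "A = B" unfolding x_def by simp
    thus ?thesis unfolding A_def B_def P_def .
  qed
  hence "\<exists>p q :: complex poly. q \<noteq> 0 \<and> (\<forall>\<^sub>\<approx>z. f z = poly p z / poly q z)"
  proof (rule rational_of_constant_quotient[OF f0 finS, rotated])
    show "zorder f a \<noteq> 0 \<longleftrightarrow> a \<in> S" for a by (simp add: S_def)
  qed
  thus False using f by (auto simp: transcendental_meromorphic_def)
qed

text \<open>If no j works, every index has another at most 4 steps later with more than twice its
  value. Along such a chain a grows at least like 2^(j/4), which outruns q^j since q^4 < 2.\<close>

lemma doubling_window:
  fixes a :: "nat \<Rightarrow> real"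
  assumes bound: "\<And>j. J \<le> j \<Longrightarrow> a j \<le> M * q ^ j" and q: "1 \<le> q" "q ^ 4 < 2" and pos: "0 < a J"
  shows "\<exists>j\<ge>J. \<forall>s\<le>4. a (j + s) \<le> 2 * a j"
proof (rule ccontr)
  assume "\<not> ?thesis"
  hence step: "\<exists>s\<le>4. 2 * a j < a (j + s)" if "J \<le> j" for j using that by (meson not_le)
  have chain: "\<exists>j\<ge>J. j \<le> J + 4 * i \<and> 2 ^ i * a J \<le> a j" for i
  proof (induction i)
    case (Suc i)
    then obtain j where j: "J \<le> j" "j \<le> J + 4 * i" "2 ^ i * a J \<le> a j" by blast
    obtain s where s: "s \<le> 4" "2 * a j < a (j + s)" using step[OF j(1)] by blast
    show ?case using j s by (intro exI[of _ "j + s"]) auto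
  qed auto
  have M0: "0 \<le> M"
  proof (rule ccontr)
    assume "\<not> 0 \<le> M"
    hence "M * q ^ J \<le> 0" using q by (intro mult_nonpos_nonneg) auto
    thus False using bound[of J] pos by simp
  qed
  have le: "2 ^ i * a J \<le> M * q ^ J * (q ^ 4) ^ i" for i
  proof -
    obtain j where j: "J \<le> j" "j \<le> J + 4 * i" "2 ^ i * a J \<le> a j" using chain by blast
    have "a j \<le> M * q ^ j" by (rule bound[OF j(1)])
    also have "\<dots> \<le> M * q ^ (J + 4 * i)" using j q M0 by (intro mult_left_mono power_increasing)
    finally show ?thesis using j(3) by (simp add: power_add power_mult)
  qed
  have "1 < 2 / q ^ 4" using q by (simp add: field_simps) 
  then obtain i where i: "M * q ^ J / a J < (2 / q ^ 4) ^ i" using real_arch_pow by blast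
  hence "M * q ^ J * (q ^ 4) ^ i < 2 ^ i * a J"
    using pos q by (simp add: power_divide field_simps)
  thus False using le[of i] by simp
qed

text \<open>The interval from a to 2 a has measure a, too much to be covered by E and a null
  set.\<close>

lemma avoiding_radius:
  assumes E: "E \<in> lmeasurable" and D: "countable D" and a: "measure lebesgue E < a"
  shows "\<exists>x. a \<le> x \<and> x \<le> 2 * a \<and> x \<notin> E \<and> x \<notin> (D :: real set)"
proof (rule ccontr)
  assume "\<not> ?thesis"
  hence sub: "{a..2 * a} \<subseteq> E \<union> D" by auto
  have a0: "0 < a" using a measure_nonneg[of lebesgue E] by linarith
  have neg: "negligible D" using countable_imp_null_set_lborel[OF D] null_sets_completionI negligible_iff_null_sets by blast
  hence D': "D \<in> lmeasurable" "measure lebesgue D = 0" by (auto simp: negligible_iff_measure)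
  have "measure lebesgue {a..2 * a} \<le> measure lebesgue (E \<union> D)"
    using sub E D' by (intro measure_mono_fmeasurable) auto
  also have "\<dots> \<le> measure lebesgue E + measure lebesgue D"
    using E D' by (intro measure_Un_le) (auto simp: fmeasurableD)
  finally show False using a a0 D' by simp
qed

lemma zero_order_bound:
  assumes "zero_order f" "0 < e"
  shows "eventually (\<lambda>r. nevanlinna_T r f \<le> r powr e) at_top"
proof -
  have "Limsup at_top (\<lambda>r. ereal (log_plus (nevanlinna_T r f) / ln r)) < ereal e"
    using assms by (simp add: zero_order_def)
  hence "eventually (\<lambda>r. ereal (log_plus (nevanlinna_T r f) / ln r) < ereal e) at_top"
    by (rule Limsup_lessD)
  moreover have "eventually (\<lambda>r::real. 1 < r) at_top" by (rule eventually_gt_at_top)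
  ultimately show ?thesis
  proof eventually_elim
    case (elim r)
    have lr: "0 < ln r" using elim by simp
    have l: "log_plus (nevanlinna_T r f) < e * ln r" using elim lr by (simp add: field_simps)
    show ?case
    proof (cases "nevanlinna_T r f \<le> 1")
      case True
      thus ?thesis using elim assms ge_one_powr_ge_zero[of r e] by linarith
    next
      case False
      hence "ln (nevanlinna_T r f) < e * ln r" using l by (simp add: log_plus_def)
      hence "nevanlinna_T r f < exp (e * ln r)" using False by (metis exp_less_mono exp_ln not_le order_trans zero_less_one less_trans not_less)
      thus ?thesis using elim by (simp add: powr_def)
    qed
  qed
qed

text \<open>The windows are indexed by \<open>i\<close>; \<open>\<rho> 0 i, \<dots>, \<rho> 4 i\<close> are the radii inside one window.\<close>

definition peak_radii :: "(complex \<Rightarrow> complex) \<Rightarrow> (nat \<Rightarrow> nat \<Rightarrow> real) \<Rightarrow> bool" where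
  "peak_radii f \<rho> \<longleftrightarrow> (\<forall>s\<le>4. \<forall>i. 1 \<le> \<rho> s i) \<and> (\<forall>s\<le>4. filterlim (\<rho> s) at_top sequentially) \<and>
    (\<forall>s<4. filterlim (\<lambda>i. \<rho> (Suc s) i / \<rho> s i) at_top sequentially) \<and>
    (\<forall>s\<le>4. \<forall>i. nevanlinna_T (\<rho> s i) f \<le> 2 * nevanlinna_T (\<rho> 0 i) f)"

text \<open>One radius is taken from each interval [C^j, 2 C^j], outside E and D. The freedom of a
  factor 2 reduces the ratio of neighbours from C to C/2. As T(r) <= r^e for a small e, the
  characteristic at these radii is O(q^j) with q = C^e, and \<open>doubling_window\<close> yields a
  suitable starting index.\<close>

lemma peak_window:
  assumes zo: "zero_order f" and E: "E \<in> lmeasurable" and D: "countable D"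
    and pos: "\<And>r. r1 \<le> r \<Longrightarrow> r \<notin> D \<Longrightarrow> 0 < nevanlinna_T r f" and C: "2 \<le> C"
  shows "\<exists>p. \<forall>s\<le>4. L \<le> p s \<and> p s \<notin> E \<and> p s \<notin> D \<and> C / 2 * p s \<le> p (Suc s) \<and>
    nevanlinna_T (p s) f \<le> 2 * nevanlinna_T (p 0) f"
proof -
  \<comment> \<open>Chosen so that C^e = 2^(1/8); then q^4 is the square root of 2, below the 2
    required for doubling.\<close>
  define e where "e = ln 2 / (8 * ln C)"
  have lC: "0 < ln C" using C by simp
  have e: "0 < e" unfolding e_def using lC by simp
  obtain r2 where r2: "\<And>r. r2 \<le> r \<Longrightarrow> nevanlinna_T r f \<le> r powr e"
    using zero_order_bound[OF zo e] by (auto simp: eventually_at_top_linorder)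
  define B where "B = Max {r1, r2, L, measure lebesgue E + 1, 1}"
  obtain J where J: "B < C ^ J" using real_arch_pow[of C B] C by auto
  have CJ: "B < C ^ j" if "J \<le> j" for j using J power_increasing[OF that, of C] C by linarith
  have Bge: "r1 \<le> B" "r2 \<le> B" "L \<le> B" "measure lebesgue E + 1 \<le> B" "1 \<le> B" unfolding B_def by (auto simp: le_max_iff_disj)
  have "\<exists>x. C ^ j \<le> x \<and> x \<le> 2 * C ^ j \<and> x \<notin> E \<and> x \<notin> D" if "J \<le> j" for j
    by (rule avoiding_radius[OF E D]) (use CJ[OF that] Bge in linarith)
  then obtain p where p: "\<And>j. J \<le> j \<Longrightarrow> C ^ j \<le> p j \<and> p j \<le> 2 * C ^ j \<and> p j \<notin> E \<and> p j \<notin> D" by metis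
  define q where "q = C powr e"
  have q1: "1 \<le> q" unfolding q_def using C e by (intro ge_one_powr_ge_zero) auto
  have "q = exp (ln 2 / 8)" using C lC by (simp add: q_def powr_def e_def)
  hence "q ^ 4 = exp (ln 2 / 2)" by (simp add: exp_of_nat_mult[symmetric])
  also have "\<dots> < exp (ln 2)" by (simp only: exp_less_cancel_iff) simp
  finally have q4: "q ^ 4 < 2" by simp
  have "\<exists>j\<ge>J. \<forall>s\<le>4. nevanlinna_T (p (j + s)) f \<le> 2 * nevanlinna_T (p j) f"
  proof (rule doubling_window[OF _ q1 q4])
    fix j assume j: "J \<le> j"
    have pj: "0 < p j" "r2 \<le> p j" using p[OF j] CJ[OF j] Bge by linarith+
    have "nevanlinna_T (p j) f \<le> p j powr e" by (rule r2[OF pj(2)])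
    also have "\<dots> \<le> (2 * C ^ j) powr e" using p[OF j] pj e by (intro powr_mono2) auto
    also have "\<dots> = 2 powr e * q ^ j"
      using C by (simp add: powr_mult q_def powr_realpow[symmetric] powr_powr mult.commute)
    finally show "nevanlinna_T (p j) f \<le> 2 powr e * q ^ j" .
  next
    show "0 < nevanlinna_T (p J) f" by (rule pos) (use p[of J] CJ[of J] Bge in auto)
  qed
  then obtain j where j: "J \<le> j" "\<And>s. s \<le> 4 \<Longrightarrow> nevanlinna_T (p (j + s)) f \<le> 2 * nevanlinna_T (p j) f" by blast
  show ?thesis
  proof (intro exI[of _ "\<lambda>s. p (j + s)"] allI impI conjI)
    fix s :: nat assume s: "s \<le> 4"
    have js: "J \<le> j + s" "J \<le> j + Suc s" using j by auto
    show "L \<le> p (j + s)" using p[OF js(1)] CJ[OF js(1)] Bge by linarith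
    show "p (j + s) \<notin> E" "p (j + s) \<notin> D" using p[OF js(1)] by auto
    have "C / 2 * p (j + s) \<le> C / 2 * (2 * C ^ (j + s))" using p[OF js(1)] C by (intro mult_left_mono) auto
    also have "\<dots> \<le> p (j + Suc s)" using p[OF js(2)] by simp
    finally show "C / 2 * p (j + s) \<le> p (j + Suc s)" .
    show "nevanlinna_T (p (j + s)) f \<le> 2 * nevanlinna_T (p (j + 0)) f" using j(2)[OF s] by simp
  qed
qed

lemma peak_radii_exist:
  assumes zo: "zero_order f" and E: "E \<in> lmeasurable" and D: "countable D"
    and pos: "\<And>r. r1 \<le> r \<Longrightarrow> r \<notin> D \<Longrightarrow> 0 < nevanlinna_T r f"
  obtains \<rho> where "peak_radii f \<rho>" "\<And>s i. s \<le> 4 \<Longrightarrow> \<rho> s i \<notin> E" "\<And>s i. s \<le> 4 \<Longrightarrow> \<rho> s i \<notin> D"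
proof -
  \<comment> \<open>The i-th window uses the lower bound i + 1 and C = i + 2, so radii and ratios
    both tend to infinity with i.\<close>
  define Q where "Q i p \<longleftrightarrow> (\<forall>s\<le>4. real i + 1 \<le> p s \<and> p s \<notin> E \<and> p s \<notin> D \<and> (real i + 2) / 2 * p s \<le> p (Suc s) \<and>
    nevanlinna_T (p s) f \<le> 2 * nevanlinna_T (p 0) f)" for i :: nat and p :: "nat \<Rightarrow> real"
  have "\<exists>p. Q i p" for i
    unfolding Q_def
  proof (rule peak_window[OF zo E D])
    show "0 < nevanlinna_T r f" if "r1 \<le> r" "r \<notin> D" for r using that by (rule pos)
  qed simp
  then obtain p where "\<And>i. Q i (p i)" using choice[of Q] by blast
  hence p: "real i + 1 \<le> p i s \<and> p i s \<notin> E \<and> p i s \<notin> D \<and> (real i + 2) / 2 * p i s \<le> p i (Suc s) \<and>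
    nevanlinna_T (p i s) f \<le> 2 * nevanlinna_T (p i 0) f" if "s \<le> 4" for i s
    using that unfolding Q_def by blast
  show thesis
  proof (rule that[of "\<lambda>s i. p i s"])
    show "peak_radii f (\<lambda>s i. p i s)"
      unfolding peak_radii_def
    proof (intro conjI allI impI)
      fix s i :: nat assume s: "s \<le> 4"
      have "real i + 1 \<le> p i s" using p[OF s] by blast
      thus "1 \<le> p i s" by linarith
      show "filterlim (\<lambda>i. p i s) at_top sequentially"
        by (rule filterlim_at_top_mono[OF filterlim_real_sequentially])
           (use p[OF s] in \<open>intro always_eventually allI, smt (verit)\<close>)
      show "nevanlinna_T (p i s) f \<le> 2 * nevanlinna_T (p i 0) f" using p[OF s] by blast
    next
      fix s :: nat assume s: "s < 4"
      have "filterlim (\<lambda>i. (real i + 2) / 2) at_top sequentially" by real_asymp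
      thus "filterlim (\<lambda>i. p i (Suc s) / p i s) at_top sequentially"
      proof (rule filterlim_at_top_mono, intro always_eventually allI)
        fix i
        have "(real i + 2) / 2 * p i s \<le> p i (Suc s)" "real i + 1 \<le> p i s" using p[of s i] s by auto
        thus "(real i + 2) / 2 \<le> p i (Suc s) / p i s" by (subst pos_le_divide_eq) auto
      qed
    qed
  qed (use p in auto)
qed

section \<open>Negligible quantities along a sequence of windows\<close>

text \<open>One-sided versions of \<open>o(T)\<close> and \<open>O(T)\<close>: \<open>X\<close> may be very negative.\<close>

definition negl :: "(nat \<Rightarrow> real) \<Rightarrow> (nat \<Rightarrow> real) \<Rightarrow> bool" where
  "negl T X \<longleftrightarrow> (\<forall>e>0. eventually (\<lambda>i. X i \<le> e * T i) sequentially)"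

definition dominated :: "(nat \<Rightarrow> real) \<Rightarrow> (nat \<Rightarrow> real) \<Rightarrow> bool" where
  "dominated T X \<longleftrightarrow> (\<exists>K\<ge>0. eventually (\<lambda>i. X i \<le> K * T i) sequentially)"

lemma neglD: "negl T X \<Longrightarrow> 0 < e \<Longrightarrow> eventually (\<lambda>i. X i \<le> e * T i) sequentially"
  by (simp add: negl_def)

lemma negl_mono_eventually:
  assumes "negl T Y" "eventually (\<lambda>i. X i \<le> Y i) sequentially"
  shows "negl T X"
  unfolding negl_def
proof (intro allI impI)
  fix e :: real assume "0 < e"
  from neglD[OF assms(1) this] assms(2) show "eventually (\<lambda>i. X i \<le> e * T i) sequentially"
    by eventually_elim linarith
qed

lemma negl_mono: "negl T Y \<Longrightarrow> (\<And>i. X i \<le> Y i) \<Longrightarrow> negl T X"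
  by (erule negl_mono_eventually) (intro always_eventually allI)

lemma dominated_mono_eventually:
  assumes "dominated T Y" "eventually (\<lambda>i. X i \<le> Y i) sequentially"
  shows "dominated T X"
proof -
  obtain K where K: "0 \<le> K" "eventually (\<lambda>i. Y i \<le> K * T i) sequentially" using assms(1) by (auto simp: dominated_def)
  from K(2) assms(2) have "eventually (\<lambda>i. X i \<le> K * T i) sequentially" by eventually_elim linarith
  thus ?thesis using K(1) by (auto simp: dominated_def)
qed

lemma dominated_mono: "dominated T Y \<Longrightarrow> (\<And>i. X i \<le> Y i) \<Longrightarrow> dominated T X"
  by (erule dominated_mono_eventually) (intro always_eventually allI)

lemma negl_add:
  assumes "negl T X" "negl T Y"
  shows "negl T (\<lambda>i. X i + Y i)"
  unfolding negl_def
proof (intro allI impI)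
  fix e :: real assume e: "0 < e"
  have "eventually (\<lambda>i. X i \<le> e / 2 * T i) sequentially" "eventually (\<lambda>i. Y i \<le> e / 2 * T i) sequentially"
    by (rule neglD[OF assms(1)] neglD[OF assms(2)]; use e in simp)+
  thus "eventually (\<lambda>i. X i + Y i \<le> e * T i) sequentially"
    by eventually_elim (simp add: field_simps)
qed

lemma dominated_add:
  assumes "dominated T X" "dominated T Y"
  shows "dominated T (\<lambda>i. X i + Y i)"
proof -
  obtain K L where KL: "0 \<le> K" "0 \<le> L"
    "eventually (\<lambda>i. X i \<le> K * T i) sequentially" "eventually (\<lambda>i. Y i \<le> L * T i) sequentially"
    using assms by (auto simp: dominated_def)
  from KL(3,4) have "eventually (\<lambda>i. X i + Y i \<le> (K + L) * T i) sequentially"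
    by eventually_elim (simp add: algebra_simps)
  thus ?thesis using KL(1,2) unfolding dominated_def by (intro exI[of _ "K + L"]) simp
qed

lemma dominated_cmult:
  assumes "dominated T X" "0 \<le> c"
  shows "dominated T (\<lambda>i. c * X i)"
proof -
  obtain K where K: "0 \<le> K" "eventually (\<lambda>i. X i \<le> K * T i) sequentially" using assms(1) by (auto simp: dominated_def)
  from K(2) have "eventually (\<lambda>i. c * X i \<le> (c * K) * T i) sequentially"
    by eventually_elim (use assms(2) in \<open>simp add: mult.assoc mult_left_mono\<close>)
  thus ?thesis using K(1) assms(2) unfolding dominated_def by (intro exI[of _ "c * K"]) simp
qed

lemma dominated_self: "dominated T T"
  unfolding dominated_def by (intro exI[of _ 1]) simp

lemma negl_imp_dominated: "negl T X \<Longrightarrow> dominated T X"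
  using neglD[of T X 1] unfolding dominated_def by (intro exI[of _ 1]) simp

context
  fixes T :: "nat \<Rightarrow> real"
  assumes T_top: "filterlim T at_top sequentially"
begin

lemma eventually_T_ge: "eventually (\<lambda>i. c \<le> T i) sequentially"
  using T_top by (simp add: filterlim_at_top)

lemma negl_const: "negl T (\<lambda>_. c)"
  unfolding negl_def
proof (intro allI impI)
  fix e :: real assume e: "0 < e"
  from eventually_T_ge[of "c / e"] show "eventually (\<lambda>i. c \<le> e * T i) sequentially"
    by eventually_elim (use e in \<open>simp add: field_simps\<close>)
qed

lemma negl_null_mult:
  assumes "c \<longlonglongrightarrow> 0" "eventually (\<lambda>i. 0 \<le> c i) sequentially" "dominated T Y"
  shows "negl T (\<lambda>i. c i * Y i)"
  unfolding negl_def
proof (intro allI impI)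
  fix e :: real assume e: "0 < e"
  obtain K where K: "0 \<le> K" "eventually (\<lambda>i. Y i \<le> K * T i) sequentially" using assms(3) by (auto simp: dominated_def)
  have "eventually (\<lambda>i. c i < e / (K + 1)) sequentially"
    using assms(1) by (rule order_tendstoD) (use e K in auto)
  with K(2) assms(2) eventually_T_ge[of 0] show "eventually (\<lambda>i. c i * Y i \<le> e * T i) sequentially"
  proof eventually_elim
    case (elim i)
    have "c i * Y i \<le> c i * (K * T i)" using elim by (intro mult_left_mono) auto
    also have "\<dots> \<le> (e / (K + 1)) * (K * T i)" using elim K by (intro mult_right_mono) auto
    also have "\<dots> = e * T i * (K / (K + 1))" by simp
    also have "\<dots> \<le> e * T i * 1" using elim e K by (intro mult_left_mono) (auto simp: field_simps)
    finally show ?case by simp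
  qed
qed

lemma negl_cmult:
  assumes "negl T X" "0 \<le> c"
  shows "negl T (\<lambda>i. c * X i)"
proof (cases "c = 0")
  case True
  thus ?thesis using negl_const[of 0] by simp
next
  case False
  hence c: "0 < c" using assms(2) by simp
  show ?thesis unfolding negl_def
  proof (intro allI impI)
    fix e :: real assume e: "0 < e"
    have "eventually (\<lambda>i. X i \<le> e / c * T i) sequentially" using assms e c by (intro neglD) auto
    thus "eventually (\<lambda>i. c * X i \<le> e * T i) sequentially"
      by eventually_elim (use c in \<open>simp add: field_simps\<close>)
  qed
qed

lemma negl_sum:
  assumes "finite I" "\<And>j. j \<in> I \<Longrightarrow> negl T (X j)"
  shows "negl T (\<lambda>i. \<Sum>j\<in>I. X j i)"
  using assms by (induction rule: finite_induct) (auto intro: negl_add simp: negl_const)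

lemma dominated_sum:
  assumes "finite I" "\<And>j. j \<in> I \<Longrightarrow> dominated T (X j)"
  shows "dominated T (\<lambda>i. \<Sum>j\<in>I. X j i)"
  using assms by (induction rule: finite_induct) (auto intro: dominated_add negl_imp_dominated simp: negl_const)

lemma negl_contradiction:
  assumes "negl T (\<lambda>i. c * T i)" "0 < c"
  shows False
proof -
  have "eventually (\<lambda>i. c * T i \<le> c / 2 * T i) sequentially" using assms by (intro neglD) auto
  with eventually_T_ge[of 1] have "eventually (\<lambda>i::nat. False) sequentially"
  proof eventually_elim
    case (elim i)
    have "0 < c * T i" using elim assms(2) by simp
    thus ?case using elim by simp
  qed
  thus False by simp
qed

end

text \<open>N depends only on punctured neighbourhoods, so agreement off a sparse set is enough for
  it; m reads the values on the circle, hence the separate hypothesis there.\<close>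

lemma nevanlinna_T_cong:
  assumes u: "merom_nonzero u" and eq: "\<forall>\<^sub>\<approx>z. u z = v z" and r: "0 < r"
    and circ: "\<And>z. norm z = r \<Longrightarrow> u z = v z"
  shows "nevanlinna_T r u = nevanlinna_T r v"
proof -
  have v: "merom_nonzero v" by (rule merom_nonzero_cong[OF u eq])
  have "zorder u a = zorder v a" for a
    by (rule zorder_cong) (use eventually_cosparse_imp_eventually_at[OF eq, of a] in auto)
  hence "nevanlinna_N r u = nevanlinna_N r v"
    by (simp add: nevanlinna_N_log_count u v r pole_mult_def[abs_def])
  moreover have "nevanlinna_m r u = nevanlinna_m r v"
    unfolding nevanlinna_m_circle_mean by (rule circle_mean_cong) (use circ r in auto)
  ultimately show ?thesis by (simp add: nevanlinna_T_def)
qed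

text \<open>Fixes one sequence of windows and measures everything against T at the innermost radius
  \<open>\<rho> 0\<close>. Transcendence of f enters through \<open>T_top\<close> and
  \<open>ln_negl\<close>.\<close>

locale peak_setup =
  fixes f :: "complex \<Rightarrow> complex" and \<rho> :: "nat \<Rightarrow> nat \<Rightarrow> real" and T :: "nat \<Rightarrow> real"
  assumes f: "merom_nonzero f"
    and peak: "peak_radii f \<rho>"
    and good_f: "\<And>s i. s \<le> 4 \<Longrightarrow> good_radius f (\<rho> s i)"
    and T_eq: "T = (\<lambda>i. nevanlinna_T (\<rho> 0 i) f)"
    and T_top: "filterlim T at_top sequentially"
    and ln_negl: "\<And>s. s \<le> 4 \<Longrightarrow> negl T (\<lambda>i. ln (\<rho> s i))"
begin

lemmas negl_rules = negl_add negl_const[OF T_top] negl_cmult[OF T_top]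
lemmas dominated_rules = dominated_add negl_imp_dominated[OF negl_const[OF T_top]] dominated_cmult

lemma \<rho>_ge_1: "s \<le> 4 \<Longrightarrow> 1 \<le> \<rho> s i"
  using peak by (auto simp: peak_radii_def)

lemma \<rho>_top: "s \<le> 4 \<Longrightarrow> filterlim (\<rho> s) at_top sequentially"
  using peak by (auto simp: peak_radii_def)

lemma ratio_top: "s < 4 \<Longrightarrow> filterlim (\<lambda>i. \<rho> (Suc s) i / \<rho> s i) at_top sequentially"
  using peak by (auto simp: peak_radii_def)

lemma ratio_ge: 
  assumes "s < 4"
  shows "eventually (\<lambda>i. c * \<rho> s i \<le> \<rho> (Suc s) i) sequentially"
proof -
  have "eventually (\<lambda>i. c \<le> \<rho> (Suc s) i / \<rho> s i) sequentially"
    using ratio_top[OF assms] by (simp add: filterlim_at_top)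
  thus ?thesis
  proof eventually_elim
    case (elim i)
    have "1 \<le> \<rho> s i" using assms by (intro \<rho>_ge_1) simp
    thus ?case using elim by (simp add: field_simps)
  qed
qed

lemma ratio_null:
  assumes "s < 4"
  shows "(\<lambda>i. \<rho> s i / \<rho> (Suc s) i) \<longlonglongrightarrow> 0"
  using tendsto_inverse_0_at_top[OF ratio_top[OF assms]] by (simp add: inverse_eq_divide)

lemma dominated_T_f:
  assumes "s \<le> 4"
  shows "dominated T (\<lambda>i. nevanlinna_T (\<rho> s i) f)"
  by (rule dominated_mono[OF dominated_cmult[OF dominated_self, of 2]])
     (use peak assms in \<open>auto simp: peak_radii_def T_eq\<close>)

text \<open>By \<open>divisor_count_bound\<close> the count times the logarithm of the ratio of the
  radii is O(T), and this logarithm tends to infinity.\<close>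

lemma divisor_negl:
  assumes u: "merom_nonzero u" and s: "s < 4" and good: "\<And>i. good_radius u (\<rho> (Suc s) i)"
    and dom: "dominated T (\<lambda>i. nevanlinna_T (\<rho> (Suc s) i) u)"
  shows "negl T (\<lambda>i. divisor_count u (2 * \<rho> s i))"
proof -
  obtain c where c: "0 \<le> c" "\<And>r. 1 \<le> r \<Longrightarrow> good_radius u r \<Longrightarrow>
      nevanlinna_N r u + nevanlinna_N r (\<lambda>z. inverse (u z)) \<le> 2 * nevanlinna_T r u + c"
    using nevanlinna_T_controls[OF u] by metis
  let ?l = "\<lambda>i. ln (\<rho> (Suc s) i / (2 * \<rho> s i))"
  have "filterlim (\<lambda>i. \<rho> (Suc s) i / \<rho> s i * (1 / 2)) at_top sequentially"
    by (rule filterlim_at_top_mult_tendsto_pos[OF tendsto_const _ ratio_top[OF s]]) simp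
  hence "filterlim (\<lambda>i. \<rho> (Suc s) i / (2 * \<rho> s i)) at_top sequentially" by (simp add: mult.commute)
  hence "filterlim ?l at_top sequentially" by (rule filterlim_compose[OF ln_at_top])
  hence null: "(\<lambda>i. inverse (?l i)) \<longlonglongrightarrow> 0" by (rule tendsto_inverse_0_at_top)
  have big: "eventually (\<lambda>i. 4 * \<rho> s i \<le> \<rho> (Suc s) i) sequentially" by (rule ratio_ge[OF s])
  have lpos: "0 < ?l i" if "4 * \<rho> s i \<le> \<rho> (Suc s) i" for i
  proof -
    have "1 \<le> \<rho> s i" using s by (intro \<rho>_ge_1) simp
    thus ?thesis using that by (intro ln_gt_zero) (simp add: field_simps)
  qed
  have nl: "negl T (\<lambda>i. inverse (?l i) * (2 * nevanlinna_T (\<rho> (Suc s) i) u + c))"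
  proof (rule negl_null_mult[OF T_top null])
    show "eventually (\<lambda>i. 0 \<le> inverse (?l i)) sequentially"
      using big by eventually_elim (use lpos in \<open>simp add: less_imp_le\<close>)
  qed (intro dominated_rules dom; simp)
  show ?thesis
  proof (rule negl_mono_eventually[OF nl])
    show "\<forall>\<^sub>F i in sequentially. divisor_count u (2 * \<rho> s i)
         \<le> inverse (?l i) * (2 * nevanlinna_T (\<rho> (Suc s) i) u + c)"
      using big
    proof eventually_elim
      case (elim i)
      have r1: "1 \<le> \<rho> s i" "1 \<le> \<rho> (Suc s) i" using s by (intro \<rho>_ge_1; simp)+
      have "divisor_count u (2 * \<rho> s i) * ?l i \<le> nevanlinna_N (\<rho> (Suc s) i) u + nevanlinna_N (\<rho> (Suc s) i) (\<lambda>z. inverse (u z))"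
        by (rule divisor_count_bound[OF u]) (use r1 elim in auto)
      also have "\<dots> \<le> 2 * nevanlinna_T (\<rho> (Suc s) i) u + c" by (rule c(2)[OF r1(2) good])
      finally show ?case using lpos[OF elim] by (simp add: field_simps)
    qed
  qed
qed

lemma proximity_dominated:
  assumes u: "merom_nonzero u" and s: "s \<le> 4" and good: "\<And>i. good_radius u (\<rho> s i)"
    and dom: "dominated T (\<lambda>i. nevanlinna_T (\<rho> s i) u)"
  shows "dominated T (\<lambda>i. proximity_sum (\<rho> s i) u)"
proof -
  obtain c where c: "0 \<le> c" "\<And>r. 1 \<le> r \<Longrightarrow> good_radius u r \<Longrightarrow> proximity_sum r u \<le> 2 * nevanlinna_T r u + c"
    using nevanlinna_T_controls[OF u] by metis
  have "dominated T (\<lambda>i. 2 * nevanlinna_T (\<rho> s i) u + c)"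
    by (intro dominated_rules dom) simp
  thus ?thesis by (rule dominated_mono) (intro c(2) good \<rho>_ge_1 s)
qed

text \<open>These are the error terms of the factorization estimates for r =
  \<open>\<rho> s i\<close> and R = \<open>\<rho> (Suc s) i\<close>. The proximity term is O(T) and
  carries r/R or 8/R, both tending to 0. Zeros and poles are counted up to 2 R, which requires the
  characteristic one radius further out; hence two domination hypotheses and s < 3.\<close>

lemma remainder_negl:
  assumes u: "merom_nonzero u" and s: "s < 3" and good: "\<And>t i. t \<le> 4 \<Longrightarrow> good_radius u (\<rho> t i)"
    and dom: "dominated T (\<lambda>i. nevanlinna_T (\<rho> (Suc s) i) u)" "dominated T (\<lambda>i. nevanlinna_T (\<rho> (Suc (Suc s)) i) u)"
  shows "negl T (\<lambda>i. divisor_count u (2 * \<rho> (Suc s) i))"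
    and "negl T (\<lambda>i. \<rho> s i / \<rho> (Suc s) i * (proximity_sum (\<rho> (Suc s) i) u + 3 * divisor_count u (2 * \<rho> (Suc s) i)))"
    and "negl T (\<lambda>i. 8 / \<rho> (Suc s) i * (proximity_sum (\<rho> (Suc s) i) u + 3 * divisor_count u (2 * \<rho> (Suc s) i)))"
proof -
  show 1: "negl T (\<lambda>i. divisor_count u (2 * \<rho> (Suc s) i))"
    by (rule divisor_negl[OF u _ _ dom(2)]) (use s good in auto)
  have d: "dominated T (\<lambda>i. proximity_sum (\<rho> (Suc s) i) u + 3 * divisor_count u (2 * \<rho> (Suc s) i))"
    by (intro dominated_rules proximity_dominated u good dom negl_imp_dominated[OF 1]) (use s in auto)
  have pos: "0 \<le> \<rho> t i" if "t \<le> 4" for t i using \<rho>_ge_1[OF that, of i] by simp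
  show "negl T (\<lambda>i. \<rho> s i / \<rho> (Suc s) i * (proximity_sum (\<rho> (Suc s) i) u + 3 * divisor_count u (2 * \<rho> (Suc s) i)))"
    by (rule negl_null_mult[OF T_top ratio_null _ d])
       (use s pos in \<open>auto intro!: always_eventually divide_nonneg_nonneg\<close>)
  have "filterlim (\<rho> (Suc s)) at_top sequentially" using s by (intro \<rho>_top) simp
  hence "(\<lambda>i. 8 * inverse (\<rho> (Suc s) i)) \<longlonglongrightarrow> 8 * 0" by (intro tendsto_mult tendsto_const tendsto_inverse_0_at_top)
  hence "(\<lambda>i. 8 / \<rho> (Suc s) i) \<longlonglongrightarrow> 0" by (simp add: divide_inverse)
  thus "negl T (\<lambda>i. 8 / \<rho> (Suc s) i * (proximity_sum (\<rho> (Suc s) i) u + 3 * divisor_count u (2 * \<rho> (Suc s) i)))"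
    by (rule negl_null_mult[OF T_top _ _ d])
       (use s pos in \<open>auto intro!: always_eventually divide_nonneg_nonneg\<close>)
qed

text \<open>For m, log+ |f(q z + c)| exceeds log+ |f(z)| by at most the difference of logarithms in
  \<open>shift_mean_bound\<close>; for N, \<open>shift_N_bound\<close> applies. The range s <= 2
  leaves two wider radii for the error terms.\<close>

lemma shift_T_negl:
  assumes q: "q \<noteq> 0" and s: "s \<le> 2" and good: "\<And>i. good_radius (\<lambda>z. f (q * z + c)) (\<rho> s i)"
  shows "negl T (\<lambda>i. nevanlinna_T (\<rho> s i) (\<lambda>z. f (q * z + c)) - nevanlinna_T (\<rho> s i) f)"
proof -
  let ?v = "\<lambda>z. f (q * z + c)"
  obtain K where K: "0 < K"
    "\<And>r R. \<lbrakk>1 \<le> r; K * r \<le> R; good_radius f r; good_radius ?v r; good_radius f R\<rbrakk> \<Longrightarrow>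
       circle_mean r (\<lambda>z. \<bar>ln (norm (?v z)) - ln (norm (f z))\<bar>)
         \<le> K * (r / R * (proximity_sum R f + 3 * divisor_count f (2 * R)) + divisor_count f (2 * R))"
    using shift_mean_bound[OF f q, of c] by blast
  obtain K' where K': "0 \<le> K'"
    "\<And>r R. \<lbrakk>1 \<le> r; (norm q + norm c + 1) * r \<le> R\<rbrakk> \<Longrightarrow>
       nevanlinna_N r ?v \<le> nevanlinna_N r f + K' * (divisor_count f R + ln r)"
    using shift_N_bound[OF f q, of c] by blast
  have s3: "s < 3" using s by simp
  have rem: "negl T (\<lambda>i. divisor_count f (2 * \<rho> (Suc s) i))"
    "negl T (\<lambda>i. \<rho> s i / \<rho> (Suc s) i * (proximity_sum (\<rho> (Suc s) i) f + 3 * divisor_count f (2 * \<rho> (Suc s) i)))"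
    using remainder_negl(1,2)[OF f s3 good_f dominated_T_f dominated_T_f] s by auto
  let ?X = "\<lambda>i. \<rho> s i / \<rho> (Suc s) i * (proximity_sum (\<rho> (Suc s) i) f + 3 * divisor_count f (2 * \<rho> (Suc s) i))"
  let ?n = "\<lambda>i. divisor_count f (2 * \<rho> (Suc s) i)"
  have nl: "negl T (\<lambda>i. K * (?X i + ?n i) + K' * (?n i + ln (\<rho> s i)))"
    by (intro negl_rules rem ln_negl) (use K(1) K'(1) s in auto)
  have "eventually (\<lambda>i. max K (norm q + norm c + 1) * \<rho> s i \<le> \<rho> (Suc s) i) sequentially"
    by (rule ratio_ge) (use s in simp)
  hence ev: "eventually (\<lambda>i. nevanlinna_T (\<rho> s i) ?v - nevanlinna_T (\<rho> s i) f \<le> K * (?X i + ?n i) + K' * (?n i + ln (\<rho> s i))) sequentially"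
  proof eventually_elim
    case (elim i)
    let ?r = "\<rho> s i" and ?R = "\<rho> (Suc s) i"
    have r: "1 \<le> ?r" "1 \<le> ?R" using s by (intro \<rho>_ge_1; simp)+
    have "K * ?r \<le> max K (norm q + norm c + 1) * ?r" using r by (intro mult_right_mono) auto
    hence KR: "K * ?r \<le> ?R" using elim by linarith
    \<comment> \<open>The counting estimate is applied with outer radius 2 R, so that it involves
      the same divisor count as the estimate for the means.\<close>
    have "(norm q + norm c + 1) * ?r \<le> max K (norm q + norm c + 1) * ?r" using r by (intro mult_right_mono) auto
    hence KR': "(norm q + norm c + 1) * ?r \<le> 2 * ?R" using elim r by linarith
    have gf: "good_radius f ?r" "good_radius f ?R" using s by (auto intro!: good_f)
    have c1: "continuous_on (sphere 0 ?r) (\<lambda>z. log_plus (norm (f z)))"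
      by (intro log_plus_continuous continuous_on_norm good_radius_continuous gf)
    have c2: "continuous_on (sphere 0 ?r) (\<lambda>z. \<bar>ln (norm (?v z)) - ln (norm (f z))\<bar>)"
      by (intro continuous_on_rabs continuous_on_diff good_radius_continuous_ln gf good)
    have "nevanlinna_m ?r ?v \<le> circle_mean ?r (\<lambda>z. log_plus (norm (f z)) + \<bar>ln (norm (?v z)) - ln (norm (f z))\<bar>)"
      unfolding nevanlinna_m_circle_mean
    proof (rule circle_mean_mono)
      fix z :: complex assume z: "norm z = ?r"
      have "f z \<noteq> 0" "?v z \<noteq> 0" using z gf(1) good by (auto dest: good_radius_nonzero)
      hence "log_plus (norm (?v z)) = max 0 (ln (norm (?v z)))" "log_plus (norm (f z)) = max 0 (ln (norm (f z)))"
        by (auto intro!: log_plus_eq)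
      thus "log_plus (norm (?v z)) \<le> log_plus (norm (f z)) + \<bar>ln (norm (?v z)) - ln (norm (f z))\<bar>" by linarith
    qed (use r in \<open>auto intro!: log_plus_continuous continuous_on_norm good_radius_continuous good continuous_on_add c1 c2\<close>)
    also have "\<dots> = nevanlinna_m ?r f + circle_mean ?r (\<lambda>z. \<bar>ln (norm (?v z)) - ln (norm (f z))\<bar>)"
      unfolding nevanlinna_m_circle_mean using r by (intro circle_mean_add c1 c2) simp
    also have "circle_mean ?r (\<lambda>z. \<bar>ln (norm (?v z)) - ln (norm (f z))\<bar>) \<le> K * (?X i + ?n i)"
      by (rule K(2)[OF r(1) KR gf(1) good gf(2)])
    finally have "nevanlinna_m ?r ?v \<le> nevanlinna_m ?r f + K * (?X i + ?n i)" by simp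
    thus ?case using K'(2)[OF r(1) KR'] by (simp add: nevanlinna_T_def)
  qed
  show ?thesis by (rule negl_mono_eventually[OF nl ev])
qed

lemma shift_T_dominated:
  assumes q: "q \<noteq> 0" and s: "s \<le> 2" and good: "\<And>i. good_radius (\<lambda>z. f (q * z + c)) (\<rho> s i)"
  shows "dominated T (\<lambda>i. nevanlinna_T (\<rho> s i) (\<lambda>z. f (q * z + c)))"
proof -
  have "dominated T (\<lambda>i. (nevanlinna_T (\<rho> s i) (\<lambda>z. f (q * z + c)) - nevanlinna_T (\<rho> s i) f) + nevanlinna_T (\<rho> s i) f)"
    by (intro dominated_add dominated_T_f negl_imp_dominated shift_T_negl q good) (use s in auto)
  thus ?thesis by simp
qed

lemma logderiv_negl:
  assumes u: "merom_nonzero u" and good: "\<And>t i. t \<le> 4 \<Longrightarrow> good_radius u (\<rho> t i)"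
    and dom: "dominated T (\<lambda>i. nevanlinna_T (\<rho> 1 i) u)" "dominated T (\<lambda>i. nevanlinna_T (\<rho> 2 i) u)"
    and cont: "\<And>i. continuous_on (sphere 0 (\<rho> 0 i)) (deriv u)"
  shows "negl T (\<lambda>i. nevanlinna_m (\<rho> 0 i) (\<lambda>z. deriv u z / u z))"
proof -
  have d: "dominated T (\<lambda>i. nevanlinna_T (\<rho> (Suc 0) i) u)" "dominated T (\<lambda>i. nevanlinna_T (\<rho> (Suc (Suc 0)) i) u)"
    using dom by (simp_all add: numeral_2_eq_2)
  have s: "(0::nat) < 3" by simp
  note rem = remainder_negl(1,3)[OF u s good d]
  have nl: "negl T (\<lambda>i. 8 / \<rho> (Suc 0) i * (proximity_sum (\<rho> (Suc 0) i) u + 3 * divisor_count u (2 * \<rho> (Suc 0) i)) + 3 * divisor_count u (2 * \<rho> (Suc 0) i))"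
    by (intro negl_rules rem) auto
  have "eventually (\<lambda>i. 2 * \<rho> 0 i \<le> \<rho> (Suc 0) i) sequentially" by (rule ratio_ge) simp
  hence "eventually (\<lambda>i. nevanlinna_m (\<rho> 0 i) (\<lambda>z. deriv u z / u z) \<le> 8 / \<rho> (Suc 0) i * (proximity_sum (\<rho> (Suc 0) i) u + 3 * divisor_count u (2 * \<rho> (Suc 0) i)) + 3 * divisor_count u (2 * \<rho> (Suc 0) i)) sequentially"
    by eventually_elim (intro log_derivative_bound u good cont \<rho>_ge_1; simp)
  thus ?thesis by (rule negl_mono_eventually[OF nl])
qed

text \<open>T = m + N with m at most the proximity sum, which \<open>balanced_mean_bound\<close>
  reduces to counting functions and error terms.\<close>

lemma balanced_negl:
  assumes u: "merom_nonzero u" and good: "\<And>t i. t \<le> 4 \<Longrightarrow> good_radius u (\<rho> t i)"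
    and dom: "dominated T (\<lambda>i. nevanlinna_T (\<rho> 1 i) u)" "dominated T (\<lambda>i. nevanlinna_T (\<rho> 2 i) u)"
    and N: "negl T (\<lambda>i. nevanlinna_N (\<rho> 0 i) u)" "negl T (\<lambda>i. nevanlinna_N (\<rho> 0 i) (\<lambda>z. inverse (u z)))"
  shows "negl T (\<lambda>i. nevanlinna_T (\<rho> 0 i) u)"
proof -
  have d: "dominated T (\<lambda>i. nevanlinna_T (\<rho> (Suc 0) i) u)" "dominated T (\<lambda>i. nevanlinna_T (\<rho> (Suc (Suc 0)) i) u)"
    using dom by (simp_all add: numeral_2_eq_2)
  have s: "(0::nat) < 3" by simp
  note rem = remainder_negl(1,2)[OF u s good d]
  obtain C where C: "\<And>r R. \<lbrakk>1 \<le> r; 2 * r \<le> R; good_radius u r; good_radius u R\<rbrakk> \<Longrightarrow>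
     proximity_sum r u \<le> C + nevanlinna_N r u + nevanlinna_N r (\<lambda>z. inverse (u z)) +
       8 * (r / R) * (proximity_sum R u + 3 * divisor_count u (2 * R)) + 2 * divisor_count u (2 * R)"
    using balanced_mean_bound[OF u] by blast
  let ?Y = "\<lambda>i. C + nevanlinna_N (\<rho> 0 i) u + nevanlinna_N (\<rho> 0 i) (\<lambda>z. inverse (u z)) +
     8 * (\<rho> 0 i / \<rho> (Suc 0) i * (proximity_sum (\<rho> (Suc 0) i) u + 3 * divisor_count u (2 * \<rho> (Suc 0) i))) + 2 * divisor_count u (2 * \<rho> (Suc 0) i) + nevanlinna_N (\<rho> 0 i) u"
  have nl: "negl T ?Y"
    by (intro negl_rules rem N) auto
  have "eventually (\<lambda>i. 2 * \<rho> 0 i \<le> \<rho> (Suc 0) i) sequentially" by (rule ratio_ge) simp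
  hence "eventually (\<lambda>i. nevanlinna_T (\<rho> 0 i) u \<le> ?Y i) sequentially"
  proof eventually_elim
    case (elim i)
    have r: "1 \<le> \<rho> 0 i" by (intro \<rho>_ge_1) simp
    have g: "good_radius u (\<rho> 0 i)" "good_radius u (\<rho> (Suc 0) i)" by (auto intro!: good)
    have "0 \<le> nevanlinna_m (\<rho> 0 i) (\<lambda>z. inverse (u z))"
      by (intro nevanlinna_m_nonneg good_radius_continuous good_radius_inverse g) (use r in simp)
    moreover have "proximity_sum (\<rho> 0 i) u = nevanlinna_m (\<rho> 0 i) u + nevanlinna_m (\<rho> 0 i) (\<lambda>z. inverse (u z))"
      unfolding proximity_sum_def by (rule circle_mean_abs_ln_eq[OF g(1)]) (use r in simp)
    ultimately show ?case using C[OF r elim g] by (simp add: nevanlinna_T_def)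
  qed
  thus ?thesis by (rule negl_mono_eventually[OF nl])
qed

end

section \<open>Conclusion\<close>

lemma nevanlinna_T_prod_le:
  assumes "finite I" "\<And>i. i \<in> I \<Longrightarrow> merom_nonzero (u i)" "1 \<le> r"
    "\<And>i. i \<in> I \<Longrightarrow> continuous_on (sphere 0 r) (u i)"
  shows "nevanlinna_T r (\<lambda>z. \<Prod>i\<in>I. u i z) \<le> (\<Sum>i\<in>I. nevanlinna_T r (u i))"
  using assms(1,2,4)
proof (induction rule: finite_induct)
  case empty
  show ?case using assms(3) nevanlinna_T_const[of 1 r] by (simp add: log_plus_def)
next
  case (insert x F)
  have "nevanlinna_T r (\<lambda>z. u x z * (\<Prod>i\<in>F. u i z)) \<le> nevanlinna_T r (u x) + nevanlinna_T r (\<lambda>z. \<Prod>i\<in>F. u i z)"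
    using insert.prems assms(3) by (intro nevanlinna_T_mult_le merom_nonzero_prod continuous_on_prod) auto
  also have "nevanlinna_T r (\<lambda>z. \<Prod>i\<in>F. u i z) \<le> (\<Sum>i\<in>F. nevanlinna_T r (u i))"
    using insert by auto
  finally show ?case using insert.hyps by simp
qed

lemma nevanlinna_T_power_le:
  assumes "merom_nonzero u" "1 \<le> r" "continuous_on (sphere 0 r) u"
  shows "nevanlinna_T r (\<lambda>z. u z ^ n) \<le> real n * nevanlinna_T r u"
  using nevanlinna_T_prod_le[of "{..<n}" "\<lambda>_. u" r] assms by simp

lemma nevanlinna_T_cmult_le:
  assumes "c \<noteq> 0" "merom_nonzero u" "1 \<le> r" "continuous_on (sphere 0 r) u"
  shows "nevanlinna_T r (\<lambda>z. c * u z) \<le> log_plus (norm c) + nevanlinna_T r u"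
  using nevanlinna_T_mult_le[OF merom_nonzero_const[OF assms(1)] assms(2,3) continuous_on_const assms(4)]
    nevanlinna_T_const[OF assms(1), of r] assms(3) by simp

lemma nevanlinna_T_diff_const_le:
  assumes "nonconstant_mero f" "1 \<le> r" "continuous_on (sphere 0 r) f"
  shows "nevanlinna_T r (\<lambda>z. f z - e) \<le> nevanlinna_T r f + (log_plus (norm e) + ln 2)"
proof (cases "e = 0")
  case False
  have "nevanlinna_T r (\<lambda>z. f z - e) \<le> nevanlinna_T r f + nevanlinna_T r (\<lambda>_. e) + ln 2"
    using assms False
    by (intro nevanlinna_T_diff_le nonconstant_meroD nonconstant_mero_nonzero merom_nonzero_const) auto
  thus ?thesis using False assms(2) by (simp add: nevanlinna_T_const)
qed simp

text \<open>Supplies the O(T) bounds for P(f) at the wider radii of a window, where the exact factor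
  is irrelevant.\<close>

lemma nevanlinna_T_poly_upper:
  assumes f: "nonconstant_mero f" and P: "P \<noteq> 0"
  obtains C where "\<And>r. 1 \<le> r \<Longrightarrow> continuous_on (sphere 0 r) f \<Longrightarrow>
    nevanlinna_T r (\<lambda>z. poly P (f z)) \<le> real (degree P) * nevanlinna_T r f + C"
proof (rule that)
  fix r :: real assume r: "1 \<le> r" and cont: "continuous_on (sphere 0 r) f"
  let ?Z = "{e. poly P e = 0}"
  have fin: "finite ?Z" using P by (rule poly_roots_finite)
  have c: "continuous_on (sphere 0 r) (\<lambda>z. f z - e)" for e by (intro continuous_on_diff cont continuous_on_const)
  have m: "merom_nonzero (\<lambda>z. (f z - e) ^ order e P)" for e by (intro merom_nonzero_power nonconstant_meroD f)
  have "nevanlinna_T r (\<lambda>z. poly P (f z)) \<le> log_plus (norm (lead_coeff P)) +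
      nevanlinna_T r (\<lambda>z. \<Prod>e\<in>?Z. (f z - e) ^ order e P)"
    unfolding poly_comp_decompose[of P f] using P r
    by (intro nevanlinna_T_cmult_le merom_nonzero_prod m continuous_on_prod continuous_on_power c) auto
  also have "nevanlinna_T r (\<lambda>z. \<Prod>e\<in>?Z. (f z - e) ^ order e P) \<le> (\<Sum>e\<in>?Z. nevanlinna_T r (\<lambda>z. (f z - e) ^ order e P))"
    by (intro nevanlinna_T_prod_le fin m r continuous_on_power c)
  also have "\<dots> \<le> (\<Sum>e\<in>?Z. real (order e P) * (nevanlinna_T r f + (log_plus (norm e) + ln 2)))"
  proof (rule sum_mono)
    fix e
    have "nevanlinna_T r (\<lambda>z. (f z - e) ^ order e P) \<le> real (order e P) * nevanlinna_T r (\<lambda>z. f z - e)"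
      by (intro nevanlinna_T_power_le nonconstant_meroD f r c)
    also have "\<dots> \<le> real (order e P) * (nevanlinna_T r f + (log_plus (norm e) + ln 2))"
      by (intro mult_left_mono nevanlinna_T_diff_const_le f r cont) simp
    finally show "nevanlinna_T r (\<lambda>z. (f z - e) ^ order e P) \<le> \<dots>" .
  qed
  also have "\<dots> = real (\<Sum>e\<in>?Z. order e P) * nevanlinna_T r f + (\<Sum>e\<in>?Z. real (order e P) * (log_plus (norm e) + ln 2))"
    by (simp add: distrib_left sum.distrib sum_distrib_right)
  finally show "nevanlinna_T r (\<lambda>z. poly P (f z)) \<le> real (degree P) * nevanlinna_T r f +
    (log_plus (norm (lead_coeff P)) + (\<Sum>e\<in>?Z. real (order e P) * (log_plus (norm e) + ln 2)))"
    unfolding sum_order_complex_poly[OF P] by simp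
qed

text \<open>If H' vanished off a sparse set, continuity would make it vanish on a whole disc of
  analyticity, where H would be constant.\<close>

lemma merom_nonzero_deriv:
  assumes H: "nonconstant_mero H"
  shows "merom_nonzero (deriv H)"
proof -
  have H0: "merom_nonzero H" by (rule nonconstant_mero_nonzero[OF H])
  have m: "deriv H meromorphic_on UNIV" by (intro meromorphic_on_deriv merom_nonzero_mero H0)
  have False if z: "\<forall>\<^sub>\<approx>z. deriv H z = 0"
  proof -
    obtain z0 where z0: "regular_at H z0"
    proof (rule ccontr)
      assume "\<not> thesis"
      hence "\<And>z. \<not> regular_at H z" using that by blast
      with merom_nonzero_regular[OF H0] show False by simp
    qed
    then obtain e where e: "0 < e" "H holomorphic_on ball z0 e"
      unfolding regular_at_def analytic_on_def by auto
    have d0: "deriv H w = 0" if w: "w \<in> ball z0 e" for w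
    proof -
      have "deriv H holomorphic_on ball z0 e" by (intro holomorphic_deriv e open_ball)
      hence "isCont (deriv H) w"
        using w by (meson continuous_on_eq_continuous_at holomorphic_on_imp_continuous_on open_ball)
      hence "(deriv H \<longlongrightarrow> deriv H w) (at w)" by (simp add: isCont_def)
      moreover have "(deriv H \<longlongrightarrow> 0) (at w)"
        by (rule tendsto_eventually) (use eventually_cosparse_imp_eventually_at[OF z, of w] in auto)
      ultimately show ?thesis by (rule LIM_unique)
    qed
    have "\<exists>c. \<forall>w\<in>ball z0 e. H w = c"
    proof (rule has_field_derivative_zero_constant)
      fix w assume w: "w \<in> ball z0 e"
      have "(H has_field_derivative deriv H w) (at w)" by (rule holomorphic_derivI[OF e(2) open_ball w])
      thus "(H has_field_derivative 0) (at w within ball z0 e)" using d0[OF w] has_field_derivative_at_within by metis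
    qed auto
    then obtain c where c: "\<And>w. w \<in> ball z0 e \<Longrightarrow> H w = c" by blast
    have "\<forall>\<^sub>F w in at z0. w \<in> ball z0 e" using e by (intro eventually_at_in_open') auto
    moreover have "\<forall>\<^sub>F w in at z0. H w - c \<noteq> 0" by (rule merom_nonzero_at[OF nonconstant_meroD[OF H]])
    ultimately have "\<forall>\<^sub>F w in at z0. False" by eventually_elim (use c in auto)
    thus False by simp
  qed
  thus ?thesis using m by (auto simp: merom_nonzero_def nonzero_function_def)
qed

lemma deriv_diff_const_good:
  assumes "good_radius H r" "norm z = r"
  shows "deriv (\<lambda>z. H z - c) z = deriv H z"
proof -
  have "H field_differentiable at z"
    using assms analytic_on_imp_differentiable_at by (auto simp: good_radius_def regular_at_def)
  thus ?thesis by (subst deriv_diff) auto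
qed

text \<open>Both cases of the theorem refuted at once, since they share the windows and all
  characteristic estimates. \<open>L\<close> must not vanish identically, for otherwise the function
  in question is - \<alpha>, which can be zero-free. The bound \<open>k + 2 \<le> degree P\<close>
  makes the lower estimate for T(r, F) a positive multiple of T(r, f).\<close>

lemma few_zeros_bounds:
  fixes k :: nat and P :: "complex poly" and f \<alpha> :: "complex \<Rightarrow> complex" and a c q :: "nat \<Rightarrow> complex"
  assumes P: "P \<noteq> 0" and zo: "zero_order f" and small: "small_function \<alpha> f" and \<alpha>0: "nonzero_function \<alpha>"
    and q: "\<And>j. j \<le> k \<Longrightarrow> q j \<noteq> 0" and L0: "nonzero_function (L_op k a q c f)"
    and f: "transcendental_meromorphic f"
    and fin: "finite {z. isolated_zero (\<lambda>z. poly P (f z) * L_op k a q c f z - \<alpha> z) z}"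
    and n: "k + 2 \<le> degree P"
  shows "degree P \<le> card {z. poly P z = 0} + 3 * k + 4" and "\<not> f holomorphic_on UNIV"
proof -

  \<comment> \<open>The functions involved and their meromorphy\<close>
  define L where "L = L_op k a q c f"
  define v where "v j z = f (q j * z + c j)" for j z
  define Pf where "Pf z = poly P (f z)" for z
  define F where "F z = Pf z * L z" for z
  define G where "G z = F z - \<alpha> z" for z
  define H where "H z = F z / \<alpha> z" for z
  define Z where "Z = {e. poly P e = 0}"
  \<comment> \<open>Indices with coefficient 0 are dropped, because the estimates for sums require
    each summand to be a nonzero meromorphic function.\<close>
  define J where "J = {j. j \<le> k \<and> a j \<noteq> 0}"
  have finZ: "finite Z" using P poly_roots_finite by (simp add: Z_def)
  have finJ: "finite J" "card J \<le> k + 1"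
  proof -
    have "J \<subseteq> {..k}" by (auto simp: J_def)
    thus "finite J" "card J \<le> k + 1" using finite_subset[of J "{..k}"] card_mono[of "{..k}" J] by auto
  qed
  have nc: "nonconstant_mero f" by (rule transcendental_imp_nonconstant[OF f])
  have f0: "merom_nonzero f" by (rule nonconstant_mero_nonzero[OF nc])
  have fe: "merom_nonzero (\<lambda>z. f z - e)" for e by (rule nonconstant_meroD[OF nc])
  have v0: "merom_nonzero (v j)" if "j \<le> k" for j
    unfolding v_def by (rule merom_nonzero_affine[OF f0 q[OF that]])
  have av0: "merom_nonzero (\<lambda>z. a j * v j z)" if "j \<in> J" for j
    using that by (intro merom_nonzero_mult merom_nonzero_const v0) (auto simp: J_def)
  have L_eq: "L = (\<lambda>z. \<Sum>j\<in>J. a j * v j z)"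
    unfolding L_def L_op_def v_def by (rule ext, rule sum.mono_neutral_right) (auto simp: J_def)
  have Lm: "merom_nonzero L"
    unfolding merom_nonzero_def
  proof
    show "L meromorphic_on UNIV"
      unfolding L_eq by (rule meromorphic_on_sum) (rule merom_nonzero_mero[OF av0])
  qed (use L0 in \<open>simp add: L_def\<close>)
  have Pm: "merom_nonzero Pf" using merom_nonzero_poly[OF nc P] by (simp add: Pf_def[abs_def])
  have Fm: "merom_nonzero F" unfolding F_def by (rule merom_nonzero_mult[OF Pm Lm])
  have \<alpha>m: "merom_nonzero \<alpha>" using small \<alpha>0 by (simp add: small_function_def merom_nonzero_def)
  have Hm: "merom_nonzero H" unfolding H_def by (rule merom_nonzero_divide[OF Fm \<alpha>m])
  obtain E where E: "E \<in> lmeasurable" "(\<lambda>r. nevanlinna_T r \<alpha>) \<in> o[inf at_top (principal (- E))](\<lambda>r. nevanlinna_T r f)"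
    using small by (auto simp: small_function_def nevanlinna_S_def)

  \<comment> \<open>Choice of radii and growth of T along them\<close>
  define U0 where "U0 = {f, Pf, L, F, \<alpha>, H, G, \<lambda>z. H z - 1, deriv H} \<union> v ` {..k} \<union> (\<lambda>e z. f z - e) ` Z"
  \<comment> \<open>The radii must be good for \<open>G\<close>, \<open>H - 1\<close> and
    \<open>deriv H\<close> too, but that these do not vanish identically is proved only later, by
    means of the radii. Filtering by \<open>merom_nonzero\<close> breaks the circle: membership is
    established afterwards.\<close>
  define U where "U = {u \<in> U0. merom_nonzero u}"
  define D where "D = (\<Union>u\<in>U. {r. \<not> good_radius u r})"
  have "finite U" unfolding U_def U0_def using finZ by simp
  hence D: "countable D" unfolding D_def by (intro countable_UN countable_finite good_radius_countable) (auto simp: U_def)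
  have goodD: "good_radius u r" if "u \<in> U" "r \<notin> D" for u r using that by (auto simp: D_def)
  have fU: "f \<in> U" using f0 by (simp add: U_def U0_def)
  obtain r0 where r0: "\<And>r. r0 \<le> r \<Longrightarrow> good_radius f r \<Longrightarrow> 1 * ln r \<le> nevanlinna_T r f"
    using transcendental_growth[OF f, of 1] by blast
  have pos: "0 < nevanlinna_T r f" if "max r0 (exp 1) \<le> r" "r \<notin> D" for r
  proof -
    have "0 < exp (1::real)" by simp
    hence "1 \<le> ln r" using that by (subst ln_ge_iff) (auto simp del: exp_gt_zero)
    thus ?thesis using r0[of r] that goodD[OF fU] by auto
  qed
  obtain \<rho> where \<rho>: "peak_radii f \<rho>" "\<And>s i. s \<le> 4 \<Longrightarrow> \<rho> s i \<notin> E" "\<And>s i. s \<le> 4 \<Longrightarrow> \<rho> s i \<notin> D"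
    by (rule peak_radii_exist[OF zo E(1) D, of "max r0 (exp 1)"]) (use pos in blast)+
  define T where "T = (\<lambda>i. nevanlinna_T (\<rho> 0 i) f)"
  have good: "good_radius u (\<rho> s i)" if "u \<in> U" "s \<le> 4" for u s i
    using goodD[OF that(1) \<rho>(3)[OF that(2)]] .
  have \<rho>_ev: "eventually (\<lambda>i. b \<le> \<rho> s i) sequentially" if "s \<le> 4" for s b
    using \<rho>(1) that by (auto simp: peak_radii_def filterlim_at_top)
  have Tle: "nevanlinna_T (\<rho> s i) f \<le> 2 * T i" if "s \<le> 4" for s i
    using \<rho>(1) that by (auto simp: peak_radii_def T_def)
  have T_top: "filterlim T at_top sequentially"
  proof (rule filterlim_at_top_mono)
    have "filterlim (\<rho> 0) at_top sequentially" using \<rho>(1) by (auto simp: peak_radii_def)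
    thus "filterlim (\<lambda>i. ln (\<rho> 0 i)) at_top sequentially" by (rule filterlim_compose[OF ln_at_top])
    show "eventually (\<lambda>i. ln (\<rho> 0 i) \<le> T i) sequentially"
      using \<rho>_ev[of 0 r0] by (auto elim!: eventually_mono simp: T_def intro!: r0[simplified] good fU)
  qed
  have ln_negl: "negl T (\<lambda>i. ln (\<rho> s i))" if s: "s \<le> 4" for s
    unfolding negl_def
  proof (intro allI impI)
    fix e :: real assume e: "0 < e"
    obtain r1 where r1: "\<And>r. r1 \<le> r \<Longrightarrow> good_radius f r \<Longrightarrow> (2 / e) * ln r \<le> nevanlinna_T r f"
      using transcendental_growth[OF f, of "2 / e"] by blast
    from \<rho>_ev[OF s, of r1] show "eventually (\<lambda>i. ln (\<rho> s i) \<le> e * T i) sequentially"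
    proof eventually_elim
      case (elim i)
      have "(2 / e) * ln (\<rho> s i) \<le> 2 * T i"
        using r1[OF elim good[OF fU s]] Tle[OF s, of i] by linarith
      thus ?case using e by (simp add: field_simps)
    qed
  qed
  interpret peak_setup f \<rho> T
    by unfold_locales (use f0 \<rho>(1) T_top ln_negl good[OF fU] in \<open>auto simp: T_def\<close>)
  have cont: "continuous_on (sphere 0 (\<rho> s i)) u" if "u \<in> U" "s \<le> 4" for u s i
    by (rule good_radius_continuous[OF good[OF that]])
  have PU: "Pf \<in> U" and LU: "L \<in> U" and FU: "F \<in> U" and \<alpha>U: "\<alpha> \<in> U" and HU: "H \<in> U"
    using Pm Lm Fm \<alpha>m Hm by (auto simp: U_def U0_def)
  have vU: "v j \<in> U" if "j \<le> k" for j using that v0 by (auto simp: U_def U0_def)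
  have feU: "(\<lambda>z. f z - e) \<in> U" if "e \<in> Z" for e using that fe by (auto simp: U_def U0_def)

  \<comment> \<open>Characteristics of \<alpha> and of reciprocals\<close>
  have \<alpha>_negl: "negl T (\<lambda>i. nevanlinna_T (\<rho> s i) \<alpha>)" if s: "s \<le> 4" for s
    unfolding negl_def
  proof (intro allI impI)
    fix e :: real assume e: "0 < e"
    have "eventually (\<lambda>r. norm (nevanlinna_T r \<alpha>) \<le> e / 2 * norm (nevanlinna_T r f)) (inf at_top (principal (- E)))"
      by (rule landau_o.smallD[OF E(2)]) (use e in simp)
    then obtain r1 where r1: "\<And>r. r1 \<le> r \<Longrightarrow> r \<notin> E \<Longrightarrow> \<bar>nevanlinna_T r \<alpha>\<bar> \<le> e / 2 * \<bar>nevanlinna_T r f\<bar>"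
      by (auto simp: eventually_inf_principal eventually_at_top_linorder)
    from \<rho>_ev[OF s, of r1] show "eventually (\<lambda>i. nevanlinna_T (\<rho> s i) \<alpha> \<le> e * T i) sequentially"
    proof eventually_elim
      case (elim i)
      have "0 \<le> nevanlinna_T (\<rho> s i) f" by (intro nevanlinna_T_nonneg(1) f0 \<rho>_ge_1 s good fU)
      hence "\<bar>nevanlinna_T (\<rho> s i) \<alpha>\<bar> \<le> e / 2 * nevanlinna_T (\<rho> s i) f" using r1[OF elim \<rho>(2)[OF s]] by simp
      also have "\<dots> \<le> e / 2 * (2 * T i)" using Tle[OF s] e by (intro mult_left_mono) auto
      finally show ?case by simp
    qed
  qed
  have inv_le: "\<exists>c. \<forall>s\<le>4. \<forall>i. nevanlinna_T (\<rho> s i) (\<lambda>z. inverse (u z)) \<le> nevanlinna_T (\<rho> s i) u + c" if "u \<in> U" for u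
    using nevanlinna_T_controls[of u] that good \<rho>_ge_1 unfolding U_def by (smt (verit) mem_Collect_eq)
  obtain cL where cL: "\<And>s i. s \<le> 4 \<Longrightarrow> nevanlinna_T (\<rho> s i) (\<lambda>z. inverse (L z)) \<le> nevanlinna_T (\<rho> s i) L + cL"
    using inv_le[OF LU] by blast
  obtain c\<alpha> where c\<alpha>: "\<And>s i. s \<le> 4 \<Longrightarrow> nevanlinna_T (\<rho> s i) (\<lambda>z. inverse (\<alpha> z)) \<le> nevanlinna_T (\<rho> s i) \<alpha> + c\<alpha>"
    using inv_le[OF \<alpha>U] by blast
  have inv\<alpha>_negl: "negl T (\<lambda>i. nevanlinna_T (\<rho> s i) (\<lambda>z. inverse (\<alpha> z)))" if s: "s \<le> 4" for s
    by (rule negl_mono[OF negl_add[OF \<alpha>_negl[OF s] negl_const[OF T_top]]]) (rule c\<alpha>[OF s])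

  \<comment> \<open>Characteristic of L\<close>
  define cJ where "cJ = (\<Sum>j\<in>J. log_plus (norm (a j))) + ln (max 1 (real (card J)))"
  have TL: "nevanlinna_T (\<rho> s i) L \<le> (\<Sum>j\<in>J. nevanlinna_T (\<rho> s i) (v j)) + cJ" if s: "s \<le> 4" for s i
  proof -
    have cv: "continuous_on (sphere 0 (\<rho> s i)) (v j)" if "j \<in> J" for j using that s by (intro cont vU) (auto simp: J_def)
    have "nevanlinna_T (\<rho> s i) L \<le> (\<Sum>j\<in>J. nevanlinna_T (\<rho> s i) (\<lambda>z. a j * v j z)) + ln (max 1 (real (card J)))"
      unfolding L_eq
      by (rule nevanlinna_T_sum_le[OF finJ(1) av0])
         (use Lm[unfolded L_eq] s cv in \<open>auto intro!: \<rho>_ge_1 continuous_on_mult\<close>)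
    also have "(\<Sum>j\<in>J. nevanlinna_T (\<rho> s i) (\<lambda>z. a j * v j z)) \<le> (\<Sum>j\<in>J. log_plus (norm (a j)) + nevanlinna_T (\<rho> s i) (v j))"
      by (intro sum_mono nevanlinna_T_cmult_le \<rho>_ge_1 s cv v0) (auto simp: J_def)
    finally show ?thesis by (simp add: cJ_def sum.distrib)
  qed
  have L_dom: "dominated T (\<lambda>i. nevanlinna_T (\<rho> s i) L)" if s: "s \<le> 2" for s
  proof (rule dominated_mono[OF _ TL])
    show "dominated T (\<lambda>i. (\<Sum>j\<in>J. nevanlinna_T (\<rho> s i) (v j)) + cJ)"
      unfolding v_def
      by (intro dominated_rules dominated_sum[OF T_top finJ(1)] shift_T_dominated q good[OF vU, unfolded v_def])
         (use s in \<open>auto simp: J_def\<close>)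
  qed (use s in simp)
  \<comment> \<open>At most k + 1 shifts occur, each costing one T up to a negligible error. The
    sharp factor is wanted only at \<open>\<rho> 0\<close>; at the wider radii the bound O(T) above
    suffices.\<close>
  have L_negl: "negl T (\<lambda>i. nevanlinna_T (\<rho> 0 i) L - real (k + 1) * T i)"
  proof (rule negl_mono)
    show "negl T (\<lambda>i. (\<Sum>j\<in>J. nevanlinna_T (\<rho> 0 i) (v j) - nevanlinna_T (\<rho> 0 i) f) + cJ)"
      unfolding v_def
      by (intro negl_rules negl_sum[OF T_top finJ(1)] shift_T_negl q good[OF vU, unfolded v_def])
         (auto simp: J_def)
    fix i
    have "0 \<le> T i" unfolding T_def by (intro nevanlinna_T_nonneg(1) f0 \<rho>_ge_1 good fU) auto
    hence "real (card J) * T i \<le> real (k + 1) * T i" using finJ(2) by (intro mult_right_mono) linarith+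
    thus "nevanlinna_T (\<rho> 0 i) L - real (k + 1) * T i \<le> (\<Sum>j\<in>J. nevanlinna_T (\<rho> 0 i) (v j) - nevanlinna_T (\<rho> 0 i) f) + cJ"
      using TL[of 0 i] by (simp add: sum_subtractf T_def)
  qed

  \<comment> \<open>Characteristics of P(f) and F\<close>
  obtain CP where CP: "\<And>r. 1 \<le> r \<Longrightarrow> continuous_on (sphere 0 r) f \<Longrightarrow> nevanlinna_T r Pf \<le> real (degree P) * nevanlinna_T r f + CP"
    using nevanlinna_T_poly_upper[OF nc P] unfolding Pf_def[abs_def, symmetric] by blast
  obtain CP' where CP': "\<And>r. 1 \<le> r \<Longrightarrow> continuous_on (sphere 0 r) f \<Longrightarrow> real (degree P) * nevanlinna_T r f \<le> nevanlinna_T r Pf + CP'"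
    using nevanlinna_T_poly_lower[OF nc P] unfolding Pf_def[abs_def, symmetric] by blast
  have P_dom: "dominated T (\<lambda>i. nevanlinna_T (\<rho> s i) Pf)" if s: "s \<le> 4" for s
    by (rule dominated_mono[of T "\<lambda>i. real (degree P) * nevanlinna_T (\<rho> s i) f + CP"])
       (use s in \<open>auto intro!: dominated_rules dominated_T_f CP \<rho>_ge_1 cont fU\<close>)
  have F_dom: "dominated T (\<lambda>i. nevanlinna_T (\<rho> s i) F)" if s: "s \<le> 2" for s
  proof (rule dominated_mono)
    show "dominated T (\<lambda>i. nevanlinna_T (\<rho> s i) Pf + nevanlinna_T (\<rho> s i) L)"
      using s by (intro dominated_add P_dom L_dom) auto
    show "nevanlinna_T (\<rho> s i) F \<le> nevanlinna_T (\<rho> s i) Pf + nevanlinna_T (\<rho> s i) L" for i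
      unfolding F_def using s by (intro nevanlinna_T_mult_le Pm Lm \<rho>_ge_1 cont PU LU) auto
  qed
  \<comment> \<open>P(f) = F/L has characteristic at least n T up to a constant, and division by L
    costs at most T(r, L), which is (k + 1) T up to a negligible error.\<close>
  have F_lower: "negl T (\<lambda>i. (real (degree P) - real (k + 1)) * T i - nevanlinna_T (\<rho> 0 i) F)"
  proof (rule negl_mono)
    show "negl T (\<lambda>i. (nevanlinna_T (\<rho> 0 i) L - real (k + 1) * T i) + (cL + CP'))"
      by (intro negl_rules L_negl)
    fix i
    have r: "1 \<le> \<rho> 0 i" by (intro \<rho>_ge_1) simp
    have "nevanlinna_T (\<rho> 0 i) Pf = nevanlinna_T (\<rho> 0 i) (\<lambda>z. F z * inverse (L z))"
    proof (rule nevanlinna_T_cong[OF Pm])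
      show "\<forall>\<^sub>\<approx>z. Pf z = F z * inverse (L z)"
        using merom_nonzero_eventually[OF Lm] by eventually_elim (simp add: F_def)
      show "Pf z = F z * inverse (L z)" if "norm z = \<rho> 0 i" for z
        using good_radius_nonzero[OF good[OF LU, of 0] that] by (simp add: F_def)
    qed (use r in simp)
    also have "\<dots> \<le> nevanlinna_T (\<rho> 0 i) F + nevanlinna_T (\<rho> 0 i) (\<lambda>z. inverse (L z))"
      by (intro nevanlinna_T_mult_le Fm merom_nonzero_inverse Lm r cont FU good_radius_continuous good_radius_inverse good LU) auto
    finally have "nevanlinna_T (\<rho> 0 i) Pf \<le> nevanlinna_T (\<rho> 0 i) F + nevanlinna_T (\<rho> 0 i) L + cL"
      using cL[of 0 i] by simp
    thus "(real (degree P) - real (k + 1)) * T i - nevanlinna_T (\<rho> 0 i) F \<le> (nevanlinna_T (\<rho> 0 i) L - real (k + 1) * T i) + (cL + CP')"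
      using CP'[OF r cont[OF fU]] by (simp add: T_def left_diff_distrib)
  qed
  have F_not_negl: False if "negl T (\<lambda>i. nevanlinna_T (\<rho> 0 i) F)"
  proof (rule negl_contradiction[OF T_top])
    show "negl T (\<lambda>i. (real (degree P) - real (k + 1)) * T i)"
      using negl_add[OF F_lower that] by simp
  qed (use n in linarith)

  \<comment> \<open>F/\<alpha> is not constant\<close>
  have F\<alpha>: "F z = H z * \<alpha> z" if "\<alpha> z \<noteq> 0" for z using that by (simp add: H_def)
  have ncH: "nonconstant_mero H"
    unfolding nonconstant_mero_def
  proof
    fix d
    show "merom_nonzero (\<lambda>z. H z - d)"
      unfolding merom_nonzero_def nonzero_function_def
    proof (intro conjI notI)
      show "(\<lambda>z. H z - d) meromorphic_on UNIV" by (intro meromorphic_intros merom_nonzero_mero Hm)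
      assume H: "\<forall>\<^sub>\<approx>z. H z - d = 0"
      have eq: "\<forall>\<^sub>\<approx>z. F z = d * \<alpha> z"
        using H merom_nonzero_eventually[OF \<alpha>m] by eventually_elim (simp add: F\<alpha>)
      have d0: "d \<noteq> 0"
      proof
        assume "d = 0"
        hence "\<forall>\<^sub>\<approx>z. F z = 0" using eq by simp
        thus False using Fm by (simp add: merom_nonzero_def nonzero_function_def)
      qed
      \<comment> \<open>The identity is known off a sparse set; continuity on the good circle
        extends it to every point there, as \<open>nevanlinna_T_cong\<close> demands.\<close>
      have circ: "F z = d * \<alpha> z" if z: "norm z = \<rho> 0 i" for z i
      proof -
        have an: "F analytic_on {z}" "\<alpha> analytic_on {z}"
          using good[OF FU, of 0 i] good[OF \<alpha>U, of 0 i] z by (auto simp: good_radius_def regular_at_def)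
        have lim: "(F \<longlongrightarrow> F z) (at z)" "(\<alpha> \<longlongrightarrow> \<alpha> z) (at z)"
          using an analytic_at_imp_isCont isContD by blast+
        have "\<forall>\<^sub>F w in at z. F w = d * \<alpha> w"
          using eventually_cosparse_imp_eventually_at[OF eq, of z] by simp
        hence "((\<lambda>w. d * \<alpha> w) \<longlongrightarrow> F z) (at z)" by (rule Lim_transform_eventually[OF lim(1)])
        moreover have "((\<lambda>w. d * \<alpha> w) \<longlongrightarrow> d * \<alpha> z) (at z)" by (intro tendsto_mult tendsto_const lim)
        ultimately show ?thesis by (rule LIM_unique)
      qed
      have "negl T (\<lambda>i. nevanlinna_T (\<rho> 0 i) F)"
      proof (rule negl_mono)
        show "negl T (\<lambda>i. log_plus (norm d) + nevanlinna_T (\<rho> 0 i) \<alpha>)" by (intro negl_rules \<alpha>_negl) simp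
        fix i
        have "nevanlinna_T (\<rho> 0 i) F = nevanlinna_T (\<rho> 0 i) (\<lambda>z. d * \<alpha> z)"
          by (rule nevanlinna_T_cong[OF Fm eq _ circ]) (use \<rho>_ge_1[of 0 i] in simp)
        also have "\<dots> \<le> log_plus (norm d) + nevanlinna_T (\<rho> 0 i) \<alpha>"
          by (intro nevanlinna_T_cmult_le d0 \<alpha>m \<rho>_ge_1 cont \<alpha>U) auto
        finally show "nevanlinna_T (\<rho> 0 i) F \<le> log_plus (norm d) + nevanlinna_T (\<rho> 0 i) \<alpha>" .
      qed
      thus False by (rule F_not_negl)
    qed
  qed

  \<comment> \<open>F - \<alpha> and its finitely many zeros\<close>
  have H1m: "merom_nonzero (\<lambda>z. H z - 1)" by (rule nonconstant_meroD[OF ncH])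
  have dHm: "merom_nonzero (deriv H)" by (rule merom_nonzero_deriv[OF ncH])
  have Gm: "merom_nonzero G"
  proof (rule merom_nonzero_cong)
    show "merom_nonzero (\<lambda>z. \<alpha> z * (H z - 1))" by (rule merom_nonzero_mult[OF \<alpha>m H1m])
    show "\<forall>\<^sub>\<approx>z. \<alpha> z * (H z - 1) = G z"
      using merom_nonzero_eventually[OF \<alpha>m] by eventually_elim (simp add: G_def H_def algebra_simps)
  qed
  have GU: "G \<in> U" and H1U: "(\<lambda>z. H z - 1) \<in> U" and dHU: "deriv H \<in> U"
    using Gm H1m dHm by (auto simp: U_def U0_def)
  have finG: "finite {z. isolated_zero G z}" using fin by (simp add: G_def[abs_def] F_def Pf_def L_def)
  obtain KG where KG: "0 \<le> KG" "\<And>r. 1 \<le> r \<Longrightarrow> nevanlinna_N r (\<lambda>z. inverse (G z)) \<le> KG * (1 + ln r)"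
    using zero_mult_cofinite_log_bound[OF Gm finG] by blast
  have NG: "negl T (\<lambda>i. nevanlinna_N (\<rho> 0 i) (\<lambda>z. inverse (G z)))"
    by (rule negl_mono[of T "\<lambda>i. KG * (1 + ln (\<rho> 0 i))"])
       (use KG in \<open>auto intro!: negl_rules ln_negl \<rho>_ge_1\<close>)

  \<comment> \<open>The entire case\<close>
  show "\<not> f holomorphic_on UNIV"
  proof
    assume hol: "f holomorphic_on UNIV"
    have hv: "v j holomorphic_on UNIV" for j
    proof -
      have "(\<lambda>z. q j * z + c j) holomorphic_on UNIV" by (intro holomorphic_intros)
      hence "f \<circ> (\<lambda>z. q j * z + c j) holomorphic_on UNIV"
        by (rule holomorphic_on_compose) (rule holomorphic_on_subset[OF hol], simp)
      thus ?thesis by (simp add: o_def v_def[abs_def])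
    qed
    have "(\<lambda>z. (\<Sum>j\<in>J. a j * v j z)) holomorphic_on UNIV"
      by (intro holomorphic_on_sum holomorphic_on_mult holomorphic_on_const hv)
    moreover have "Pf holomorphic_on UNIV"
    proof -
      have "poly P holomorphic_on UNIV" by (intro holomorphic_intros)
      hence "poly P \<circ> f holomorphic_on UNIV"
        by (intro holomorphic_on_compose[OF hol]) (rule holomorphic_on_subset, auto)
      thus ?thesis by (simp add: o_def Pf_def[abs_def])
    qed
    ultimately have "F holomorphic_on UNIV"
      unfolding F_def[abs_def] L_eq by (intro holomorphic_on_mult)
    hence Fan: "F analytic_on {z}" for z by (simp add: holomorphic_on_imp_analytic_at)
    have NF: "nevanlinna_N r F = 0" if "0 < r" for r
    proof -
      have "pole_mult F z = 0" for z using zorder_nonneg_analytic[OF Fm Fan] by (simp add: pole_mult_def)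
      thus ?thesis using that by (simp add: nevanlinna_N_log_count[OF Fm] log_count_def)
    qed
    have m\<alpha>: "merom_nonzero (\<lambda>z. - \<alpha> z)" by (rule merom_nonzero_uminus[OF \<alpha>m])
    \<comment> \<open>F is entire here, so F - \<alpha> has poles only where \<alpha> does. Together
      with its finitely many zeros this makes \<open>balanced_negl\<close> applicable.\<close>
    have NG': "negl T (\<lambda>i. nevanlinna_N (\<rho> 0 i) G)"
    proof (rule negl_mono[OF \<alpha>_negl[of 0]])
      fix i
      have r: "1 \<le> \<rho> 0 i" by (intro \<rho>_ge_1) simp
      have "nevanlinna_N (\<rho> 0 i) (\<lambda>z. \<Sum>b\<in>{True, False}. (if b then F else (\<lambda>z. - \<alpha> z)) z) \<le>
          (\<Sum>b\<in>{True, False}. nevanlinna_N (\<rho> 0 i) (if b then F else (\<lambda>z. - \<alpha> z)))"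
        by (rule nevanlinna_N_sum_le) (use Fm m\<alpha> Gm r in \<open>auto simp: G_def[abs_def]\<close>)
      hence "nevanlinna_N (\<rho> 0 i) G \<le> nevanlinna_N (\<rho> 0 i) (\<lambda>z. - \<alpha> z)"
        using r NF by (simp add: G_def[abs_def])
      also have "\<dots> = nevanlinna_N (\<rho> 0 i) \<alpha>"
        using r by (simp add: nevanlinna_N_log_count \<alpha>m m\<alpha> pole_mult_uminus)
      also have "\<dots> \<le> nevanlinna_T (\<rho> 0 i) \<alpha>" by (intro nevanlinna_T_nonneg \<alpha>m r good \<alpha>U) simp
      finally show "nevanlinna_N (\<rho> 0 i) G \<le> nevanlinna_T (\<rho> 0 i) \<alpha>" .
    qed simp
    have G_dom: "dominated T (\<lambda>i. nevanlinna_T (\<rho> s i) G)" if s: "s \<le> 2" for s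
    proof (rule dominated_mono)
      show "dominated T (\<lambda>i. nevanlinna_T (\<rho> s i) F + nevanlinna_T (\<rho> s i) \<alpha> + ln 2)"
        using s by (intro dominated_rules F_dom negl_imp_dominated \<alpha>_negl) auto
      show "nevanlinna_T (\<rho> s i) G \<le> nevanlinna_T (\<rho> s i) F + nevanlinna_T (\<rho> s i) \<alpha> + ln 2" for i
        unfolding G_def using s Gm
        by (intro nevanlinna_T_diff_le Fm \<alpha>m \<rho>_ge_1 cont FU \<alpha>U) (auto simp: G_def[abs_def])
    qed
    have TG: "negl T (\<lambda>i. nevanlinna_T (\<rho> 0 i) G)"
      by (rule balanced_negl[OF Gm good[OF GU] _ _ NG' NG]) (auto intro: G_dom)
    have "negl T (\<lambda>i. nevanlinna_T (\<rho> 0 i) F)"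
    proof (rule negl_mono)
      show "negl T (\<lambda>i. nevanlinna_T (\<rho> 0 i) G + nevanlinna_T (\<rho> 0 i) \<alpha> + ln 2)"
        by (intro negl_rules TG \<alpha>_negl) simp
      fix i
      have "F = (\<lambda>z. G z + \<alpha> z)" by (simp add: G_def fun_eq_iff)
      hence "nevanlinna_T (\<rho> 0 i) F = nevanlinna_T (\<rho> 0 i) (\<lambda>z. G z + \<alpha> z)" by (rule arg_cong)
      also have "\<dots> \<le> nevanlinna_T (\<rho> 0 i) G + nevanlinna_T (\<rho> 0 i) \<alpha> + ln 2"
        using Fm by (intro nevanlinna_T_add_le Gm \<alpha>m \<rho>_ge_1 cont GU \<alpha>U) (auto simp: G_def)
      finally show "nevanlinna_T (\<rho> 0 i) F \<le> nevanlinna_T (\<rho> 0 i) G + nevanlinna_T (\<rho> 0 i) \<alpha> + ln 2" .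
    qed
    thus False by (rule F_not_negl)
  qed

  \<comment> \<open>The meromorphic case, by the second main theorem for F/\<alpha>\<close>
  show "degree P \<le> card {z. poly P z = 0} + 3 * k + 4"
  proof -
    have H_dom: "dominated T (\<lambda>i. nevanlinna_T (\<rho> s i) H)" if s: "s \<le> 2" for s
    proof (rule dominated_mono)
      show "dominated T (\<lambda>i. nevanlinna_T (\<rho> s i) F + nevanlinna_T (\<rho> s i) (\<lambda>z. inverse (\<alpha> z)))"
        using s by (intro dominated_add F_dom negl_imp_dominated inv\<alpha>_negl) auto
      show "nevanlinna_T (\<rho> s i) H \<le> nevanlinna_T (\<rho> s i) F + nevanlinna_T (\<rho> s i) (\<lambda>z. inverse (\<alpha> z))" for i
        unfolding H_def divide_inverse using s
        by (intro nevanlinna_T_mult_le Fm merom_nonzero_inverse \<alpha>m \<rho>_ge_1 cont FU good_radius_continuous good_radius_inverse good \<alpha>U) auto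
    qed
    have H1_dom: "dominated T (\<lambda>i. nevanlinna_T (\<rho> s i) (\<lambda>z. H z - 1))" if s: "s \<le> 2" for s
    proof (rule dominated_mono)
      show "dominated T (\<lambda>i. nevanlinna_T (\<rho> s i) H + (log_plus (norm (1::complex)) + ln 2))"
        by (intro dominated_rules H_dom s)
      show "nevanlinna_T (\<rho> s i) (\<lambda>z. H z - 1) \<le> nevanlinna_T (\<rho> s i) H + (log_plus (norm (1::complex)) + ln 2)" for i
        using s by (intro nevanlinna_T_diff_const_le ncH \<rho>_ge_1 cont HU) auto
    qed
    have mA: "negl T (\<lambda>i. nevanlinna_m (\<rho> 0 i) (\<lambda>z. deriv H z / H z))"
      by (rule logderiv_negl[OF Hm good[OF HU]]) (auto intro: H_dom cont dHU)
    have mB: "negl T (\<lambda>i. nevanlinna_m (\<rho> 0 i) (\<lambda>z. deriv H z / (H z - 1)))"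
    proof -
      have dd: "deriv (\<lambda>z. H z - 1) z = deriv H z" if "norm z = \<rho> 0 i" for z i
        by (rule deriv_diff_const_good[OF good[OF HU] that]) simp
      have "negl T (\<lambda>i. nevanlinna_m (\<rho> 0 i) (\<lambda>z. deriv (\<lambda>z. H z - 1) z / (H z - 1)))"
      proof (rule logderiv_negl[OF H1m good[OF H1U]])
        fix i
        have "continuous_on (sphere 0 (\<rho> 0 i)) (deriv H)" by (intro cont dHU) simp
        thus "continuous_on (sphere 0 (\<rho> 0 i)) (deriv (\<lambda>z. H z - 1))"
          by (rule continuous_on_eq) (simp add: dd)
      qed (auto intro: H1_dom)
      moreover have "nevanlinna_m (\<rho> 0 i) (\<lambda>z. deriv (\<lambda>z. H z - 1) z / (H z - 1)) = nevanlinna_m (\<rho> 0 i) (\<lambda>z. deriv H z / (H z - 1))" for i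
        unfolding nevanlinna_m_circle_mean
        by (rule circle_mean_cong) (use \<rho>_ge_1[of 0 i] dd in auto)
      ultimately show ?thesis by simp
    qed
    obtain CH where CH: "\<And>r. \<lbrakk>1 \<le> r; good_radius H r; good_radius (\<lambda>z. H z - 1) r; good_radius (deriv H) r\<rbrakk> \<Longrightarrow>
      nevanlinna_T r H \<le> log_count r (\<lambda>a. of_bool (zorder H a \<noteq> 0) + zero_mult (\<lambda>z. H z - 1) a)
        + nevanlinna_m r (\<lambda>z. deriv H z / H z) + 2 * nevanlinna_m r (\<lambda>z. deriv H z / (H z - 1)) + CH"
      using second_main_theorem[OF ncH dHm] by blast
    \<comment> \<open>The constant of the first main theorem depends on the root e; it is chosen as
      a function of e so that it can be summed over all roots.\<close>
    define ce where "ce e = (SOME c. \<forall>s\<le>4. \<forall>i. nevanlinna_T (\<rho> s i) (\<lambda>z. inverse (f z - e)) \<le> nevanlinna_T (\<rho> s i) (\<lambda>z. f z - e) + c)" for e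
    have ce: "nevanlinna_T (\<rho> s i) (\<lambda>z. inverse (f z - e)) \<le> nevanlinna_T (\<rho> s i) (\<lambda>z. f z - e) + ce e" if "e \<in> Z" "s \<le> 4" for e s i
      using someI_ex[OF inv_le[OF feU[OF that(1)]]] that(2) unfolding ce_def by blast
    \<comment> \<open>A zero or pole of H = P(f) L / \<alpha> is one of P(f), L or \<alpha>. The
      zeros of H - 1 = G/\<alpha> are bounded by zeros of G and poles of \<alpha>, so the poles of
      \<alpha> occur twice.\<close>
    define w where "w b = (pole_mult f b + (\<Sum>e\<in>Z. zero_mult (\<lambda>z. f z - e) b)) + ((pole_mult L b + zero_mult L b)
        + ((zero_mult \<alpha> b + 2 * pole_mult \<alpha> b) + zero_mult G b))" for b
    have ordH: "zorder H b = zorder Pf b + zorder L b - zorder \<alpha> b" for b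
      unfolding H_def F_def by (simp add: zorder_mero_divide zorder_mero_mult merom_nonzero_mult Pm Lm \<alpha>m)
    have ordH1: "zorder (\<lambda>z. H z - 1) b = zorder G b - zorder \<alpha> b" for b
    proof -
      have "\<forall>\<^sub>\<approx>z. H z - 1 = G z / \<alpha> z"
        using merom_nonzero_eventually[OF \<alpha>m] by eventually_elim (simp add: G_def H_def field_simps)
      hence "zorder (\<lambda>z. H z - 1) b = zorder (\<lambda>z. G z / \<alpha> z) b"
        by (intro zorder_cong) (auto dest: eventually_cosparse_imp_eventually_at[of _ _ b UNIV])
      thus ?thesis by (simp add: zorder_mero_divide Gm \<alpha>m)
    qed
    have le_w: "of_bool (zorder H b \<noteq> 0) + zero_mult (\<lambda>z. H z - 1) b \<le> w b" for b
    proof -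
      have "of_bool (zorder Pf b \<noteq> 0) \<le> pole_mult f b + (\<Sum>e\<in>Z. zero_mult (\<lambda>z. f z - e) b)"
        using zorder_poly_comp_ne0[OF nc P, of b] by (simp add: Pf_def[abs_def] Z_def)
      moreover have "of_bool (zorder L b \<noteq> 0) \<le> pole_mult L b + zero_mult L b"
        "of_bool (zorder \<alpha> b \<noteq> 0) \<le> pole_mult \<alpha> b + zero_mult \<alpha> b"
        by (auto simp: pole_mult_def zero_mult_def)
      moreover have "of_bool (zorder H b \<noteq> 0) \<le> of_bool (zorder Pf b \<noteq> 0) + of_bool (zorder L b \<noteq> 0) + (of_bool (zorder \<alpha> b \<noteq> 0) :: real)"
        by (auto simp: ordH)
      moreover have "zero_mult (\<lambda>z. H z - 1) b \<le> zero_mult G b + pole_mult \<alpha> b"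
        by (simp add: zero_mult_def pole_mult_def ordH1)
      ultimately show ?thesis unfolding w_def by linarith
    qed
    note lf = loc_finite_pole_mult loc_finite_zero_mult
    have lfw: "loc_finite (\<lambda>b. zero_mult \<alpha> b + 2 * pole_mult \<alpha> b)"
      by (intro loc_finite_add lf \<alpha>m loc_finite_subset[OF loc_finite_pole_mult[OF \<alpha>m]]) simp
    \<comment> \<open>The coefficient collects 1 from the poles of f, one for each root of P, and 2
      (k + 1) from the zeros and poles of L; everything else is negligible.\<close>
    have T_upper: "negl T (\<lambda>i. nevanlinna_T (\<rho> 0 i) H - (real (card Z) + 2 * real k + 3) * T i)"
    proof (rule negl_mono)
      let ?X = "\<lambda>i. 2 * (nevanlinna_T (\<rho> 0 i) L - real (k + 1) * T i) + (nevanlinna_T (\<rho> 0 i) (\<lambda>z. inverse (\<alpha> z)) + 2 * nevanlinna_T (\<rho> 0 i) \<alpha>)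
        + nevanlinna_N (\<rho> 0 i) (\<lambda>z. inverse (G z)) + nevanlinna_m (\<rho> 0 i) (\<lambda>z. deriv H z / H z) + 2 * nevanlinna_m (\<rho> 0 i) (\<lambda>z. deriv H z / (H z - 1))
        + (CH + cL + (\<Sum>e\<in>Z. log_plus (norm e) + ln 2 + ce e))"
      show "negl T ?X"
        by (intro negl_rules L_negl \<alpha>_negl inv\<alpha>_negl NG mA mB) auto
      fix i
      let ?r = "\<rho> 0 i"
      have r: "1 \<le> ?r" "0 < ?r" using \<rho>_ge_1[of 0 i] by auto
      have g: "u \<in> U \<Longrightarrow> good_radius u ?r" for u by (rule good) auto
      have "log_count ?r (\<lambda>b. of_bool (zorder H b \<noteq> 0) + zero_mult (\<lambda>z. H z - 1) b) \<le> log_count ?r w"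
      proof (rule log_count_mono[OF r(1) _ le_w])
        show "loc_finite w" unfolding w_def[abs_def]
          by (intro loc_finite_add loc_finite_sum lf lfw f0 fe Lm Gm)
        show "loc_finite (\<lambda>b. of_bool (zorder H b \<noteq> 0) + zero_mult (\<lambda>z. H z - 1) b)"
          by (intro loc_finite_add lf H1m loc_finite_subset[OF loc_finite_zorder[OF Hm]]) simp
      qed
      also have "log_count ?r w = (nevanlinna_N ?r f + (\<Sum>e\<in>Z. nevanlinna_N ?r (\<lambda>z. inverse (f z - e)))) +
          ((nevanlinna_N ?r L + nevanlinna_N ?r (\<lambda>z. inverse (L z))) +
           ((nevanlinna_N ?r (\<lambda>z. inverse (\<alpha> z)) + 2 * nevanlinna_N ?r \<alpha>) + nevanlinna_N ?r (\<lambda>z. inverse (G z))))"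
        unfolding w_def[abs_def] using r finZ
        by (simp add: log_count_add log_count_sum log_count_cmult loc_finite_add loc_finite_sum lf lfw f0 fe Lm Gm \<alpha>m
            loc_finite_subset[OF loc_finite_pole_mult[OF \<alpha>m]]
            nevanlinna_N_log_count nevanlinna_N_inverse)
      also have "\<dots> \<le> (T i + (\<Sum>e\<in>Z. T i + (log_plus (norm e) + ln 2 + ce e))) +
          ((nevanlinna_T ?r L + (nevanlinna_T ?r L + cL)) +
           ((nevanlinna_T ?r (\<lambda>z. inverse (\<alpha> z)) + 2 * nevanlinna_T ?r \<alpha>) + nevanlinna_N ?r (\<lambda>z. inverse (G z))))"
      proof (intro add_mono sum_mono mult_left_mono order_refl)
        show "nevanlinna_N ?r f \<le> T i" unfolding T_def by (intro nevanlinna_T_nonneg f0 r g fU)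
        show "nevanlinna_N ?r L \<le> nevanlinna_T ?r L" by (intro nevanlinna_T_nonneg Lm r g LU)
        show "nevanlinna_N ?r \<alpha> \<le> nevanlinna_T ?r \<alpha>" by (intro nevanlinna_T_nonneg \<alpha>m r g \<alpha>U)
        show "nevanlinna_N ?r (\<lambda>z. inverse (\<alpha> z)) \<le> nevanlinna_T ?r (\<lambda>z. inverse (\<alpha> z))"
          by (intro nevanlinna_T_nonneg merom_nonzero_inverse good_radius_inverse \<alpha>m r g \<alpha>U)
        have "nevanlinna_N ?r (\<lambda>z. inverse (L z)) \<le> nevanlinna_T ?r (\<lambda>z. inverse (L z))"
          by (intro nevanlinna_T_nonneg merom_nonzero_inverse good_radius_inverse Lm r g LU)
        thus "nevanlinna_N ?r (\<lambda>z. inverse (L z)) \<le> nevanlinna_T ?r L + cL" using cL[of 0 i] by simp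
        fix e assume e: "e \<in> Z"
        have "nevanlinna_N ?r (\<lambda>z. inverse (f z - e)) \<le> nevanlinna_T ?r (\<lambda>z. inverse (f z - e))"
          by (intro nevanlinna_T_nonneg merom_nonzero_inverse good_radius_inverse fe r g feU e)
        also have "\<dots> \<le> nevanlinna_T ?r (\<lambda>z. f z - e) + ce e" by (rule ce[OF e]) simp
        also have "nevanlinna_T ?r (\<lambda>z. f z - e) \<le> T i + (log_plus (norm e) + ln 2)"
          unfolding T_def by (intro nevanlinna_T_diff_const_le nc r cont fU) simp
        finally show "nevanlinna_N ?r (\<lambda>z. inverse (f z - e)) \<le> T i + (log_plus (norm e) + ln 2 + ce e)" by simp
      qed simp
      finally have "log_count ?r (\<lambda>b. of_bool (zorder H b \<noteq> 0) + zero_mult (\<lambda>z. H z - 1) b) \<le> \<dots>" .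
      moreover have "(\<Sum>e\<in>Z. T i + (log_plus (norm e) + ln 2 + ce e)) = real (card Z) * T i + (\<Sum>e\<in>Z. log_plus (norm e) + ln 2 + ce e)"
        by (simp add: sum.distrib)
      ultimately show "nevanlinna_T ?r H - (real (card Z) + 2 * real k + 3) * T i \<le> ?X i"
        using CH[OF r(1) g[OF HU] g[OF H1U] g[OF dHU]] by (simp add: algebra_simps)
    qed
    \<comment> \<open>As F = H \<alpha>, T(r, F) is at most T(r, H) up to a negligible term, so the
      lower bound for F meets the upper bound for H. The coefficient of T cannot be positive, which
      says n <= m + 3 k + 4.\<close>
    have "negl T (\<lambda>i. (real (degree P) - real (k + 1) - (real (card Z) + 2 * real k + 3)) * T i)"
    proof (rule negl_mono)
      show "negl T (\<lambda>i. ((real (degree P) - real (k + 1)) * T i - nevanlinna_T (\<rho> 0 i) F) +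
          (nevanlinna_T (\<rho> 0 i) H - (real (card Z) + 2 * real k + 3) * T i) + nevanlinna_T (\<rho> 0 i) \<alpha>)"
        by (intro negl_rules F_lower T_upper \<alpha>_negl) simp
      fix i
      have "nevanlinna_T (\<rho> 0 i) F = nevanlinna_T (\<rho> 0 i) (\<lambda>z. H z * \<alpha> z)"
      proof (rule nevanlinna_T_cong[OF Fm])
        show "\<forall>\<^sub>\<approx>z. F z = H z * \<alpha> z"
          using merom_nonzero_eventually[OF \<alpha>m] by eventually_elim (rule F\<alpha>)
        show "F z = H z * \<alpha> z" if "norm z = \<rho> 0 i" for z
          by (rule F\<alpha>) (rule good_radius_nonzero[OF good[OF \<alpha>U, of 0] that], simp)
      qed (use \<rho>_ge_1[of 0 i] in simp)
      also have "\<dots> \<le> nevanlinna_T (\<rho> 0 i) H + nevanlinna_T (\<rho> 0 i) \<alpha>"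
        by (intro nevanlinna_T_mult_le Hm \<alpha>m \<rho>_ge_1 cont HU \<alpha>U) auto
      finally show "(real (degree P) - real (k + 1) - (real (card Z) + 2 * real k + 3)) * T i \<le>
         ((real (degree P) - real (k + 1)) * T i - nevanlinna_T (\<rho> 0 i) F) +
          (nevanlinna_T (\<rho> 0 i) H - (real (card Z) + 2 * real k + 3) * T i) + nevanlinna_T (\<rho> 0 i) \<alpha>"
        by (simp add: algebra_simps)
    qed
    hence "\<not> 0 < real (degree P) - real (k + 1) - (real (card Z) + 2 * real k + 3)"
      using negl_contradiction[OF T_top] by blast
    thus ?thesis unfolding Z_def by linarith
  qed
qed

theorem theorem2p1:
  fixes k n m :: nat
    and P :: "complex poly"
    and f \<alpha> :: "complex \<Rightarrow> complex"
    and a c q :: "nat \<Rightarrow> complex"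
  assumes "P \<noteq> 0" and "degree P = n"
    and "m = card {z. poly P z = 0}"
    and "zero_order f"
    and "small_function \<alpha> f" and "nonzero_function \<alpha>"
    and "\<forall>j\<le>k. q j \<noteq> 0"
    and "nonzero_function (L_op k a q c f)"
  shows "(transcendental_meromorphic f \<and> n > m + 3 * k + 4 \<longrightarrow>
            has_infinitely_many_zeros (\<lambda>z. poly P (f z) * L_op k a q c f z - \<alpha> z)) \<and>
         (transcendental_entire f \<and> n > m + k \<longrightarrow>
            has_infinitely_many_zeros (\<lambda>z. poly P (f z) * L_op k a q c f z - \<alpha> z))"
proof (intro conjI impI; elim conjE)
  assume f: "transcendental_meromorphic f" and n: "n > m + 3 * k + 4"
  show "has_infinitely_many_zeros (\<lambda>z. poly P (f z) * L_op k a q c f z - \<alpha> z)"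
    unfolding has_infinitely_many_zeros_def
  proof
    assume fin: "finite {z. isolated_zero (\<lambda>z. poly P (f z) * L_op k a q c f z - \<alpha> z) z}"
    have "degree P \<le> card {z. poly P z = 0} + 3 * k + 4"
      by (rule few_zeros_bounds(1)[OF assms(1,4,5,6) _ assms(8) f fin]) (use assms n in auto)
    thus False using n assms by simp
  qed
next
  assume f: "transcendental_entire f" and n: "n > m + k"
  \<comment> \<open>A nonconstant P has a root, so m >= 1, and n > m + k becomes n >= k + 2.\<close>
  have "\<not> constant (poly P)" using n assms constant_degree[of P] by simp
  then obtain e where "poly P e = 0" using fundamental_theorem_of_algebra by blast
  moreover have "finite {z. poly P z = 0}" using assms(1) by (rule poly_roots_finite)
  ultimately have "1 \<le> m" using assms(3) by (auto simp: Suc_le_eq card_gt_0_iff)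
  show "has_infinitely_many_zeros (\<lambda>z. poly P (f z) * L_op k a q c f z - \<alpha> z)"
    unfolding has_infinitely_many_zeros_def
  proof
    assume fin: "finite {z. isolated_zero (\<lambda>z. poly P (f z) * L_op k a q c f z - \<alpha> z) z}"
    have "\<not> f holomorphic_on UNIV"
      by (rule few_zeros_bounds(2)[OF assms(1,4,5,6) _ assms(8) _ fin])
         (use assms f n \<open>1 \<le> m\<close> in \<open>auto simp: transcendental_entire_def\<close>)
    thus False using f by (simp add: transcendental_entire_def)
  qed
qed

end
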